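(* Let $D\subset\mathbb{R}^d$ be a Lipschitz domain, let $a,b\in\mathcal{A}_1$, let $f\in L_\infty(D)$ with $f\ge c_f>0$ on $D$, and let $u_a,u_b\in H^1_0(D)$ be the corresponding weak solutions (right side $f$, diffusion coefficients $a$ and $b$). Then $$\|a-b\|_{L_2(D)}\le C\sqrt{1+C_0}\,\|u_a-u_b\|_{H^1_0(D)}^{1/6},$$ where $$C_0:=C_1\|f\|_{L_\infty(D)}\bigl(1+\max\{\|\nabla a\|_{L_2(D)},\|\nabla b\|_{L_2(D)}\}\bigr),$$ $C_1$ is a constant depending only on $D,d,\lambda,\Lambda$, and $C$ is a constant depending only on $D,d,\lambda,\Lambda$ and $c_f$.
   Context: $D\subset\mathbb{R}^d$, $d\ge 2$, is a bounded domain (open, connected). $\lambda,\Lambda$ are fixed positive constants and $\mathcal{A}:=\{a\in L_\infty(D):\lambda\le a\le\Lambda\}$. For $s>0$, $\mathcal{A}_s:=\{a\in\mathcal{A}:\|a\|_{H^s(D)}\le M\}$, where $M>0$ is arbitrary but fixed. $H^1_0(D)$ is equipped with the norm $\|v\|_{H^1_0(D)}=\|\nabla v\|_{L_2(D)}$. For $a\in\mathcal{A}$ and $f\in H^{-1}(D)$ (the dual of $H^1_0(D)$), $u_a\in H^1_0(D)$ is the unique weak solution of $-\mathrm{div}(a\nabla u_a)=f$ on $D$, $u_a=0$ on $\partial D$, i.e. $\int_D a\nabla u_a\cdot\nabla v=\langle f,v\rangle_{H^{-1}(D),H^1_0(D)}$ for all $v\in H^1_0(D)$. *)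

theory Defs
  imports "HOL-Analysis.Analysis" "HOL-Probability.Essential_Supremum"
begin

text \<open>
  Functions on a set \<open>D\<close> are represented by total functions; all notions below that depend on
  measure or integration refer to \<open>lebesgue_on D\<close>, so the values outside \<open>D\<close>
  and on null sets are irrelevant.
\<close>

subsection \<open>Lipschitz domains\<close>

definition bounded_domain :: "'a::euclidean_space set \<Rightarrow> bool" where
  "bounded_domain D \<longleftrightarrow> open D \<and> connected D \<and> bounded D \<and> D \<noteq> {}"

text \<open>
  Near each boundary point, \<open>D\<close> is the strict epigraph of a Lipschitz function over a hyperplane
  through the origin with unit normal \<open>e\<close>: \<open>x \<bullet> e\<close> is the coordinate along \<open>e\<close> and
  \<open>x - (x \<bullet> e) *\<^sub>R e\<close> is the orthogonal projection of \<open>x\<close> to the hyperplane.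
\<close>

definition lipschitz_domain :: "'a::euclidean_space set \<Rightarrow> bool" where
  "lipschitz_domain D \<longleftrightarrow> bounded_domain D \<and>
     (\<forall>p\<in>frontier D. \<exists>r>0. \<exists>e. \<exists>\<gamma>::'a \<Rightarrow> real. \<exists>L. norm e = 1 \<and>
        lipschitz_on L {y. y \<bullet> e = 0} \<gamma> \<and>
        D \<inter> ball p r = {x \<in> ball p r. \<gamma> (x - (x \<bullet> e) *\<^sub>R e) < x \<bullet> e})"

subsection \<open>Lebesgue spaces\<close>

definition L2 :: "'a::euclidean_space set \<Rightarrow> ('a \<Rightarrow> 'b::euclidean_space) set" where
  "L2 D = {u. u \<in> borel_measurable (lebesgue_on D) \<and>
              integrable (lebesgue_on D) (\<lambda>x. (norm (u x))\<^sup>2)}"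

definition L2_norm :: "'a::euclidean_space set \<Rightarrow> ('a \<Rightarrow> 'b::euclidean_space) \<Rightarrow> real" where
  "L2_norm D u = sqrt (LINT x|lebesgue_on D. (norm (u x))\<^sup>2)"

definition Linf :: "'a::euclidean_space set \<Rightarrow> ('a \<Rightarrow> real) set" where
  "Linf D = {u. u \<in> borel_measurable (lebesgue_on D) \<and>
                esssup (lebesgue_on D) (\<lambda>x. ereal \<bar>u x\<bar>) < \<infinity>}"

definition Linf_norm :: "'a::euclidean_space set \<Rightarrow> ('a \<Rightarrow> real) \<Rightarrow> real" where
  "Linf_norm D u = real_of_ereal (esssup (lebesgue_on D) (\<lambda>x. ereal \<bar>u x\<bar>))"

subsection \<open>Test functions\<close>

text \<open>\<open>partial i \<phi>\<close> is the classical partial derivative in the direction of the basis vector \<open>i\<close>.\<close>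

definition partial :: "'a::euclidean_space \<Rightarrow> ('a \<Rightarrow> real) \<Rightarrow> 'a \<Rightarrow> real" where
  "partial i \<phi> x = frechet_derivative \<phi> (at x) i"

fun Ck :: "nat \<Rightarrow> ('a::euclidean_space \<Rightarrow> real) \<Rightarrow> bool" where
  "Ck 0 \<phi> \<longleftrightarrow> continuous_on UNIV \<phi>"
| "Ck (Suc k) \<phi> \<longleftrightarrow> (\<forall>x. \<phi> differentiable (at x)) \<and> (\<forall>i\<in>Basis. Ck k (partial i \<phi>))"

definition test_functions :: "'a::euclidean_space set \<Rightarrow> ('a \<Rightarrow> real) set" where
  "test_functions D = {\<phi>. (\<forall>k. Ck k \<phi>) \<and>
     compact (closure {x. \<phi> x \<noteq> 0}) \<and> closure {x. \<phi> x \<noteq> 0} \<subseteq> D}"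

subsection \<open>Sobolev spaces\<close>

definition has_weak_gradient ::
    "'a::euclidean_space set \<Rightarrow> ('a \<Rightarrow> real) \<Rightarrow> ('a \<Rightarrow> 'a) \<Rightarrow> bool" where
  "has_weak_gradient D u g \<longleftrightarrow> u \<in> L2 D \<and> g \<in> L2 D \<and>
     (\<forall>\<phi>\<in>test_functions D. \<forall>i\<in>Basis.
        (LINT x|lebesgue_on D. u x * partial i \<phi> x) = - (LINT x|lebesgue_on D. (g x \<bullet> i) * \<phi> x))"

definition H1 :: "'a::euclidean_space set \<Rightarrow> ('a \<Rightarrow> real) set" where
  "H1 D = {u. \<exists>g. has_weak_gradient D u g}"

text \<open>
  The weak gradient is unique up to null sets, so \<open>weak_grad\<close> selects a representative;
  it is only meaningful for \<open>u \<in> H1 D\<close>.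
\<close>

definition weak_grad :: "'a::euclidean_space set \<Rightarrow> ('a \<Rightarrow> real) \<Rightarrow> 'a \<Rightarrow> 'a" where
  "weak_grad D u = (SOME g. has_weak_gradient D u g)"

definition H1_norm :: "'a::euclidean_space set \<Rightarrow> ('a \<Rightarrow> real) \<Rightarrow> real" where
  "H1_norm D u = sqrt ((L2_norm D u)\<^sup>2 + (L2_norm D (weak_grad D u))\<^sup>2)"

definition H10 :: "'a::euclidean_space set \<Rightarrow> ('a \<Rightarrow> real) set" where
  "H10 D = {u \<in> H1 D. \<exists>\<phi>. (\<forall>n. \<phi> n \<in> test_functions D) \<and>
                          (\<lambda>n. H1_norm D (\<lambda>x. \<phi> n x - u x)) \<longlonglongrightarrow> 0}"

definition H10_norm :: "'a::euclidean_space set \<Rightarrow> ('a \<Rightarrow> real) \<Rightarrow> real" where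
  "H10_norm D u = L2_norm D (weak_grad D u)"

subsection \<open>The diffusion problem\<close>

definition coeffs :: "'a::euclidean_space set \<Rightarrow> real \<Rightarrow> real \<Rightarrow> ('a \<Rightarrow> real) set" where
  "coeffs D lam Lam = {a \<in> Linf D. AE x in lebesgue_on D. lam \<le> a x \<and> a x \<le> Lam}"

definition coeffs_H1 :: "'a::euclidean_space set \<Rightarrow> real \<Rightarrow> real \<Rightarrow> real \<Rightarrow> ('a \<Rightarrow> real) set" where
  "coeffs_H1 D lam Lam M = {a \<in> coeffs D lam Lam. a \<in> H1 D \<and> H1_norm D a \<le> M}"

text \<open>The right-hand side \<open>F\<close> is a functional on \<open>H10 D\<close>, given by its action.\<close>

definition weak_solution ::
    "'a::euclidean_space set \<Rightarrow> ('a \<Rightarrow> real) \<Rightarrow> (('a \<Rightarrow> real) \<Rightarrow> real) \<Rightarrow> ('a \<Rightarrow> real) \<Rightarrow> bool" where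
  "weak_solution D a F u \<longleftrightarrow> u \<in> H10 D \<and>
     (\<forall>v\<in>H10 D. (LINT x|lebesgue_on D. a x * (weak_grad D u x \<bullet> weak_grad D v x)) = F v)"

definition functional_of ::
    "'a::euclidean_space set \<Rightarrow> ('a \<Rightarrow> real) \<Rightarrow> ('a \<Rightarrow> real) \<Rightarrow> real" where
  "functional_of D f v = (LINT x|lebesgue_on D. f x * v x)"

end

theory Submission
  imports Defs
begin

text \<open>
  Let \<open>q(s) = s / (e + \<bar>s\<bar>)\<close>, \<open>u = u\<^sub>a\<close> and \<open>\<delta> = \<lambda>(a - b) / a\<close>. Testing the two equations with
  \<open>\<delta> q(u)\<close> and the first one with \<open>\<delta>\<^sup>2 q(u)\<close> gives
  \<open>\<integral> \<delta>\<^sup>2 (a q'(u) \<bar>\<nabla>u\<bar>\<^sup>2 + f q(u)) = 2 \<lambda> \<integral> b \<nabla>(u\<^sub>b - u) \<cdot> \<nabla>(\<delta> q(u))\<close>, so \<open>\<delta>\<close> is controlled in \<open>L\<^sub>2\<close>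
  on \<open>{u \<ge> e}\<close>, where \<open>q(u) \<ge> 1/2\<close>, by \<open>E (\<surd>(F / e) + \<parallel>\<nabla>a\<parallel> + \<parallel>\<nabla>b\<parallel>)\<close> with \<open>E = \<parallel>\<nabla>(u\<^sub>a - u\<^sub>b)\<parallel>\<close>
  and \<open>F = \<parallel>f\<parallel>\<^sub>\<infinity>\<close>; the energy in \<open>\<nabla>(\<delta> q(u))\<close> is bounded by testing with \<open>q(u)\<close> itself.
  The set \<open>{u < e}\<close> has measure \<open>O(\<surd>e)\<close>: testing with \<open>\<phi>\<^sup>2 (1 - q(u))\<close>, \<open>\<phi>\<close> a cutoff at distance \<open>\<surd>e\<close>
  from the boundary, yields \<open>c\<^sub>f \<integral> \<phi>\<^sup>2 (1 - q(u)) \<le> \<Lambda> e \<integral> \<bar>\<nabla>\<phi>\<bar>\<^sup>2\<close>, and the boundary strip of width \<open>\<surd>e\<close> of a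
  Lipschitz domain has measure \<open>O(\<surd>e)\<close>. No pointwise lower bound for \<open>u\<close> is needed. The choice
  \<open>e = E powr (2/3)\<close> gives the exponent.
\<close>

subsection \<open>Smooth functions\<close>

text \<open>Dividing by \<open>a\<close> makes the two tests fit together:
  \<open>a * \<delta>\<close> is \<open>lam * (a - b)\<close>, so the form with the signless
  coefficient \<open>a - b\<close> becomes an energy form of the first equation, and testing with
  the square of \<delta> removes the remaining term in the gradient of \<delta>. The weight q
  saturates at level e, so only the measure of a sublevel set of u is left to estimate. The price is
  q' <= 1/e, which puts the factor 1/e into the energy. The analytic obstacle is that the test
  functions are nonlinear in u while their coefficients lie only in H^1. One product rule, for a
  bounded H^1 function times h(u) with h bounded and h' bounded and Lipschitz, covers every test
  function that involves u. To fit it, q, the substitute for the negative part and even 1/a are all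
  built from the same rational function of |s|. Weak derivatives are handled by mollification away
  from the boundary; the Lipschitz property of D is used only for the measure of the boundary
  strip.\<close>

lemma partialI: "(f has_derivative f') (at x) \<Longrightarrow> partial i f x = f' i"
  unfolding partial_def using frechet_derivative_at by metis

lemma Ck_SucD: "Ck (Suc k) f \<Longrightarrow> Ck k f"
proof (induction k arbitrary: f)
  case 0
  then show ?case
    by (auto intro!: differentiable_imp_continuous_on simp: differentiable_on_def)
next
  case (Suc k)
  then show ?case by (metis Ck.simps(2))
qed

lemma Ck_const: "Ck k (\<lambda>x::'a::euclidean_space. c)"
proof (induction k arbitrary: c)
  case (Suc k)
  have "partial i (\<lambda>x::'a. c) = (\<lambda>x. 0)" for i
    by (rule ext) (simp add: partial_def)
  then show ?case using Suc by simp
qed simp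

lemma partial_add:
  assumes "f differentiable (at x)" "g differentiable (at x)"
  shows "partial i (\<lambda>x. f x + g x) x = partial i f x + partial i g x"
  unfolding partial_def
  by (rule partialI[unfolded partial_def])
     (intro has_derivative_add assms[unfolded frechet_derivative_works])

lemma partial_mult:
  assumes "f differentiable (at x)" "g differentiable (at x)"
  shows "partial i (\<lambda>x. f x * g x) x = f x * partial i g x + partial i f x * g x"
  unfolding partial_def
  by (rule partialI[unfolded partial_def])
     (intro has_derivative_mult assms[unfolded frechet_derivative_works])

lemma Ck_add: "Ck k f \<Longrightarrow> Ck k g \<Longrightarrow> Ck k (\<lambda>x. f x + g x)"
proof (induction k arbitrary: f g)
  case 0
  then show ?case by (auto intro: continuous_on_add)
next
  case (Suc k)
  have "partial i (\<lambda>x. f x + g x) = (\<lambda>x. partial i f x + partial i g x)" for i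
    using Suc.prems by (intro ext partial_add) auto
  then show ?case using Suc by auto
qed

lemma Ck_mult: "Ck k f \<Longrightarrow> Ck k g \<Longrightarrow> Ck k (\<lambda>x. f x * g x)"
proof (induction k arbitrary: f g)
  case 0
  then show ?case by (auto intro: continuous_on_mult)
next
  case (Suc k)
  have *: "partial i (\<lambda>x. f x * g x) = (\<lambda>x. f x * partial i g x + partial i f x * g x)" for i
    using Suc.prems by (intro ext partial_mult) auto
  have "Ck k f" "Ck k g" using Suc.prems Ck_SucD by auto
  then have "Ck k (\<lambda>x. f x * partial i g x + partial i f x * g x)" if "i \<in> Basis" for i
    using Suc.prems that by (intro Ck_add Suc.IH) auto
  then show ?case using Suc.prems by (auto simp: *)
qed

lemma Ck_inner: "Ck k (\<lambda>x::'a::euclidean_space. x \<bullet> j)"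
proof (cases k)
  case (Suc k')
  have "((\<lambda>x. x \<bullet> j) has_derivative (\<lambda>h. h \<bullet> j)) (at x)" for x :: 'a
    by (auto intro!: derivative_eq_intros)
  then have "partial i (\<lambda>x. x \<bullet> j) = (\<lambda>x. i \<bullet> j)" for i :: 'a
    by (intro ext partialI)
  then show ?thesis using Suc by (auto simp: Ck_const)
qed (auto intro: continuous_intros)

lemma Ck_sum: "finite A \<Longrightarrow> (\<And>i. i \<in> A \<Longrightarrow> Ck k (f i)) \<Longrightarrow> Ck k (\<lambda>x. \<Sum>i\<in>A. f i x)"
  by (induction A rule: finite_induct) (auto simp: Ck_const Ck_add)

lemma Ck_inner_self: "Ck k (\<lambda>x::'a::euclidean_space. x \<bullet> x)"
proof -
  have "Ck k (\<lambda>x::'a. \<Sum>i\<in>Basis. (x \<bullet> i) * (x \<bullet> i))"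
    by (intro Ck_sum Ck_mult Ck_inner) auto
  then show ?thesis by (simp add: euclidean_inner[symmetric])
qed

text \<open>Needed with \<open>s = -1\<close>, for the reflected kernels
  \<open>\<phi> (x - y)\<close> as functions of \<open>y\<close>.\<close>

lemma Ck_affine: "Ck k f \<Longrightarrow> Ck k (\<lambda>y. f (x + s *\<^sub>R y))"
proof (induction k arbitrary: f)
  case 0
  then have "continuous_on UNIV (f \<circ> (\<lambda>y. x + s *\<^sub>R y))"
    by (intro continuous_on_compose continuous_intros) (auto intro: continuous_on_subset)
  then show ?case by (simp add: o_def)
next
  case (Suc k)
  have d: "((\<lambda>y. f (x + s *\<^sub>R y)) has_derivative
      (\<lambda>h. frechet_derivative f (at (x + s *\<^sub>R y)) (s *\<^sub>R h))) (at y)" for y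
  proof -
    have "((f \<circ> (\<lambda>y. x + s *\<^sub>R y)) has_derivative
      (frechet_derivative f (at (x + s *\<^sub>R y)) \<circ> (\<lambda>h. s *\<^sub>R h))) (at y)"
      using Suc.prems
      by (intro diff_chain_at)
        (auto intro!: derivative_eq_intros simp: frechet_derivative_works[symmetric])
    then show ?thesis by (simp add: o_def)
  qed
  have "partial i (\<lambda>y. f (x + s *\<^sub>R y)) = (\<lambda>y. s * partial i f (x + s *\<^sub>R y))" for i
  proof
    fix y
    have "linear (frechet_derivative f (at (x + s *\<^sub>R y)))"
      using Suc.prems by (auto intro: linear_frechet_derivative)
    then show "partial i (\<lambda>y. f (x + s *\<^sub>R y)) y = s * partial i f (x + s *\<^sub>R y)"
      by (simp add: partialI[OF d] linear_cmul) (simp add: partial_def)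
  qed
  moreover have "Ck k (\<lambda>y. s * partial i f (x + s *\<^sub>R y))" if "i \<in> Basis" for i
    using Suc that by (intro Ck_mult Ck_const Suc.IH) auto
  ultimately show ?case using d by (auto simp: differentiable_def)
qed

text \<open>The classical smooth function exp(-1/s), extended by 0. The denominators
  \<open>s ^ m\<close> are included because derivatives of the family are linear combinations of its
  members, which is what an induction on the order of differentiability needs.\<close>

definition flat :: "nat \<Rightarrow> real \<Rightarrow> real" where
  "flat m s = (if s > 0 then exp (- (1 / s)) / s ^ m else 0)"

lemma flat_tendsto_0: "((\<lambda>s. flat m s) \<longlongrightarrow> 0) (at 0)"
proof -
  have "((\<lambda>y. y ^ m / exp y) \<longlongrightarrow> (0::real)) at_top" by (rule tendsto_power_div_exp_0)
  then have "((\<lambda>s. (inverse s) ^ m / exp (inverse s)) \<longlongrightarrow> (0::real)) (at_right 0)"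
    by (rule filterlim_compose[OF _ filterlim_inverse_at_top_right])
  then have r: "((\<lambda>s. flat m s) \<longlongrightarrow> 0) (at_right 0)"
    by (rule Lim_transform_eventually)
       (auto simp: eventually_at_right_field flat_def field_simps exp_minus intro!: exI[of _ 1])
  have l: "((\<lambda>s. flat m s) \<longlongrightarrow> 0) (at_left 0)"
    by (rule Lim_transform_eventually[OF tendsto_const])
       (auto simp: eventually_at_left_field flat_def intro!: exI[of _ "-1"])
  show ?thesis using r l by (simp add: filterlim_split_at)
qed

lemma flat_has_derivative:
  "(flat m has_real_derivative flat (m + 2) s - real m * flat (m + 1) s) (at s)"
proof -
  consider "s < 0" | "s = 0" | "s > 0" by linarith
  then show ?thesis
  proof cases
    case 1
    have "(flat m has_real_derivative 0) (at s)"
      by (rule DERIV_cong_ev[THEN iffD2, OF refl _ refl, of _ "\<lambda>_. 0"])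
         (use 1 in \<open>auto simp: flat_def eventually_nhds intro!: exI[of _ "{..<0}"]\<close>)
    then show ?thesis using 1 by (simp add: flat_def)
  next
    case 2
    \<comment> \<open>The difference quotient of \<open>flat m\<close> at 0 is
      \<open>flat (m + 1)\<close>.\<close>
    have "((\<lambda>h. flat m h / h) \<longlongrightarrow> 0) (at 0)"
      by (rule Lim_transform_eventually[OF flat_tendsto_0[of "m+1"]])
         (auto simp: flat_def)
    then show ?thesis using 2
      by (simp add: DERIV_def) (simp add: flat_def)
  next
    case 3
    have "((\<lambda>s. exp (- (1 / s)) / s ^ m) has_real_derivative
       (exp (- (1/s)) / s^(m+2) - real m * (exp (- (1/s)) / s^(m+1)))) (at s)"
      using 3
      apply (auto intro!: derivative_eq_intros)
      apply (cases m)
       apply (auto simp: field_simps power2_eq_square)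
      done
    then have "(flat m has_real_derivative
       (exp (- (1/s)) / s^(m+2) - real m * (exp (- (1/s)) / s^(m+1)))) (at s)"
      by (rule DERIV_cong_ev[THEN iffD1, OF refl _ refl, rotated])
         (use 3 in \<open>auto simp: flat_def eventually_nhds intro!: exI[of _ "{0<..}"]\<close>)
    then show ?thesis using 3 by (simp add: flat_def)
  qed
qed

text \<open>Induction with \<open>m\<close> arbitrary: a partial derivative trades one order of
  \<open>k\<close> for the indices \<open>m + 1\<close> and \<open>m + 2\<close>, multiplied by a
  partial derivative of \<open>f\<close>.\<close>

lemma Ck_flat: "(\<And>k. Ck k f) \<Longrightarrow> Ck k (\<lambda>x. flat m (f x))"
proof (induction k arbitrary: m)
  case 0
  have "continuous_on UNIV (flat m)"
    by (intro continuous_at_imp_continuous_on ballI DERIV_isCont[OF flat_has_derivative])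
  then have "continuous_on UNIV (flat m \<circ> f)"
    using 0[of 0] by (intro continuous_on_compose) (auto intro: continuous_on_subset)
  then show ?case by (simp add: o_def)
next
  case (Suc k)
  have df: "f differentiable (at x)" for x using Suc.prems[of "Suc 0"] by simp
  let ?d = "\<lambda>x. flat (m + 2) (f x) + (- real m) * flat (m + 1) (f x)"
  have d: "((\<lambda>x. flat m (f x)) has_derivative (\<lambda>h. frechet_derivative f (at x) h * ?d x)) (at x)" for x
    using DERIV_compose_FDERIV[OF flat_has_derivative, of f "frechet_derivative f (at x)" x UNIV] df[of x]
    by (simp add: frechet_derivative_works)
  have "partial i (\<lambda>x. flat m (f x)) = (\<lambda>x. partial i f x * ?d x)" for i
    by (rule ext) (simp add: partialI[OF d] partial_def)
  moreover have "Ck k (\<lambda>x. partial i f x * ?d x)" if "i \<in> Basis" for i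
    using Suc.prems[of "Suc k"] that
    by (intro Ck_mult Ck_add Ck_const Suc.IH Suc.prems) auto
  ultimately show ?case using d by (auto simp: differentiable_def)
qed

section \<open>Test functions: supports, bounds, Taylor remainder\<close>

lemma test_functions_mono: "D \<subseteq> E \<Longrightarrow> test_functions D \<subseteq> test_functions E"
  by (auto simp: test_functions_def)

lemma test_functionsI:
  assumes "\<And>k. Ck k \<phi>" "compact K" "K \<subseteq> D" "\<And>x. x \<notin> K \<Longrightarrow> \<phi> x = 0"
  shows "\<phi> \<in> test_functions D"
proof -
  have "closure {x. \<phi> x \<noteq> 0} \<subseteq> K"
    using assms by (intro closure_minimal) (auto intro: compact_imp_closed)
  moreover have "compact (closure {x. \<phi> x \<noteq> 0})"
    using calculation assms(2) by (meson closed_closure compact_Int_closed closed_Int_compact inf.absorb_iff2 compact_eq_bounded_closed bounded_subset)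
  ultimately show ?thesis using assms
    by (auto simp: test_functions_def)
qed

text \<open>\<open>K\<close> is the closed support. The partial derivatives vanish off it too
  because its complement is open.\<close>

lemma test_functionsE:
  assumes "\<phi> \<in> test_functions D"
  obtains K where "compact K" "K \<subseteq> D" "\<And>x. x \<notin> K \<Longrightarrow> \<phi> x = 0" "\<And>x i. x \<notin> K \<Longrightarrow> partial i \<phi> x = 0"
proof
  let ?K = "closure {x. \<phi> x \<noteq> 0}"
  show "compact ?K" "?K \<subseteq> D" using assms by (auto simp: test_functions_def)
  show z: "\<phi> x = 0" if "x \<notin> ?K" for x
    using that closure_subset[of "{x. \<phi> x \<noteq> 0}"] by (auto simp: subset_iff)
  show "partial i \<phi> x = 0" if "x \<notin> ?K" for x i
  proof -
    have "open (- ?K)" by auto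
    have "(\<phi> has_derivative (\<lambda>_. 0)) (at x)"
    proof (rule has_derivative_transform_within_open[OF has_derivative_const[of 0] \<open>open (- ?K)\<close>])
      show "x \<in> - ?K" using that by (simp only: Compl_iff not_False_eq_True)
    next
      fix y assume "y \<in> - ?K"
      then have "y \<notin> ?K" by (rule ComplD)
      then show "0 = \<phi> y" by (rule z[symmetric])
    qed
    then show ?thesis by (simp add: partialI)
  qed
qed

lemma test_functions_partial:
  assumes "\<phi> \<in> test_functions D" "i \<in> Basis"
  shows "partial i \<phi> \<in> test_functions D"
proof -
  obtain K where K: "compact K" "K \<subseteq> D" "\<And>x i. x \<notin> K \<Longrightarrow> partial i \<phi> x = 0"
    using test_functionsE[OF assms(1)] by metis
  have "Ck k (partial i \<phi>)" for k
    using assms Ck.simps(2)[of k \<phi>] unfolding test_functions_def by blast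
  then show ?thesis using K by (intro test_functionsI[of _ K]) auto
qed

lemma test_function_differentiable: "\<phi> \<in> test_functions D \<Longrightarrow> \<phi> differentiable (at x)"
  using Ck.simps(2)[of 0 \<phi>] by (auto simp: test_functions_def)

lemma test_function_continuous: "\<phi> \<in> test_functions D \<Longrightarrow> continuous_on UNIV \<phi>"
  using Ck.simps(1)[of \<phi>] by (auto simp: test_functions_def simp del: Ck.simps)

lemma test_function_has_derivative:
  assumes "\<phi> \<in> test_functions D"
  shows "(\<phi> has_derivative (\<lambda>h. \<Sum>i\<in>Basis. (h \<bullet> i) * partial i \<phi> x)) (at x)"
proof -
  have d: "\<phi> differentiable (at x)" using test_function_differentiable[OF assms] .
  let ?f' = "frechet_derivative \<phi> (at x)"
  have l: "linear ?f'" using d by (rule linear_frechet_derivative)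
  have "?f' h = (\<Sum>i\<in>Basis. (h \<bullet> i) * partial i \<phi> x)" for h
  proof -
    have "?f' h = ?f' (\<Sum>i\<in>Basis. (h \<bullet> i) *\<^sub>R i)" by (simp add: euclidean_representation)
    also have "\<dots> = (\<Sum>i\<in>Basis. (h \<bullet> i) * partial i \<phi> x)"
      using l by (simp add: linear_sum linear_cmul partial_def)
    finally show ?thesis .
  qed
  then have "?f' = (\<lambda>h. \<Sum>i\<in>Basis. (h \<bullet> i) * partial i \<phi> x)" by (rule ext)
  then show ?thesis using d frechet_derivative_works by metis
qed

lemma test_function_bounded:
  assumes "\<phi> \<in> test_functions D"
  obtains B where "B > 0" "\<And>x. \<bar>\<phi> x\<bar> \<le> B"
proof -
  obtain K where K: "compact K" "\<And>x. x \<notin> K \<Longrightarrow> \<phi> x = 0"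
    using test_functionsE[OF assms] by metis
  have "bounded (\<phi> ` K)"
    using K(1) test_function_continuous[OF assms]
    by (intro compact_imp_bounded compact_continuous_image) (auto intro: continuous_on_subset)
  then obtain B where "B > 0" "\<And>x. x \<in> K \<Longrightarrow> \<bar>\<phi> x\<bar> \<le> B"
    by (auto simp: bounded_pos)
  then show ?thesis using K(2) that by (metis abs_zero less_imp_le)
qed

lemma test_function_partials_bounded:
  assumes "\<phi> \<in> test_functions D"
  obtains B where "B > 0" "\<And>x i. i \<in> Basis \<Longrightarrow> \<bar>partial i \<phi> x\<bar> \<le> B"
proof -
  have "\<forall>i\<in>Basis. \<exists>B>0. \<forall>x. \<bar>partial i \<phi> x\<bar> \<le> B"
    using test_function_bounded[OF test_functions_partial[OF assms]] by metis
  then obtain B where B: "\<And>i. i \<in> Basis \<Longrightarrow> B i > 0" "\<And>i x. i \<in> Basis \<Longrightarrow> \<bar>partial i \<phi> x\<bar> \<le> B i"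
    by metis
  have "\<bar>partial i \<phi> x\<bar> \<le> (\<Sum>i\<in>Basis. B i) + 1" if "i \<in> Basis" for i x
    using B(2)[OF that, of x] member_le_sum[of i Basis B] B(1) that by (fastforce intro: less_imp_le)
  moreover have "(\<Sum>i\<in>Basis. B i) + 1 > 0"
    using B(1) by (intro add_nonneg_pos sum_nonneg) (auto intro: less_imp_le)
  ultimately show ?thesis using that by blast
qed

lemma abs_gradient_sum_le:
  fixes c :: "'a::euclidean_space \<Rightarrow> real"
  assumes "\<And>i. i \<in> Basis \<Longrightarrow> \<bar>c i\<bar> \<le> B"
  shows "\<bar>\<Sum>i\<in>Basis. (h \<bullet> i) * c i\<bar> \<le> real DIM('a) * B * norm h"
proof -
  have "\<bar>\<Sum>i\<in>Basis. (h \<bullet> i) * c i\<bar> \<le> (\<Sum>i\<in>(Basis::'a set). norm h * B)"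
    using assms
    by (intro order_trans[OF sum_abs] sum_mono) (auto simp: abs_mult Basis_le_norm intro!: mult_mono)
  then show ?thesis by (simp add: algebra_simps)
qed

lemma test_function_lipschitz:
  fixes \<phi> :: "'a::euclidean_space \<Rightarrow> real"
  assumes "\<phi> \<in> test_functions D"
  obtains L where "L > 0" "\<And>x y. \<bar>\<phi> x - \<phi> y\<bar> \<le> L * norm (x - y)"
proof -
  obtain B where B: "B > 0" "\<And>x i. i \<in> Basis \<Longrightarrow> \<bar>partial i \<phi> x\<bar> \<le> B"
    using test_function_partials_bounded[OF assms] by blast
  have "norm (\<phi> x - \<phi> y) \<le> (real DIM('a) * B) * norm (x - y)" for x y
  proof (rule differentiable_bound[of UNIV _ "\<lambda>x h. \<Sum>i\<in>Basis. (h \<bullet> i) * partial i \<phi> x"])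
    fix x
    show "onorm (\<lambda>h. \<Sum>i\<in>Basis. h \<bullet> i * partial i \<phi> x) \<le> real DIM('a) * B"
      using B by (intro onorm_bound) (auto intro!: abs_gradient_sum_le)
  qed (auto intro: test_function_has_derivative[OF assms])
  then show ?thesis using B(1) that[of "real DIM('a) * B"] by auto
qed

text \<open>The first partials are Lipschitz, so the remainder is quadratic with a constant uniform
  in \<open>x\<close>. The uniformity is what allows differentiation under the integral of a
  convolution.\<close>

lemma test_function_remainder:
  fixes \<phi> :: "'a::euclidean_space \<Rightarrow> real"
  assumes "\<phi> \<in> test_functions D"
  obtains C where "C > 0"
    "\<And>x h. \<bar>\<phi> (x + h) - \<phi> x - (\<Sum>i\<in>Basis. (h \<bullet> i) * partial i \<phi> x)\<bar> \<le> C * (norm h)\<^sup>2"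
proof -
  have "\<forall>i\<in>Basis. \<exists>L>0. \<forall>x y. \<bar>partial i \<phi> x - partial i \<phi> y\<bar> \<le> L * norm (x - y)"
    using test_function_lipschitz[OF test_functions_partial[OF assms]] by metis
  then obtain L where L: "\<And>i. i \<in> Basis \<Longrightarrow> L i > 0"
    "\<And>i x y. i \<in> Basis \<Longrightarrow> \<bar>partial i \<phi> x - partial i \<phi> y\<bar> \<le> L i * norm (x - y)"
    by metis
  define S where "S = (\<Sum>i\<in>Basis. L i) + 1"
  have S: "S > 0" unfolding S_def
    using L(1) by (intro add_nonneg_pos sum_nonneg) (auto intro: less_imp_le)
  have LS: "L i \<le> S" if "i \<in> Basis" for i
    using member_le_sum[of i Basis L] L(1) that by (fastforce simp: S_def intro: less_imp_le)
  have "\<bar>\<phi> (x + h) - \<phi> x - (\<Sum>i\<in>Basis. (h \<bullet> i) * partial i \<phi> x)\<bar> \<le> (real DIM('a) * S) * (norm h)\<^sup>2" for x h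
  proof -
    let ?d = "\<lambda>x h. \<Sum>i\<in>Basis. (h \<bullet> i) * partial i \<phi> x"
    have "norm (\<phi> (x + h) - \<phi> x - ?d x (x + h - x)) \<le> norm (x + h - x) * (real DIM('a) * (S * norm h) * 1)"
    proof (rule differentiable_bound_linearization[of _ _ "cball x (norm h)"])
      show "(\<phi> has_derivative ?d y) (at y within cball x (norm h))" for y
        using has_derivative_at_withinI[OF test_function_has_derivative[OF assms]] .
      show "onorm (?d y - ?d x) \<le> real DIM('a) * (S * norm h) * 1" if y: "y \<in> cball x (norm h)" for y
      proof (rule onorm_bound)
        fix k
        have "\<bar>partial i \<phi> y - partial i \<phi> x\<bar> \<le> S * norm h" if "i \<in> Basis" for i
        proof -
          have "\<bar>partial i \<phi> y - partial i \<phi> x\<bar> \<le> L i * norm (y - x)" using L(2) that by blast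
          also have "\<dots> \<le> S * norm h"
            using LS[OF that] S y by (intro mult_mono) (auto simp: dist_norm norm_minus_commute)
          finally show ?thesis .
        qed
        then have "\<bar>\<Sum>i\<in>Basis. (k \<bullet> i) * (partial i \<phi> y - partial i \<phi> x)\<bar> \<le> real DIM('a) * (S * norm h) * norm k"
          by (rule abs_gradient_sum_le)
        then show "norm ((?d y - ?d x) k) \<le> real DIM('a) * (S * norm h) * 1 * norm k"
          by (simp add: right_diff_distrib sum_subtractf)
      qed (use S in auto)
    qed (auto simp: dist_norm mult_left_le_one_le abs_mult)
    then show ?thesis by (simp add: power2_eq_square algebra_simps)
  qed
  then show ?thesis using that[of "real DIM('a) * S"] S by auto
qed

subsection \<open>Mollifiers and convolution\<close>

text \<open>The argument is the squared radius minus the squared norm because this, unlike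
  \<open>r - norm x\<close>, is smooth at the origin.\<close>

definition bump0 :: "real \<Rightarrow> 'a::euclidean_space \<Rightarrow> real" where
  "bump0 r x = flat 0 (r\<^sup>2 - x \<bullet> x)"

definition bump :: "real \<Rightarrow> 'a::euclidean_space \<Rightarrow> real" where
  "bump r x = bump0 r x / (LINT y|lborel. bump0 r (y::'a))"

text \<open>The integral is over \<open>lebesgue\<close> since the functions to be smoothed are only
  Lebesgue measurable; the kernels are Borel.\<close>

definition conv :: "('a::euclidean_space \<Rightarrow> real) \<Rightarrow> ('a \<Rightarrow> real) \<Rightarrow> 'a \<Rightarrow> real" where
  "conv f \<eta> x = (LINT y|lebesgue. f y * \<eta> (x - y))"

lemma bump0_nonneg: "bump0 r x \<ge> 0"
  by (simp add: bump0_def flat_def)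

lemma bump0_pos: "r > 0 \<Longrightarrow> norm x < r \<Longrightarrow> bump0 r x > 0"
  by (simp add: bump0_def flat_def dot_square_norm power_strict_mono)

lemma bump0_eq_0: "r > 0 \<Longrightarrow> norm x \<ge> r \<Longrightarrow> bump0 r x = 0"
  by (auto simp: bump0_def flat_def dot_square_norm not_less intro: power_mono)

lemma bump0_test: "r > 0 \<Longrightarrow> bump0 r \<in> test_functions (UNIV :: 'a::euclidean_space set)"
proof (rule test_functionsI[of _ "cball 0 r"])
  fix k
  have eq: "bump0 r = (\<lambda>x::'a. flat 0 (r\<^sup>2 + (-1) * (x \<bullet> x)))"
    by (simp add: bump0_def fun_eq_iff)
  show "Ck k (bump0 r :: 'a \<Rightarrow> real)"
    unfolding eq by (intro Ck_flat Ck_add Ck_mult Ck_const Ck_inner_self)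
qed (auto simp: bump0_eq_0)

lemma continuous_compact_support_integrable:
  fixes f :: "'a::euclidean_space \<Rightarrow> real"
  assumes "continuous_on UNIV f" "compact K" "\<And>x. x \<notin> K \<Longrightarrow> f x = 0"
  shows "integrable lborel f"
proof -
  have "integrable lborel (\<lambda>x. indicator K x *\<^sub>R f x)"
    using assms by (intro borel_integrable_compact) (auto intro: continuous_on_subset)
  moreover have "(\<lambda>x. indicator K x *\<^sub>R f x) = f"
    using assms(3) by (auto simp: indicator_def fun_eq_iff)
  ultimately show ?thesis by simp
qed

lemma test_function_integrable: "\<phi> \<in> test_functions D \<Longrightarrow> integrable lborel \<phi>"
  by (metis continuous_compact_support_integrable test_functionsE test_function_continuous)

lemma test_function_borel: "\<phi> \<in> test_functions D \<Longrightarrow> \<phi> \<in> borel_measurable borel"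
  using test_function_continuous borel_measurable_continuous_onI by blast

lemma bump0_integral_pos:
  assumes "r > 0" shows "(LINT y|lborel. bump0 r (y::'a::euclidean_space)) > 0"
proof -
  have i: "integrable lborel (bump0 r :: 'a \<Rightarrow> real)"
    using test_function_integrable[OF bump0_test[OF assms]] .
  have "(LINT y|lborel. bump0 r (y::'a)) \<noteq> 0"
  proof
    assume "(LINT y|lborel. bump0 r (y::'a)) = 0"
    then have "AE x in lborel. bump0 r (x::'a) = 0"
      using integral_nonneg_eq_0_iff_AE[OF i] bump0_nonneg by auto
    then have "AE x in lborel. (x::'a) \<notin> ball 0 r"
      by eventually_elim (use bump0_pos[OF assms] in force)
    then have "emeasure lborel (ball (0::'a) r) = 0"
      by (subst (asm) AE_iff_measurable[OF _ refl]) (auto simp: ball_def dist_norm)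
    moreover have "emeasure lborel (ball (0::'a) r) > 0"
      using assms emeasure_lborel_ball_finite[of "0::'a" r] content_ball_pos[of r "0::'a"]
      by (simp add: emeasure_eq_ennreal_measure less_top)
    ultimately show False by simp
  qed
  moreover have "(LINT y|lborel. bump0 r (y::'a)) \<ge> 0"
    by (intro integral_nonneg_AE) (auto simp: bump0_nonneg)
  ultimately show ?thesis by simp
qed

lemma bump_test:
  assumes "r > 0" shows "bump r \<in> test_functions (UNIV :: 'a::euclidean_space set)"
proof (rule test_functionsI[of _ "cball 0 r"])
  fix k
  have "Ck k (\<lambda>x::'a. (1 / (LINT y|lborel. bump0 r (y::'a))) * bump0 r x)"
    using bump0_test[OF assms] by (intro Ck_mult Ck_const) (auto simp: test_functions_def)
  then show "Ck k (bump r :: 'a \<Rightarrow> real)" by (simp add: bump_def[abs_def])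
qed (auto simp: bump_def bump0_eq_0 assms)

lemma bump_nonneg: "r > 0 \<Longrightarrow> bump r x \<ge> 0"
  by (simp add: bump_def bump0_nonneg bump0_integral_pos less_imp_le)

lemma bump_eq_0: "r > 0 \<Longrightarrow> norm x \<ge> r \<Longrightarrow> bump r x = 0"
  by (simp add: bump_def bump0_eq_0)

lemma bump_integral: "r > 0 \<Longrightarrow> (LINT x|lborel. bump r (x::'a::euclidean_space)) = 1"
  using bump0_integral_pos[of r, where 'a='a] by (simp add: bump_def[abs_def])

lemma bump_integrable: "r > 0 \<Longrightarrow> integrable lborel (bump r :: 'a::euclidean_space \<Rightarrow> real)"
  using bump_test test_function_integrable by blast

lemma test_function_conv_integrable:
  assumes "\<phi> \<in> test_functions UNIV" "integrable lebesgue f"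
  shows "integrable lebesgue (\<lambda>y. f y * \<phi> (x - y))"
proof -
  obtain B where B: "\<And>x. \<bar>\<phi> x\<bar> \<le> B" using test_function_bounded[OF assms(1)] by metis
  have [measurable]: "\<phi> \<in> borel_measurable borel" using test_function_borel[OF assms(1)] .
  show ?thesis
  proof (rule Bochner_Integration.integrable_bound[of _ "\<lambda>y. B * f y"])
    show "integrable lebesgue (\<lambda>y. B * f y)" using assms(2) by simp
    have "(\<lambda>y. \<phi> (x - y)) \<in> borel_measurable lborel" by measurable
    then show "(\<lambda>y. f y * \<phi> (x - y)) \<in> borel_measurable lebesgue"
      using assms(2) by (intro borel_measurable_times) (auto intro: measurable_completion)
    have "\<bar>f y\<bar> * \<bar>\<phi> (x - y)\<bar> \<le> \<bar>f y\<bar> * \<bar>B\<bar>" for y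
      using B[of "x - y"] by (intro mult_left_mono) auto
    then show "AE y in lebesgue. norm (f y * \<phi> (x - y)) \<le> norm (B * f y)"
      by (simp add: abs_mult mult.commute)
  qed
qed

text \<open>The uniform quadratic remainder of the kernel, integrated against \<open>f\<close>,
  gives an error of at most \<open>N * C\<close> times the square of \<open>norm h\<close>, with
  \<open>N\<close> the L1 norm of \<open>f\<close>.\<close>

lemma conv_has_derivative:
  fixes \<phi> :: "'a::euclidean_space \<Rightarrow> real"
  assumes "\<phi> \<in> test_functions UNIV" and f: "integrable lebesgue f"
  shows "(conv f \<phi> has_derivative (\<lambda>h. \<Sum>i\<in>Basis. (h \<bullet> i) * conv f (partial i \<phi>) x)) (at x)"
proof -
  obtain C where C: "C > 0"
    "\<And>x h. \<bar>\<phi> (x + h) - \<phi> x - (\<Sum>i\<in>Basis. (h \<bullet> i) * partial i \<phi> x)\<bar> \<le> C * (norm h)\<^sup>2"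
    using test_function_remainder[OF assms(1)] by blast
  define N where "N = (LINT y|lebesgue. \<bar>f y\<bar>)"
  have N: "N \<ge> 0" unfolding N_def by simp
  let ?D = "\<lambda>h. \<Sum>i\<in>Basis. (h \<bullet> i) * conv f (partial i \<phi>) x"
  have int: "integrable lebesgue (\<lambda>y. f y * \<phi> (x - y))" for x
    using test_function_conv_integrable[OF assms] .
  have intp: "integrable lebesgue (\<lambda>y. f y * partial i \<phi> (x - y))" if "i \<in> Basis" for x i
    using test_function_conv_integrable[OF test_functions_partial[OF assms(1) that] f] .
  have bound: "norm (conv f \<phi> (x + h) - conv f \<phi> x - ?D h) \<le> (N * C) * (norm h)\<^sup>2" for h
  proof -
    let ?R = "\<lambda>y. \<phi> (x - y + h) - \<phi> (x - y) - (\<Sum>i\<in>Basis. (h \<bullet> i) * partial i \<phi> (x - y))"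
    let ?S = "\<lambda>y. \<Sum>i\<in>Basis. (h \<bullet> i) * (f y * partial i \<phi> (x - y))"
    have s: "integrable lebesgue ?S"
      using intp by (intro Bochner_Integration.integrable_sum) auto
    have sI: "(LINT y|lebesgue. ?S y) = ?D h"
      using intp by (subst Bochner_Integration.integral_sum) (auto simp: conv_def)
    have i1: "integrable lebesgue (\<lambda>y. f y * \<phi> (x + h - y) - f y * \<phi> (x - y)
        - (\<Sum>i\<in>Basis. (h \<bullet> i) * (f y * partial i \<phi> (x - y))))"
      using int intp by (intro Bochner_Integration.integrable_diff Bochner_Integration.integrable_sum) auto
    have eq: "f y * \<phi> (x + h - y) - f y * \<phi> (x - y)
        - (\<Sum>i\<in>Basis. (h \<bullet> i) * (f y * partial i \<phi> (x - y))) = f y * ?R y" for y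
      by (simp add: algebra_simps sum_distrib_left)
    have "conv f \<phi> (x + h) - conv f \<phi> x - ?D h = (LINT y|lebesgue. f y * \<phi> (x + h - y) - f y * \<phi> (x - y)
        - (\<Sum>i\<in>Basis. (h \<bullet> i) * (f y * partial i \<phi> (x - y))))"
      unfolding conv_def
      by (subst Bochner_Integration.integral_diff[OF Bochner_Integration.integrable_diff[OF int int] s])
         (simp add: Bochner_Integration.integral_diff[OF int int] sI conv_def)
    also have "\<dots> = (LINT y|lebesgue. f y * ?R y)" by (simp only: eq)
    finally have "norm (conv f \<phi> (x + h) - conv f \<phi> x - ?D h) \<le> (LINT y|lebesgue. norm (f y * ?R y))"
      by (simp only: integral_norm_bound)
    also have "\<dots> \<le> (LINT y|lebesgue. (C * (norm h)\<^sup>2) * \<bar>f y\<bar>)"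
    proof (rule integral_mono)
      show "integrable lebesgue (\<lambda>y. norm (f y * ?R y))"
        using i1 unfolding eq by (rule integrable_norm)
      fix y
      show "norm (f y * ?R y) \<le> (C * (norm h)\<^sup>2) * \<bar>f y\<bar>"
        using mult_left_mono[OF C(2)[of "x - y" h], of "\<bar>f y\<bar>"] by (simp add: abs_mult mult_ac)
    qed (use f in auto)
    also have "\<dots> = (N * C) * (norm h)\<^sup>2" by (simp add: N_def)
    finally show ?thesis .
  qed
  show ?thesis
    unfolding has_derivative_at
  proof
    show "bounded_linear ?D"
      by (intro bounded_linear_sum bounded_linear_mult_const[OF bounded_linear_inner_left])
    show "(\<lambda>h. norm (conv f \<phi> (x + h) - conv f \<phi> x - ?D h) / norm h) \<midarrow>0\<rightarrow> 0"
    proof (rule tendsto_sandwich[of "\<lambda>_. 0" _ _ "\<lambda>h. N * C * norm h"])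
      show "\<forall>\<^sub>F h in at 0. norm (conv f \<phi> (x + h) - conv f \<phi> x - ?D h) / norm h \<le> N * C * norm h"
        using bound by (auto intro!: always_eventually divide_left_mono simp: divide_le_eq power2_eq_square mult_ac N less_imp_le[OF C(1)])
      show "(\<lambda>h::'a. N * C * norm h) \<midarrow>0\<rightarrow> 0"
        by (auto intro!: tendsto_eq_intros)
    qed auto
  qed
qed

lemma partial_conv:
  assumes "\<phi> \<in> test_functions UNIV" "integrable lebesgue f" "i \<in> Basis"
  shows "partial i (conv f \<phi>) = conv f (partial i \<phi>)"
proof
  fix x
  have "partial i (conv f \<phi>) x = (\<Sum>j\<in>Basis. (i \<bullet> j) * conv f (partial j \<phi>) x)"
    using partialI[OF conv_has_derivative[OF assms(1,2)]] .
  also have "\<dots> = (\<Sum>j\<in>Basis. if j = i then conv f (partial j \<phi>) x else 0)"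
    using assms(3) by (intro sum.cong) (auto simp: inner_Basis)
  finally show "partial i (conv f \<phi>) x = conv f (partial i \<phi>) x"
    using assms(3) by simp
qed

lemma Ck_conv:
  assumes "\<phi> \<in> test_functions UNIV" "integrable lebesgue f"
  shows "Ck k (conv f \<phi>)"
  using assms(1)
proof (induction k arbitrary: \<phi>)
  case 0
  have "conv f \<phi> differentiable_on UNIV"
    using conv_has_derivative[OF 0 assms(2)] by (auto simp: differentiable_on_def differentiable_def)
  then show ?case by (simp add: differentiable_imp_continuous_on)
next
  case (Suc k)
  have "conv f \<phi> differentiable (at x)" for x
    using conv_has_derivative[OF Suc.prems assms(2)] by (auto simp: differentiable_def)
  then show ?case
    using Suc assms(2) by (simp add: partial_conv test_functions_partial)
qed

lemma conv_eq_0: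
  assumes "\<And>y. f y \<noteq> 0 \<Longrightarrow> \<phi> (x - y) = 0"
  shows "conv f \<phi> x = 0"
proof -
  have "(\<lambda>y. f y * \<phi> (x - y)) = (\<lambda>y. 0)" using assms by force
  then show ?thesis by (simp add: conv_def)
qed

subsection \<open>Continuity of translation\<close>

lemma lborel_translate:
  fixes f :: "'a::euclidean_space \<Rightarrow> real"
  assumes [measurable]: "f \<in> borel_measurable borel"
  shows integrable_translate: "integrable lborel (\<lambda>x. f (x - z)) \<longleftrightarrow> integrable lborel f"
    and integral_translate: "(LINT x|lborel. f (x - z)) = (LINT x|lborel. f x)"
proof -
  have *: "lborel = distr lborel borel ((+) (- z))" using lborel_distr_plus[of "- z"] by simp
  have f: "f \<in> borel_measurable borel" by fact
  have "integrable (distr lborel borel ((+) (- z))) f \<longleftrightarrow> integrable lborel (\<lambda>x. f (- z + x))"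
    by (rule integrable_distr_eq) auto
  then show "integrable lborel (\<lambda>x. f (x - z)) \<longleftrightarrow> integrable lborel f"
    using * by (simp add: algebra_simps)
  have "(LINT x|distr lborel borel ((+) (- z)). f x) = (LINT x|lborel. f (- z + x))"
    by (rule integral_distr) auto
  then show "(LINT x|lborel. f (x - z)) = (LINT x|lborel. f x)"
    using * by (simp add: algebra_simps)
qed

lemma translation_L1:
  fixes f :: "'a::euclidean_space \<Rightarrow> real"
  assumes "integrable lborel f"
  shows "\<forall>e>0. \<exists>d>0. \<forall>z. norm z < d \<longrightarrow> (LINT x|lborel. \<bar>f (x - z) - f x\<bar>) < e"
  using assms
proof (induction rule: integrable_induct)
  case (base A c)
  show ?case
  proof (intro allI impI)
    fix e :: real assume e: "e > 0"
    have AL: "A \<in> sets lebesgue" using base(1) by simp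
    \<comment> \<open>\<open>U - K\<close> will be covered by three sets of measure below
      \<open>\<eta>\<close>, and it is counted twice, once shifted; this gives
      \<open>6 * \<bar>c\<bar> * \<eta> < e\<close>. The \<open>+ 1\<close> covers
      \<open>c = 0\<close>.\<close>
    define \<eta> where "\<eta> = e / (6 * (\<bar>c\<bar> + 1))"
    have \<eta>: "\<eta> > 0" using e by (simp add: \<eta>_def)
    obtain U where U: "open U" "A \<subseteq> U" "U - A \<in> lmeasurable" "emeasure lebesgue (U - A) < ennreal \<eta>"
      using sets_lebesgue_outer_open[OF AL \<eta>] by metis
    obtain T where T: "closed T" "T \<subseteq> A" "A - T \<in> lmeasurable" "emeasure lebesgue (A - T) < ennreal \<eta>"
      using sets_lebesgue_inner_closed[OF AL \<eta>] by metis
    have fA: "emeasure lebesgue A < \<infinity>" using base by simp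
    have bor[measurable]: "U \<in> sets borel" "T \<in> sets borel" "A \<in> sets borel"
      using U(1) T(1) base(1) by auto
    have le: "emeasure lborel T < \<infinity>"
      using emeasure_mono[OF T(2), of lborel] base by (auto intro: order.strict_trans1)
    \<comment> \<open>Inner regularity yields only a closed set \<open>T\<close>; cutting it with a
      large ball makes it compact at the cost of one more \<open>\<eta>\<close>.\<close>
    have "(\<lambda>n. emeasure lborel (T - cball 0 (real n))) \<longlonglongrightarrow> emeasure lborel (\<Inter>n. T - cball 0 (real n))"
    proof (rule Lim_emeasure_decseq)
      show "decseq (\<lambda>n. T - cball 0 (real n))" by (auto simp: decseq_def)
      show "emeasure lborel (T - cball 0 (real n)) \<noteq> \<infinity>" for n
        using emeasure_mono[of "T - cball 0 (real n)" T lborel] le by (auto simp: top_unique)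
    qed auto
    moreover have "(\<Inter>n. T - cball 0 (real n)) = {}"
      using real_arch_simple by (auto simp: not_le) (meson real_arch_simple)
    ultimately have "(\<lambda>n. emeasure lborel (T - cball 0 (real n))) \<longlonglongrightarrow> 0" by (simp only: emeasure_empty)
    then have "\<forall>\<^sub>F n in sequentially. emeasure lborel (T - cball 0 (real n)) < ennreal \<eta>"
      using \<eta> by (intro order_tendstoD(2)) auto
    then obtain n where n: "emeasure lborel (T - cball 0 (real n)) < ennreal \<eta>"
      by (auto simp: eventually_sequentially)
    define K where "K = T \<inter> cball 0 (real n)"
    have K: "compact K" "K \<subseteq> A"
      using T unfolding K_def by (auto intro: closed_Int_compact)
    have [measurable]: "K \<in> sets borel" using compact_imp_closed[OF K(1)] by (rule borel_closed)
    have "emeasure lborel (U - K) \<le> emeasure lborel ((U - A) \<union> ((A - T) \<union> (T - cball 0 (real n))))"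
      by (rule emeasure_mono) (auto simp: K_def)
    also have "\<dots> \<le> emeasure lborel (U - A) + (emeasure lborel (A - T) + emeasure lborel (T - cball 0 (real n)))"
      by (intro order_trans[OF emeasure_subadditive] add_mono order_refl) auto
    also have "\<dots> \<le> ennreal \<eta> + (ennreal \<eta> + ennreal \<eta>)"
      using U(4) T(4) n bor by (intro add_mono) (auto simp: less_imp_le)
    also have "\<dots> = ennreal (3 * \<eta>)" using \<eta> by (simp add: ennreal_plus[symmetric] del: ennreal_plus)
    finally have UK: "emeasure lborel (U - K) \<le> ennreal (3 * \<eta>)" .
    \<comment> \<open>The compact \<open>K\<close> has positive distance from the complement of
      \<open>U\<close>, so a shift shorter than \<open>d\<close> cannot move a point of
      \<open>K\<close> out of \<open>U\<close>.\<close>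
    obtain d where d: "d > 0" "\<And>x y. x \<in> K \<Longrightarrow> y \<notin> U \<Longrightarrow> d \<le> dist x y"
    proof -
      have "closed (- U)" using U(1) by (rule closed_Compl)
      moreover have "K \<inter> - U = {}" using U(2) K(2) by blast
      ultimately show ?thesis using separate_compact_closed[OF K(1)] that by (metis ComplI)
    qed
    let ?W = "U - K"
    have W[measurable]: "?W \<in> sets borel" using U(1) K(1) by (auto intro: compact_imp_closed)
    have Wfin: "emeasure lborel ?W < \<infinity>" using UK by (auto intro: order.strict_trans1)
    have iW: "integrable lborel (indicator ?W :: 'a \<Rightarrow> real)" using Wfin by simp
    have "(LINT x|lborel. \<bar>indicator A (x - z) *\<^sub>R c - indicator A x *\<^sub>R c\<bar>) < e" if z: "norm z < d" for z
    proof -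
      have iW': "integrable lborel (\<lambda>x. indicator ?W (x - z) :: real)"
        using iW by (subst integrable_translate) auto
      \<comment> \<open>If exactly one of \<open>x\<close> and \<open>x - z\<close> is in
        \<open>A\<close>, that point lies in \<open>U - K\<close>, or else it lies in
        \<open>K\<close> and forces the other one into \<open>U - K\<close>.\<close>
      have pt: "\<bar>indicator A (x - z) - indicator A x\<bar> \<le> (indicator ?W x + indicator ?W (x - z) :: real)" for x
      proof -
        have "x - z \<in> U" if "x \<in> K" using d(2)[OF that, of "x - z"] z by (auto simp: dist_norm)
        moreover have "x \<in> U" if "x - z \<in> K"
          using d(2)[OF that, of x] z by (auto simp: dist_norm)
        ultimately show ?thesis
          using K(2) U(2) by (auto simp: indicator_def)
      qed
      have "(LINT x|lborel. \<bar>indicator A (x - z) *\<^sub>R c - indicator A x *\<^sub>R c\<bar>)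
          \<le> (LINT x|lborel. \<bar>c\<bar> * (indicator ?W x + indicator ?W (x - z)))"
      proof (rule integral_mono_AE')
        show "integrable lborel (\<lambda>x. \<bar>c\<bar> * (indicator ?W x + indicator ?W (x - z)))"
          using iW iW' by auto
        show "AE x in lborel. \<bar>indicator A (x - z) *\<^sub>R c - indicator A x *\<^sub>R c\<bar> \<le> \<bar>c\<bar> * (indicator ?W x + indicator ?W (x - z))"
          using mult_left_mono[OF pt, of "\<bar>c\<bar>"]
          by (auto simp: abs_mult[symmetric] algebra_simps simp del: abs_mult)
      qed auto
      also have "\<dots> = \<bar>c\<bar> * (2 * measure lborel ?W)"
        using iW iW' integral_translate[of "indicator ?W" z] by simp
      also have "\<dots> \<le> \<bar>c\<bar> * (2 * (3 * \<eta>))"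
      proof -
        have "measure lborel ?W \<le> 3 * \<eta>"
          unfolding measure_def using UK \<eta> by (intro enn2real_leI) auto
        then show ?thesis by (intro mult_left_mono) auto
      qed
      also have "\<dots> < e"
        using e by (simp add: \<eta>_def field_simps)
      finally show ?thesis .
    qed
    then show "\<exists>d>0. \<forall>z. norm z < d \<longrightarrow>
           (LINT x|lborel. \<bar>indicator A (x - z) *\<^sub>R c - indicator A x *\<^sub>R c\<bar>) < e"
      using d(1) by blast
  qed
next
  case (add f g)
  show ?case
  proof (intro allI impI)
    fix e :: real assume "e > 0"
    then have e2: "e / 2 > 0" by simp
    obtain d1 where d1: "d1 > 0" "\<And>z. norm z < d1 \<Longrightarrow> (LINT x|lborel. \<bar>f (x - z) - f x\<bar>) < e / 2"
      using add.IH(1)[rule_format, OF e2] by blast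
    obtain d2 where d2: "d2 > 0" "\<And>z. norm z < d2 \<Longrightarrow> (LINT x|lborel. \<bar>g (x - z) - g x\<bar>) < e / 2"
      using add.IH(2)[rule_format, OF e2] by blast
    note d = d1 d2
    have "(LINT x|lborel. \<bar>(f (x - z) + g (x - z)) - (f x + g x)\<bar>) < e" if "norm z < min d1 d2" for z
    proof -
      have i: "integrable lborel (\<lambda>x. \<bar>f (x - z) - f x\<bar>)" "integrable lborel (\<lambda>x. \<bar>g (x - z) - g x\<bar>)"
        using add.hyps by (auto intro!: Bochner_Integration.integrable_diff integrable_abs simp: integrable_translate)
      have "(LINT x|lborel. \<bar>(f (x - z) + g (x - z)) - (f x + g x)\<bar>) \<le> (LINT x|lborel. \<bar>f (x - z) - f x\<bar> + \<bar>g (x - z) - g x\<bar>)"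
        by (rule integral_mono_AE') (use i in auto)
      also have "\<dots> < e" using i d(2,4)[of z] that by simp
      finally show ?thesis .
    qed
    then show "\<exists>d>0. \<forall>z. norm z < d \<longrightarrow> (LINT x|lborel. \<bar>(f (x - z) + g (x - z)) - (f x + g x)\<bar>) < e"
      using d(1,3) by (intro exI[of _ "min d1 d2"]) auto
  qed
next
  case (lim f s)
  show ?case
  proof (intro allI impI)
    fix e :: real assume "e > 0"
    have [measurable]: "f \<in> borel_measurable borel" "\<And>i. s i \<in> borel_measurable borel"
      using lim.hyps by auto
    have "(\<lambda>i. LINT x|lborel. \<bar>s i x - f x\<bar>) \<longlonglongrightarrow> (LINT x::'a|lborel. 0 :: real)"
    \<comment> \<open>The induction rule provides approximants bounded by
      \<open>2 * \<bar>f x\<bar>\<close>, hence the factor 3 for the difference.\<close>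
    proof (rule integral_dominated_convergence[where w="\<lambda>x. 3 * \<bar>f x\<bar>"])
      show "integrable lborel (\<lambda>x. 3 * \<bar>f x\<bar>)" using lim.hyps by auto
      show "AE x in lborel. (\<lambda>i. \<bar>s i x - f x\<bar>) \<longlonglongrightarrow> 0"
        using lim.hyps by (auto intro!: tendsto_rabs_zero LIM_zero)
      show "AE x in lborel. norm \<bar>s i x - f x\<bar> \<le> 3 * \<bar>f x\<bar>" for i
      proof (rule AE_I2)
        fix x :: 'a
        have "norm (s i x) \<le> 2 * norm (f x)" using lim.hyps(3)[of x i] by simp
        then show "norm \<bar>s i x - f x\<bar> \<le> 3 * \<bar>f x\<bar>" by simp
      qed
    qed auto
    then have "(\<lambda>i. LINT x|lborel. \<bar>s i x - f x\<bar>) \<longlonglongrightarrow> 0" by simp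
    then obtain i where "(LINT x|lborel. \<bar>s i x - f x\<bar>) < e / 3"
      using \<open>e > 0\<close> order_tendstoD(2)[of _ 0 sequentially "e / 3"] by (fastforce simp: eventually_sequentially)
    moreover obtain d where d: "d > 0" "\<And>z. norm z < d \<Longrightarrow> (LINT x|lborel. \<bar>s i (x - z) - s i x\<bar>) < e / 3"
      using lim.IH[of i, rule_format, of "e / 3"] \<open>e > 0\<close> by auto
    ultimately have "(LINT x|lborel. \<bar>f (x - z) - f x\<bar>) < e" if "norm z < d" for z
    proof -
      have i: "integrable lborel (\<lambda>x. \<bar>s i x - f x\<bar>)" "integrable lborel (\<lambda>x. \<bar>s i (x - z) - s i x\<bar>)"
        "integrable lborel (\<lambda>x. \<bar>s i (x - z) - f (x - z)\<bar>)"
        using lim.hyps by (auto intro!: Bochner_Integration.integrable_diff integrable_abs simp: integrable_translate)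
      have "(LINT x|lborel. \<bar>f (x - z) - f x\<bar>) \<le>
         (LINT x|lborel. \<bar>s i (x - z) - f (x - z)\<bar> + \<bar>s i (x - z) - s i x\<bar> + \<bar>s i x - f x\<bar>)"
        by (rule integral_mono_AE') (use i in auto)
      also have "\<dots> = (LINT x|lborel. \<bar>s i x - f x\<bar>) + (LINT x|lborel. \<bar>s i (x - z) - s i x\<bar>) + (LINT x|lborel. \<bar>s i x - f x\<bar>)"
        using i integral_translate[of "\<lambda>x. \<bar>s i x - f x\<bar>" z] by simp
      also have "\<dots> < e" using d(2)[OF that] \<open>(LINT x|lborel. \<bar>s i x - f x\<bar>) < e / 3\<close> by simp
      finally show ?thesis .
    qed
    then show "\<exists>d>0. \<forall>z. norm z < d \<longrightarrow> (LINT x|lborel. \<bar>f (x - z) - f x\<bar>) < e"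
      using d(1) by blast
  qed
qed

text \<open>Truncation at height \<open>N\<close> reduces this to the L1 case: for the truncated
  function the squared increment is at most \<open>2 * N\<close> times the absolute increment of
  \<open>f\<close>, while the truncation error tends to 0 in L2 by dominated convergence.\<close>

lemma translation_L2:
  fixes f :: "'a::euclidean_space \<Rightarrow> real"
  assumes f: "integrable lborel f" and f2: "integrable lborel (\<lambda>x. (f x)\<^sup>2)" and "e > 0"
  shows "\<exists>d>0. \<forall>z. norm z < d \<longrightarrow> integrable lborel (\<lambda>x. (f (x - z) - f x)\<^sup>2) \<and> (LINT x|lborel. (f (x - z) - f x)\<^sup>2) < e"
proof -
  have [measurable]: "f \<in> borel_measurable borel" using f by auto
  define T where "T N x = max (- real N) (min (real N) (f x))" for N :: nat and x
  have [measurable]: "T N \<in> borel_measurable borel" for N unfolding T_def by measurable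
  have Tf: "\<bar>T N x\<bar> \<le> \<bar>f x\<bar>" and TN: "\<bar>T N x\<bar> \<le> real N" for N x unfolding T_def by auto
  have fT: "\<bar>f x - T N x\<bar> \<le> \<bar>f x\<bar>" for N x unfolding T_def by auto
  have lip: "\<bar>T N x - T N y\<bar> \<le> \<bar>f x - f y\<bar>" for N x y unfolding T_def by auto
  have "(\<lambda>N. LINT x|lborel. (f x - T N x)\<^sup>2) \<longlonglongrightarrow> (LINT x::'a|lborel. 0 :: real)"
  proof (rule integral_dominated_convergence[where w="\<lambda>x. (f x)\<^sup>2"])
    show "AE x in lborel. (\<lambda>N. (f x - T N x)\<^sup>2) \<longlonglongrightarrow> 0"
    proof (intro AE_I2 tendsto_eventually)
      fix x
      obtain N0 :: nat where "\<bar>f x\<bar> \<le> real N0" using real_arch_simple by blast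
      then show "\<forall>\<^sub>F N in sequentially. (f x - T N x)\<^sup>2 = 0"
        by (auto simp: eventually_sequentially T_def intro!: exI[of _ N0])
    qed
    show "AE x in lborel. norm ((f x - T N x)\<^sup>2) \<le> (f x)\<^sup>2" for N
      using fT[of _ N] by (auto simp: power2_le_iff_abs_le[symmetric] intro: power2_le_iff_abs_le[THEN iffD2] abs_le_square_iff[THEN iffD1])
  qed (use f2 in auto)
  then have "(\<lambda>N. LINT x|lborel. (f x - T N x)\<^sup>2) \<longlonglongrightarrow> 0" by simp
  \<comment> \<open>The square of a sum of three terms costs a factor 3, and the truncation error
    occurs twice: \<open>6 * (e / 12)\<close> is half of \<open>e\<close>. The L1 increment takes
    the other half.\<close>
  then obtain N where N: "(LINT x|lborel. (f x - T N x)\<^sup>2) < e / 12"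
    using \<open>e > 0\<close> order_tendstoD(2)[of _ 0 sequentially "e / 12"] by (fastforce simp: eventually_sequentially)
  have i1: "integrable lborel (\<lambda>x. (f x - T N x)\<^sup>2)"
    by (rule Bochner_Integration.integrable_bound[OF f2])
       (use fT[of _ N] in \<open>auto intro: abs_le_square_iff[THEN iffD1]\<close>)
  have "e / (12 * (real N + 1)) > 0" using \<open>e > 0\<close> by simp
  then obtain d where d: "d > 0" "\<And>z. norm z < d \<Longrightarrow> (LINT x|lborel. \<bar>f (x - z) - f x\<bar>) < e / (12 * (real N + 1))"
    using translation_L1[OF f, rule_format, of "e / (12 * (real N + 1))"] by blast
  have "integrable lborel (\<lambda>x. (f (x - z) - f x)\<^sup>2) \<and> (LINT x|lborel. (f (x - z) - f x)\<^sup>2) < e" if z: "norm z < d" for z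
  proof -
    have i2: "integrable lborel (\<lambda>x. (f (x - z) - T N (x - z))\<^sup>2)"
      using integrable_translate[of "\<lambda>x. (f x - T N x)\<^sup>2" z] i1 by simp
    have i3: "integrable lborel (\<lambda>x. \<bar>f (x - z) - f x\<bar>)"
      using f by (auto intro!: Bochner_Integration.integrable_diff integrable_abs simp: integrable_translate)
    let ?B = "\<lambda>x. 3 * (f (x - z) - T N (x - z))\<^sup>2 + 6 * real N * \<bar>f (x - z) - f x\<bar> + 3 * (f x - T N x)\<^sup>2"
    have iB: "integrable lborel ?B" using i1 i2 i3 by auto
    have le: "(f (x - z) - f x)\<^sup>2 \<le> ?B x" for x
    proof -
      have sq: "(a + b + c)\<^sup>2 \<le> 3 * a\<^sup>2 + 3 * b\<^sup>2 + 3 * c\<^sup>2" for a b c :: real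
      proof -
        have "0 \<le> (a - b)\<^sup>2 + (b - c)\<^sup>2 + (a - c)\<^sup>2" by simp
        then show ?thesis by (simp add: power2_eq_square algebra_simps)
      qed
      have "(T N (x - z) - T N x)\<^sup>2 = \<bar>T N (x - z) - T N x\<bar> * \<bar>T N (x - z) - T N x\<bar>"
        by (simp add: power2_eq_square abs_mult[symmetric])
      also have "\<dots> \<le> (2 * real N) * \<bar>f (x - z) - f x\<bar>"
        using TN[of N x] TN[of N "x - z"] lip[of N "x - z" x] by (intro mult_mono) auto
      finally have "(T N (x - z) - T N x)\<^sup>2 \<le> (2 * real N) * \<bar>f (x - z) - f x\<bar>" .
      then show ?thesis
        using sq[of "f (x - z) - T N (x - z)" "T N (x - z) - T N x" "T N x - f x"]
        by (simp add: power2_commute[of "T N x" "f x"])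
    qed
    have int: "integrable lborel (\<lambda>x. (f (x - z) - f x)\<^sup>2)"
      by (rule Bochner_Integration.integrable_bound[OF iB]) (use le in \<open>auto intro: order_trans[OF _ abs_ge_self]\<close>)
    have "(LINT x|lborel. (f (x - z) - f x)\<^sup>2) \<le> (LINT x|lborel. ?B x)"
      by (rule integral_mono[OF int iB le])
    also have "\<dots> = 6 * (LINT x|lborel. (f x - T N x)\<^sup>2) + 6 * real N * (LINT x|lborel. \<bar>f (x - z) - f x\<bar>)"
      using i1 i2 i3 integral_translate[of "\<lambda>x. (f x - T N x)\<^sup>2" z] by simp
    also have "\<dots> < e"
    proof -
      have "6 * real N * (LINT x|lborel. \<bar>f (x - z) - f x\<bar>) \<le> 6 * real N * (e / (12 * (real N + 1)))"
        using d(2)[OF z] by (intro mult_left_mono) auto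
      also have "\<dots> \<le> e / 2" using \<open>e > 0\<close> by (simp add: field_simps)
      finally show ?thesis using N by simp
    qed
    finally show ?thesis using int by simp
  qed
  then show ?thesis using d(1) by blast
qed

section \<open>Mollifications converge in L2\<close>

lemma lborel_distr_reflect: "distr lborel borel (\<lambda>z::'a::euclidean_space. x - z) = lborel"
proof -
  have "lborel = density (distr lborel borel (\<lambda>z::'a. x + (- 1) *\<^sub>R z)) (\<lambda>_. 1)"
    by (subst lborel_affine[of "-1" x]) auto
  then show ?thesis by (simp add: density_1)
qed

lemma lborel_reflect:
  fixes f :: "'a::euclidean_space \<Rightarrow> real"
  assumes [measurable]: "f \<in> borel_measurable borel"
  shows integrable_reflect: "integrable lborel (\<lambda>z. f (x - z)) \<longleftrightarrow> integrable lborel f"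
    and integral_reflect: "(LINT z|lborel. f (x - z)) = (LINT z|lborel. f z)"
proof -
  have "integrable (distr lborel borel (\<lambda>z. x - z)) f \<longleftrightarrow> integrable lborel (\<lambda>z. f (x - z))"
    by (rule integrable_distr_eq) auto
  then show "integrable lborel (\<lambda>z. f (x - z)) \<longleftrightarrow> integrable lborel f"
    by (simp add: lborel_distr_reflect)
  have "(LINT x|distr lborel borel (\<lambda>z. x - z). f x) = (LINT z|lborel. f (x - z))"
    by (rule integral_distr) auto
  then show "(LINT z|lborel. f (x - z)) = (LINT z|lborel. f z)"
    by (simp add: lborel_distr_reflect)
qed

text \<open>Jensen's inequality for the square, with the probability density \<open>\<eta>\<close>:
  the variance of \<open>k\<close> is nonnegative.\<close>

lemma weighted_square_le:
  fixes k \<eta> :: "'a \<Rightarrow> real"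
  assumes "\<And>z. \<eta> z \<ge> 0" "integrable M \<eta>" "(LINT z|M. \<eta> z) = 1"
    "integrable M (\<lambda>z. \<eta> z * k z)" "integrable M (\<lambda>z. \<eta> z * (k z)\<^sup>2)"
  shows "(LINT z|M. \<eta> z * k z)\<^sup>2 \<le> (LINT z|M. \<eta> z * (k z)\<^sup>2)"
proof -
  define m where "m = (LINT z|M. \<eta> z * k z)"
  have "0 \<le> (LINT z|M. \<eta> z * (k z - m)\<^sup>2)"
    using assms(1) by (intro integral_nonneg_AE) auto
  also have "(\<lambda>z. \<eta> z * (k z - m)\<^sup>2) = (\<lambda>z. \<eta> z * (k z)\<^sup>2 - 2 * m * (\<eta> z * k z) + m\<^sup>2 * \<eta> z)"
    by (auto simp: power2_eq_square algebra_simps)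
  also have "(LINT z|M. \<eta> z * (k z)\<^sup>2 - 2 * m * (\<eta> z * k z) + m\<^sup>2 * \<eta> z) =
     (LINT z|M. \<eta> z * (k z)\<^sup>2) - 2 * m * m + m\<^sup>2"
    using assms by (simp add: m_def)
  finally show ?thesis by (simp add: m_def power2_eq_square)
qed

lemma conv_cong_AE:
  assumes "AE x in lebesgue. f x = g x" "f \<in> borel_measurable lebesgue" "g \<in> borel_measurable lebesgue"
    "\<phi> \<in> borel_measurable borel"
  shows "conv f \<phi> x = conv g \<phi> x"
proof -
  have "(\<lambda>y. \<phi> (x - y)) \<in> borel_measurable lborel" using assms(4) by measurable
  then have "(\<lambda>y. \<phi> (x - y)) \<in> borel_measurable lebesgue" by (rule measurable_completion)
  then show ?thesis unfolding conv_def
    using assms by (intro integral_cong_AE) auto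
qed

text \<open>The mollification error is the average of the increments \<open>f (x - z) - f x\<close>
  with weight \<open>bump r z\<close>. Jensen moves the square inside the average and Tonelli
  exchanges the integrals, leaving the L2 increments for \<open>norm z < r\<close>. Tonelli is the
  reason to treat Borel functions over \<open>lborel\<close> before Lebesgue measurable
  ones.\<close>

lemma conv_bump_L2_borel:
  fixes f :: "'a::euclidean_space \<Rightarrow> real"
  assumes f: "integrable lborel f" and f2: "integrable lborel (\<lambda>x. (f x)\<^sup>2)" and "e > 0"
  shows "\<exists>d>0. \<forall>r. 0 < r \<longrightarrow> r < d \<longrightarrow>
    integrable lborel (\<lambda>x. (conv f (bump r) x - f x)\<^sup>2) \<and> (LINT x|lborel. (conv f (bump r) x - f x)\<^sup>2) \<le> e"
proof -
  have [measurable]: "f \<in> borel_measurable borel" using f by auto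
  obtain d where d: "d > 0" "\<And>z. norm z < d \<Longrightarrow> integrable lborel (\<lambda>x. (f (x - z) - f x)\<^sup>2)"
     "\<And>z. norm z < d \<Longrightarrow> (LINT x|lborel. (f (x - z) - f x)\<^sup>2) < e"
    using translation_L2[OF f f2 \<open>e > 0\<close>] by blast
  have "integrable lborel (\<lambda>x. (conv f (bump r) x - f x)\<^sup>2) \<and> (LINT x|lborel. (conv f (bump r) x - f x)\<^sup>2) \<le> e"
    if r: "0 < r" "r < d" for r
  proof -
    let ?\<eta> = "bump r :: 'a \<Rightarrow> real"
    have [measurable]: "?\<eta> \<in> borel_measurable borel"
      using bump_test[OF r(1)] by (rule test_function_borel)
    have fl: "integrable lebesgue f" using f by (simp add: integrable_completion)
    have [measurable]: "conv f ?\<eta> \<in> borel_measurable borel"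
      using Ck_conv[OF bump_test[OF r(1)] fl, of 0] by (auto intro: borel_measurable_continuous_onI)
    have c: "conv f ?\<eta> x - f x = (LINT z|lborel. ?\<eta> z * (f (x - z) - f x))"
      and i: "integrable lborel (\<lambda>z. ?\<eta> z * (f (x - z) - f x))" for x
    proof -
      have "integrable lborel (\<lambda>y. f y * ?\<eta> (x - y))"
        using test_function_conv_integrable[OF bump_test[OF r(1)] fl, of x] by (simp add: integrable_completion)
      then have i1: "integrable lborel (\<lambda>z. ?\<eta> z * f (x - z))"
        using integrable_reflect[of "\<lambda>y. f y * ?\<eta> (x - y)" x] by (simp add: mult.commute)
      have i2: "integrable lborel (\<lambda>z. ?\<eta> z * f x)" using bump_integrable[OF r(1), where 'a='a] by simp
      have "conv f ?\<eta> x = (LINT y|lborel. f y * ?\<eta> (x - y))"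
        unfolding conv_def by (rule integral_completion) measurable
      also have "\<dots> = (LINT z|lborel. ?\<eta> z * f (x - z))"
        using integral_reflect[of "\<lambda>y. f y * ?\<eta> (x - y)" x] by (simp add: mult.commute)
      finally show "conv f ?\<eta> x - f x = (LINT z|lborel. ?\<eta> z * (f (x - z) - f x))"
        using i1 i2 bump_integral[OF r(1), where 'a='a] by (simp add: right_diff_distrib)
      show "integrable lborel (\<lambda>z. ?\<eta> z * (f (x - z) - f x))"
        using i1 i2 by (simp add: right_diff_distrib)
    qed
    have pt: "ennreal ((conv f ?\<eta> x - f x)\<^sup>2) \<le> (\<integral>\<^sup>+z. ennreal (?\<eta> z * (f (x - z) - f x)\<^sup>2) \<partial>lborel)" for x
    \<comment> \<open>Jensen needs an integrable square; where the right side is infinite the claim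
      is trivial.\<close>
    proof (cases "(\<integral>\<^sup>+z. ennreal (?\<eta> z * (f (x - z) - f x)\<^sup>2) \<partial>lborel) = \<infinity>")
      case False
      have i2: "integrable lborel (\<lambda>z. ?\<eta> z * (f (x - z) - f x)\<^sup>2)"
        using False bump_nonneg[OF r(1), where 'a='a] by (intro integrableI_nonneg) (auto simp: less_top)
      have "(conv f ?\<eta> x - f x)\<^sup>2 \<le> (LINT z|lborel. ?\<eta> z * (f (x - z) - f x)\<^sup>2)"
        unfolding c
        using bump_nonneg[OF r(1), where 'a='a] bump_integrable[OF r(1), where 'a='a] bump_integral[OF r(1), where 'a='a] i i2
        by (intro weighted_square_le) auto
      then show ?thesis
        using bump_nonneg[OF r(1), where 'a='a] by (subst nn_integral_eq_integral[OF i2]) (auto intro: ennreal_leI)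
    qed simp
    have "(\<integral>\<^sup>+x. ennreal ((conv f ?\<eta> x - f x)\<^sup>2) \<partial>lborel) \<le>
        (\<integral>\<^sup>+x. (\<integral>\<^sup>+z. ennreal (?\<eta> z * (f (x - z) - f x)\<^sup>2) \<partial>lborel) \<partial>lborel)"
      by (intro nn_integral_mono pt)
    also have "\<dots> = (\<integral>\<^sup>+z. (\<integral>\<^sup>+x. ennreal (?\<eta> z * (f (x - z) - f x)\<^sup>2) \<partial>lborel) \<partial>lborel)"
      by (rule lborel_pair.Fubini') measurable
    also have "\<dots> \<le> (\<integral>\<^sup>+z. ennreal (?\<eta> z * e) \<partial>lborel)"
    proof (rule nn_integral_mono)
      fix z
      show "(\<integral>\<^sup>+x. ennreal (?\<eta> z * (f (x - z) - f x)\<^sup>2) \<partial>lborel) \<le> ennreal (?\<eta> z * e)"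
      proof (cases "norm z < d")
        case True
        have "(\<integral>\<^sup>+x. ennreal (?\<eta> z * (f (x - z) - f x)\<^sup>2) \<partial>lborel) = ennreal (LINT x|lborel. ?\<eta> z * (f (x - z) - f x)\<^sup>2)"
          using d(2)[OF True] bump_nonneg[OF r(1), where 'a='a] by (intro nn_integral_eq_integral) auto
        also have "\<dots> \<le> ennreal (?\<eta> z * e)"
          using d(3)[OF True] bump_nonneg[OF r(1), of z] by (intro ennreal_leI) (auto intro: mult_left_mono)
        finally show ?thesis .
      next
        case False
        then have "?\<eta> z = 0" using r by (intro bump_eq_0) auto
        then show ?thesis by simp
      qed
    qed
    also have "\<dots> = ennreal (LINT z|lborel. ?\<eta> z * e)"
      using bump_integrable[OF r(1), where 'a='a] bump_nonneg[OF r(1), where 'a='a] \<open>e > 0\<close>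
      by (intro nn_integral_eq_integral) auto
    also have "\<dots> = ennreal e" using bump_integral[OF r(1), where 'a='a] by simp
    finally have n: "(\<integral>\<^sup>+x. ennreal ((conv f ?\<eta> x - f x)\<^sup>2) \<partial>lborel) \<le> ennreal e" .
    have int: "integrable lborel (\<lambda>x. (conv f ?\<eta> x - f x)\<^sup>2)"
      using n by (intro integrableI_nonneg) (auto intro: order.strict_trans1)
    then show ?thesis
      using n \<open>e > 0\<close> by (subst (asm) nn_integral_eq_integral) (auto simp: ennreal_le_iff)
  qed
  then show ?thesis using d(1) by blast
qed

text \<open>A Borel function equal to \<open>f\<close> almost everywhere has the same convolution at
  every point.\<close>

lemma conv_bump_L2:
  fixes f :: "'a::euclidean_space \<Rightarrow> real"
  assumes f: "integrable lebesgue f" and f2: "integrable lebesgue (\<lambda>x. (f x)\<^sup>2)" and "e > 0"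
  shows "\<exists>d>0. \<forall>r. 0 < r \<longrightarrow> r < d \<longrightarrow>
    integrable lebesgue (\<lambda>x. (conv f (bump r) x - f x)\<^sup>2) \<and> (LINT x|lebesgue. (conv f (bump r) x - f x)\<^sup>2) \<le> e"
proof -
  have fm: "f \<in> borel_measurable lebesgue" using f by auto
  obtain f' where f'[measurable]: "f' \<in> borel_measurable lborel" and eq: "AE x in lborel. f x = f' x"
    using completion_ex_borel_measurable_real[OF fm] by blast
  have eql: "AE x in lebesgue. f x = f' x" using eq by (simp add: AE_completion_iff)
  have fm': "f' \<in> borel_measurable lebesgue" using f' by (rule measurable_completion)
  have "integrable lebesgue f'" using f fm fm' eql by (subst (asm) integrable_cong_AE) auto
  then have i1: "integrable lborel f'" by (simp add: integrable_completion)
  have "integrable lebesgue (\<lambda>x. (f' x)\<^sup>2)"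
    using f2 fm fm' eql by (subst (asm) integrable_cong_AE[of _ _ "\<lambda>x. (f' x)\<^sup>2"]) auto
  then have i2: "integrable lborel (\<lambda>x. (f' x)\<^sup>2)" by (simp add: integrable_completion)
  obtain d where d: "d > 0" "\<And>r. 0 < r \<Longrightarrow> r < d \<Longrightarrow>
    integrable lborel (\<lambda>x. (conv f' (bump r) x - f' x)\<^sup>2) \<and> (LINT x|lborel. (conv f' (bump r) x - f' x)\<^sup>2) \<le> e"
    using conv_bump_L2_borel[OF i1 i2 \<open>e > 0\<close>] by blast
  have "integrable lebesgue (\<lambda>x. (conv f (bump r) x - f x)\<^sup>2) \<and> (LINT x|lebesgue. (conv f (bump r) x - f x)\<^sup>2) \<le> e"
    if r: "0 < r" "r < d" for r
  proof -
    have b: "bump r \<in> borel_measurable (borel :: 'a measure)"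
      using bump_test[OF r(1)] by (rule test_function_borel)
    have ceq: "conv f (bump r) x = conv f' (bump r) x" for x
      using eql fm fm' b by (rule conv_cong_AE)
    have cm[measurable]: "conv f' (bump r) \<in> borel_measurable borel"
      using Ck_conv[OF bump_test[OF r(1)] \<open>integrable lebesgue f'\<close>, of 0] by (auto intro: borel_measurable_continuous_onI)
    have m1: "(\<lambda>x. (conv f' (bump r) x - f' x)\<^sup>2) \<in> borel_measurable lborel" by measurable
    have m1': "(\<lambda>x. (conv f' (bump r) x - f' x)\<^sup>2) \<in> borel_measurable lebesgue" 
      using m1 by (rule measurable_completion)
    have "conv f' (bump r) \<in> borel_measurable lborel" using cm by simp
    then have "conv f' (bump r) \<in> borel_measurable lebesgue" by (rule measurable_completion)
    then have m2: "(\<lambda>x. (conv f' (bump r) x - f x)\<^sup>2) \<in> borel_measurable lebesgue"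
      using fm by measurable
    have ae: "AE x in lebesgue. (conv f' (bump r) x - f x)\<^sup>2 = (conv f' (bump r) x - f' x)\<^sup>2"
      using eql by eventually_elim simp
    have "integrable lebesgue (\<lambda>x. (conv f' (bump r) x - f' x)\<^sup>2)"
      using d(2)[OF r] m1 by (simp add: integrable_completion)
    moreover have "(LINT x|lebesgue. (conv f' (bump r) x - f' x)\<^sup>2) \<le> e"
      using d(2)[OF r] m1 by (simp add: integral_completion)
    ultimately show ?thesis unfolding ceq
      using integrable_cong_AE[OF m2 m1' ae] integral_cong_AE[OF m2 m1' ae] by simp
  qed
  then show ?thesis using d(1) by blast
qed

subsection \<open>Square integrable functions\<close>

text \<open>Relative to an arbitrary measure, because the same facts are needed on \<open>D\<close>
  and on its compact subsets, where approximation takes place.\<close>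

definition sq_integrable :: "'a measure \<Rightarrow> ('a \<Rightarrow> real) \<Rightarrow> bool" where
  "sq_integrable M f \<longleftrightarrow> f \<in> borel_measurable M \<and> integrable M (\<lambda>x. (f x)\<^sup>2)"

lemma sq_integrable_measurable [measurable_dest]: "sq_integrable M f \<Longrightarrow> f \<in> borel_measurable M"
  by (simp add: sq_integrable_def)

lemma sq_integrable_square: "sq_integrable M f \<Longrightarrow> integrable M (\<lambda>x. (f x)\<^sup>2)"
  by (simp add: sq_integrable_def)

lemma sq_integrable_mult:
  assumes "sq_integrable M f" "sq_integrable M g"
  shows "integrable M (\<lambda>x. f x * g x)"
proof (rule Bochner_Integration.integrable_bound)
  show "integrable M (\<lambda>x. (f x)\<^sup>2 + (g x)\<^sup>2)" using assms by (simp add: sq_integrable_def)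
  have "\<bar>a * b\<bar> \<le> \<bar>a\<^sup>2 + b\<^sup>2\<bar>" for a b :: real
  proof -
    have "2 * (\<bar>a\<bar> * \<bar>b\<bar>) \<le> a\<^sup>2 + b\<^sup>2" using sum_squares_bound[of "\<bar>a\<bar>" "\<bar>b\<bar>"] by (simp add: mult_ac)
    moreover have "0 \<le> \<bar>a\<bar> * \<bar>b\<bar>" by simp
    ultimately have "\<bar>a\<bar> * \<bar>b\<bar> \<le> \<bar>a\<^sup>2 + b\<^sup>2\<bar>" by linarith
    then show ?thesis by (simp only: abs_mult)
  qed
  then show "AE x in M. norm (f x * g x) \<le> norm ((f x)\<^sup>2 + (g x)\<^sup>2)" by simp
qed (use assms in \<open>auto simp: sq_integrable_def\<close>)

lemma sq_integrable_add: "sq_integrable M f \<Longrightarrow> sq_integrable M g \<Longrightarrow> sq_integrable M (\<lambda>x. f x + g x)"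
  using sq_integrable_mult[of M f g] by (auto simp: sq_integrable_def power2_sum mult.assoc)

lemma sq_integrable_uminus: "sq_integrable M f \<Longrightarrow> sq_integrable M (\<lambda>x. - f x)"
  by (auto simp: sq_integrable_def)

lemma sq_integrable_diff: "sq_integrable M f \<Longrightarrow> sq_integrable M g \<Longrightarrow> sq_integrable M (\<lambda>x. f x - g x)"
  using sq_integrable_add[of M f "\<lambda>x. - g x"] sq_integrable_uminus[of M g] by simp

lemma sq_integrable_bounded_mult:
  assumes "sq_integrable M f" "b \<in> borel_measurable M" "AE x in M. \<bar>b x\<bar> \<le> B"
  shows "sq_integrable M (\<lambda>x. b x * f x)"
  unfolding sq_integrable_def
proof
  have [measurable]: "f \<in> borel_measurable M" "b \<in> borel_measurable M" using assms by (auto simp: sq_integrable_def)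
  show "(\<lambda>x. b x * f x) \<in> borel_measurable M" by measurable
  show "integrable M (\<lambda>x. (b x * f x)\<^sup>2)"
  proof (rule Bochner_Integration.integrable_bound)
    show "integrable M (\<lambda>x. B\<^sup>2 * (f x)\<^sup>2)" using assms(1) by (simp add: sq_integrable_def)
    show "AE x in M. norm ((b x * f x)\<^sup>2) \<le> norm (B\<^sup>2 * (f x)\<^sup>2)"
      using assms(3)
    proof eventually_elim
      case (elim x)
      then have "(b x)\<^sup>2 \<le> B\<^sup>2" by (simp add: abs_le_square_iff[symmetric])
      then show ?case by (simp add: power_mult_distrib mult_right_mono)
    qed
  qed measurable
qed

lemma sq_integrable_bounded:
  assumes "finite_measure M" "b \<in> borel_measurable M" "AE x in M. \<bar>b x\<bar> \<le> B"
  shows "sq_integrable M b"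
proof -
  have "sq_integrable M (\<lambda>x. 1)"
    using finite_measure.integrable_const[OF assms(1)] by (simp add: sq_integrable_def)
  then show ?thesis using sq_integrable_bounded_mult[OF _ assms(2,3)] by fastforce
qed

lemma sq_integrable_integrable:
  assumes "finite_measure M" "sq_integrable M f" shows "integrable M f"
  using sq_integrable_mult[OF assms(2) sq_integrable_bounded[OF assms(1), of "\<lambda>_. 1" 1]] by simp

lemma Cauchy_Schwarz_integral:
  assumes "sq_integrable M f" "sq_integrable M g"
  shows "(LINT x|M. f x * g x)\<^sup>2 \<le> (LINT x|M. (f x)\<^sup>2) * (LINT x|M. (g x)\<^sup>2)"
proof -
  define A where "A = (LINT x|M. (f x)\<^sup>2)"
  define B where "B = (LINT x|M. f x * g x)"
  define C where "C = (LINT x|M. (g x)\<^sup>2)"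
  have nn: "A \<ge> 0" "C \<ge> 0" unfolding A_def C_def by auto
  have p: "0 \<le> A - 2 * t * B + t\<^sup>2 * C" for t
  proof -
    have "0 \<le> (LINT x|M. (f x - t * g x)\<^sup>2)" by simp
    also have "(\<lambda>x. (f x - t * g x)\<^sup>2) = (\<lambda>x. (f x)\<^sup>2 - 2 * t * (f x * g x) + t\<^sup>2 * (g x)\<^sup>2)"
      by (auto simp: power2_eq_square algebra_simps)
    also have "(LINT x|M. (f x)\<^sup>2 - 2 * t * (f x * g x) + t\<^sup>2 * (g x)\<^sup>2) = A - 2 * t * B + t\<^sup>2 * C"
      using assms sq_integrable_mult[OF assms] by (simp add: A_def B_def C_def sq_integrable_def)
    finally show ?thesis .
  qed
  show ?thesis
  proof (cases "C = 0")
    case True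
    have "B = 0"
    proof (rule ccontr)
      assume "B \<noteq> 0"
      \<comment> \<open>Without a quadratic term the polynomial is linear in \<open>t\<close>, and
        at this \<open>t\<close> it equals -1.\<close>
      then show False using p[of "(A + 1) / (2 * B)"] True by simp
    qed
    then show ?thesis using nn by (simp add: A_def B_def C_def)
  next
    case False
    then have "C > 0" using nn by simp
    \<comment> \<open>\<open>B / C\<close> is the minimizer of the quadratic polynomial in
      \<open>t\<close>.\<close>
    then have "B\<^sup>2 \<le> A * C" using p[of "B / C"]
      by (simp add: field_simps power2_eq_square)
    then show ?thesis by (simp only: A_def B_def C_def)
  qed
qed

definition L2_tendsto :: "'a measure \<Rightarrow> (nat \<Rightarrow> 'a \<Rightarrow> real) \<Rightarrow> ('a \<Rightarrow> real) \<Rightarrow> bool" where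
  "L2_tendsto M s f \<longleftrightarrow> (\<forall>n. sq_integrable M (s n)) \<and> sq_integrable M f \<and>
     (\<lambda>n. LINT x|M. (s n x - f x)\<^sup>2) \<longlonglongrightarrow> 0"

lemma tendsto_0_le:
  fixes a b :: "nat \<Rightarrow> real"
  assumes "\<And>n. a n \<le> b n" "b \<longlonglongrightarrow> 0" "\<And>n. 0 \<le> a n"
  shows "a \<longlonglongrightarrow> 0"
  by (rule tendsto_sandwich[of "\<lambda>_. 0" a sequentially b 0]) (use assms in auto)

lemma L2_tendstoD:
  assumes "L2_tendsto M s f"
  shows "sq_integrable M (s n)" "sq_integrable M f" "(\<lambda>n. LINT x|M. (s n x - f x)\<^sup>2) \<longlonglongrightarrow> 0"
  using assms unfolding L2_tendsto_def by blast+

lemma L2_tendsto_le: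
  assumes "L2_tendsto M s f" "\<And>n. sq_integrable M (t n)" "sq_integrable M g"
    "\<And>n. AE x in M. (t n x - g x)\<^sup>2 \<le> C * (s n x - f x)\<^sup>2"
  shows "L2_tendsto M t g"
proof -
  have i: "integrable M (\<lambda>x. (s n x - f x)\<^sup>2)" "integrable M (\<lambda>x. (t n x - g x)\<^sup>2)" for n
    using L2_tendstoD(1,2)[OF assms(1)] assms(2,3) by (simp_all add: sq_integrable_square sq_integrable_diff)
  have "(LINT x|M. (t n x - g x)\<^sup>2) \<le> C * (LINT x|M. (s n x - f x)\<^sup>2)" for n
    using integral_mono_AE[OF i(2) integrable_mult_right[OF i(1)] assms(4)] by simp
  then have "(\<lambda>n. LINT x|M. (t n x - g x)\<^sup>2) \<longlonglongrightarrow> 0"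
    by (rule tendsto_0_le[OF _ tendsto_mult_right_zero[OF L2_tendstoD(3)[OF assms(1)]]]) simp
  then show ?thesis using assms(2,3) unfolding L2_tendsto_def by blast
qed

lemma L2_tendsto_add:
  assumes "L2_tendsto M s f" "L2_tendsto M t g"
  shows "L2_tendsto M (\<lambda>n x. s n x + t n x) (\<lambda>x. f x + g x)"
proof -
  have sq: "sq_integrable M (s n)" "sq_integrable M (t n)" "sq_integrable M f" "sq_integrable M g" for n
    using L2_tendstoD[OF assms(1)] L2_tendstoD[OF assms(2)] by blast+
  have i: "integrable M (\<lambda>x. (s n x - f x)\<^sup>2)" "integrable M (\<lambda>x. (t n x - g x)\<^sup>2)" 
     "integrable M (\<lambda>x. (s n x + t n x - (f x + g x))\<^sup>2)" for n
    using sq by (auto intro!: sq_integrable_square sq_integrable_diff sq_integrable_add)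
  have A: "(\<lambda>n. LINT x|M. (s n x - f x)\<^sup>2) \<longlonglongrightarrow> 0" "(\<lambda>n. LINT x|M. (t n x - g x)\<^sup>2) \<longlonglongrightarrow> 0"
    using L2_tendstoD(3)[OF assms(1)] L2_tendstoD(3)[OF assms(2)] by blast+
  have lim: "(\<lambda>n. 2 * (LINT x|M. (s n x - f x)\<^sup>2) + 2 * (LINT x|M. (t n x - g x)\<^sup>2)) \<longlonglongrightarrow> 0"
    using tendsto_add[OF tendsto_mult_right_zero[OF A(1), of 2] tendsto_mult_right_zero[OF A(2), of 2]]
    by (simp only: add_0_right)
  have pt: "(s n x + t n x - (f x + g x))\<^sup>2 \<le> 2 * (s n x - f x)\<^sup>2 + 2 * (t n x - g x)\<^sup>2" for n x
  proof -
    have "0 \<le> ((s n x - f x) - (t n x - g x))\<^sup>2" by simp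
    then show ?thesis by (simp add: power2_eq_square algebra_simps)
  qed
  have "(LINT x|M. (s n x + t n x - (f x + g x))\<^sup>2) \<le> 2 * (LINT x|M. (s n x - f x)\<^sup>2) + 2 * (LINT x|M. (t n x - g x)\<^sup>2)" for n
    using integral_mono[OF i(3) Bochner_Integration.integrable_add[OF integrable_mult_right[OF i(1)] integrable_mult_right[OF i(2)]] pt] i
    by simp
  then have "(\<lambda>n. LINT x|M. (s n x + t n x - (f x + g x))\<^sup>2) \<longlonglongrightarrow> 0"
    by (rule tendsto_0_le[OF _ lim]) simp
  then show ?thesis using sq_integrable_add[OF sq(1,2)] sq_integrable_add[OF sq(3,4)]
    unfolding L2_tendsto_def by blast
qed

text \<open>The difference of the products is
  \<open>(s - f) * (t - g) + (s - f) * g + f * (t - g)\<close>, and Cauchy-Schwarz applies to each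
  term.\<close>

lemma L2_tendsto_integral_mult:
  assumes "L2_tendsto M s f" "L2_tendsto M t g"
  shows "(\<lambda>n. LINT x|M. s n x * t n x) \<longlonglongrightarrow> (LINT x|M. f x * g x)"
proof -
  have sq: "sq_integrable M (s n)" "sq_integrable M (t n)" "sq_integrable M f" "sq_integrable M g" for n
    using L2_tendstoD[OF assms(1)] L2_tendstoD[OF assms(2)] by blast+
  define a where "a n = (LINT x|M. (s n x - f x)\<^sup>2)" for n
  define b where "b n = (LINT x|M. (t n x - g x)\<^sup>2)" for n
  have ab: "a \<longlonglongrightarrow> 0" "b \<longlonglongrightarrow> 0"
    unfolding a_def b_def using L2_tendstoD(3)[OF assms(1)] L2_tendstoD(3)[OF assms(2)] by blast+
  have nn: "a n \<ge> 0" "b n \<ge> 0" for n by (auto simp: a_def b_def)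
  have CS: "\<bar>LINT x|M. p x * q x\<bar> \<le> sqrt (LINT x|M. (p x)\<^sup>2) * sqrt (LINT x|M. (q x)\<^sup>2)"
    if "sq_integrable M p" "sq_integrable M q" for p q
    using real_sqrt_le_mono[OF Cauchy_Schwarz_integral[OF that]] by (simp add: real_sqrt_mult)
  have "norm ((LINT x|M. s n x * t n x) - (LINT x|M. f x * g x)) \<le>
      sqrt (a n) * sqrt (b n) + sqrt (a n) * sqrt (LINT x|M. (g x)\<^sup>2) + sqrt (LINT x|M. (f x)\<^sup>2) * sqrt (b n)" for n
  proof -
    have d: "sq_integrable M (\<lambda>x. s n x - f x)" "sq_integrable M (\<lambda>x. t n x - g x)"
      using sq by (auto intro: sq_integrable_diff)
    have "(LINT x|M. s n x * t n x) - (LINT x|M. f x * g x) = (LINT x|M. s n x * t n x - f x * g x)"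
      using sq by (intro Bochner_Integration.integral_diff[symmetric] sq_integrable_mult)
    also have "(\<lambda>x. s n x * t n x - f x * g x) =
       (\<lambda>x. (s n x - f x) * (t n x - g x) + (s n x - f x) * g x + f x * (t n x - g x))"
      by (auto simp: algebra_simps)
    also have "(LINT x|M. (s n x - f x) * (t n x - g x) + (s n x - f x) * g x + f x * (t n x - g x)) =
       (LINT x|M. (s n x - f x) * (t n x - g x)) + (LINT x|M. (s n x - f x) * g x) + (LINT x|M. f x * (t n x - g x))"
      using sq_integrable_mult[OF d] sq_integrable_mult[OF d(1) sq(4)] sq_integrable_mult[OF sq(3) d(2)] by simp
    finally show ?thesis
      using CS[OF d] CS[OF d(1) sq(4)] CS[OF sq(3) d(2)] by (simp add: a_def b_def)
  qed
  moreover have "(\<lambda>n. sqrt (a n) * sqrt (b n) + sqrt (a n) * sqrt (LINT x|M. (g x)\<^sup>2) + sqrt (LINT x|M. (f x)\<^sup>2) * sqrt (b n)) \<longlonglongrightarrow> 0"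
  proof -
    have "(\<lambda>n. sqrt (a n) * sqrt (b n) + sqrt (a n) * C + D * sqrt (b n)) \<longlonglongrightarrow> sqrt 0 * sqrt 0 + sqrt 0 * C + D * sqrt 0" for C D
      by (intro tendsto_add tendsto_mult tendsto_const tendsto_real_sqrt ab)
    then show ?thesis by simp
  qed
  ultimately have "(\<lambda>n. norm ((LINT x|M. s n x * t n x) - (LINT x|M. f x * g x))) \<longlonglongrightarrow> 0"
    by (rule tendsto_0_le) (rule norm_ge_zero)
  then show ?thesis by (simp only: tendsto_norm_zero_iff LIM_zero_iff)
qed

lemma L2_tendsto_const: "sq_integrable M f \<Longrightarrow> L2_tendsto M (\<lambda>_. f) f"
  by (simp add: L2_tendsto_def)

text \<open>Serves for nonlinear coefficients such as \<open>h' (\<phi> n x)\<close>, which converge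
  only pointwise but stay bounded, next to a fixed square integrable factor.\<close>

lemma L2_tendsto_dominated:
  assumes f: "sq_integrable M f" and c: "\<And>n. c n \<in> borel_measurable M" "c' \<in> borel_measurable M"
    and B: "\<And>n. AE x in M. \<bar>c n x\<bar> \<le> B" and l: "AE x in M. (\<lambda>n. c n x) \<longlonglongrightarrow> c' x"
  shows "L2_tendsto M (\<lambda>n x. c n x * f x) (\<lambda>x. c' x * f x)"
proof -
  have [measurable]: "f \<in> borel_measurable M" using f by (simp add: sq_integrable_def)
  note c[measurable]
  have all: "AE x in M. \<forall>n. \<bar>c n x\<bar> \<le> B" using B by (simp add: AE_all_countable)
  have B': "AE x in M. \<bar>c' x\<bar> \<le> B"
    using l all
  proof eventually_elim
    case (elim x)
    then show ?case by (intro Lim_bounded[of "\<lambda>n. \<bar>c n x\<bar>" _ 0]) (auto intro: tendsto_rabs)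
  qed
  have "(\<lambda>n. LINT x|M. (c n x * f x - c' x * f x)\<^sup>2) \<longlonglongrightarrow> (LINT x|M. (0 :: real))"
  proof (rule integral_dominated_convergence[where w="\<lambda>x. (2 * B)\<^sup>2 * (f x)\<^sup>2"])
    show "integrable M (\<lambda>x. (2 * B)\<^sup>2 * (f x)\<^sup>2)" using f by (simp add: sq_integrable_def)
    show "AE x in M. (\<lambda>n. (c n x * f x - c' x * f x)\<^sup>2) \<longlonglongrightarrow> 0"
      using l
    proof eventually_elim
      case (elim x)
      have "(\<lambda>n. (c n x * f x - c' x * f x)\<^sup>2) \<longlonglongrightarrow> (c' x * f x - c' x * f x)\<^sup>2"
        by (intro tendsto_intros elim)
      then show ?case by simp
    qed
    show "AE x in M. norm ((c n x * f x - c' x * f x)\<^sup>2) \<le> (2 * B)\<^sup>2 * (f x)\<^sup>2" for n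
      using all B'
    proof eventually_elim
      case (elim x)
      have "\<bar>c n x - c' x\<bar> \<le> 2 * B" using elim(1)[rule_format, of n] elim(2) by linarith
      then have "(c n x - c' x)\<^sup>2 \<le> (2 * B)\<^sup>2" by (metis abs_ge_zero abs_le_square_iff abs_of_nonneg order_trans)
      then have "(c n x - c' x)\<^sup>2 * (f x)\<^sup>2 \<le> (2 * B)\<^sup>2 * (f x)\<^sup>2" by (rule mult_right_mono) simp
      then show ?case by (simp add: left_diff_distrib[symmetric] power_mult_distrib)
    qed
  qed measurable
  then show ?thesis
    using sq_integrable_bounded_mult[OF f c(1) B] sq_integrable_bounded_mult[OF f c(2) B']
    unfolding L2_tendsto_def by simp
qed

lemma L2_tendsto_AE_subseq:
  assumes "finite_measure M" "L2_tendsto M s f"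
  obtains r where "strict_mono r" "AE x in M. (\<lambda>n. s (r n) x) \<longlonglongrightarrow> f x"
proof -
  have sq: "sq_integrable M (s n)" "sq_integrable M f" for n using L2_tendstoD[OF assms(2)] by blast+
  have d: "sq_integrable M (\<lambda>x. s n x - f x)" for n using sq by (intro sq_integrable_diff)
  have "\<exists>r. strict_mono r \<and> (AE x in M. (\<lambda>n. (s (r n) x - f x)\<^sup>2) \<longlonglongrightarrow> 0)"
    by (rule tendsto_L1_AE_subseq[where u="\<lambda>n x. (s n x - f x)\<^sup>2"])
       (use sq_integrable_square[OF d] L2_tendstoD(3)[OF assms(2)] in simp_all)
  then obtain r where r: "strict_mono r" "AE x in M. (\<lambda>n. (s (r n) x - f x)\<^sup>2) \<longlonglongrightarrow> 0" by blast
  have "AE x in M. (\<lambda>n. s (r n) x) \<longlonglongrightarrow> f x"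
    using r(2)
  proof eventually_elim
    case (elim x)
    then have "(\<lambda>n. sqrt ((s (r n) x - f x)\<^sup>2)) \<longlonglongrightarrow> sqrt 0" by (intro tendsto_real_sqrt)
    then have "(\<lambda>n. \<bar>s (r n) x - f x\<bar>) \<longlonglongrightarrow> 0" by simp
    then show ?case by (simp add: tendsto_rabs_zero_iff LIM_zero_iff)
  qed
  then show ?thesis using r(1) that by blast
qed

subsection \<open>Weak derivatives\<close>

lemma borel_measurable_lebesgue_onI:
  "f \<in> borel_measurable borel \<Longrightarrow> f \<in> borel_measurable (lebesgue_on S)"
  by (intro measurable_restrict_space1 measurable_completion) simp

lemma integral_lebesgue_on_support:
  fixes f :: "'a::euclidean_space \<Rightarrow> real"
  assumes "S \<in> sets lebesgue" "T \<in> sets lebesgue" "T \<subseteq> S" "\<And>x. x \<in> S - T \<Longrightarrow> f x = 0"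
  shows "(LINT x|lebesgue_on S. f x) = (LINT x|lebesgue_on T. f x)"
proof -
  have "(\<lambda>x. indicator S x *\<^sub>R f x) = (\<lambda>x. indicator T x *\<^sub>R f x)"
    using assms(3,4) by (auto simp: indicator_def fun_eq_iff)
  then show ?thesis using assms(1,2) by (simp add: integral_restrict_space)
qed

lemma sq_integrable_subset:
  assumes "sq_integrable (lebesgue_on S) f" "T \<subseteq> S" "S \<in> sets lebesgue" "T \<in> sets lebesgue"
  shows "sq_integrable (lebesgue_on T) f"
proof -
  have "set_integrable lebesgue S (\<lambda>x. (f x)\<^sup>2)"
    using assms by (simp add: sq_integrable_def integrable_restrict_space set_integrable_def)
  then have "set_integrable lebesgue T (\<lambda>x. (f x)\<^sup>2)"
    using assms(4,2) by (rule set_integrable_subset)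
  moreover have "f \<in> borel_measurable (lebesgue_on T)"
    using assms(1,2) by (auto simp: sq_integrable_def intro: measurable_restrict_mono)
  ultimately show ?thesis
    using assms(4) by (simp add: sq_integrable_def integrable_restrict_space set_integrable_def)
qed

lemma continuous_sq_integrable_compact:
  fixes f :: "'a::euclidean_space \<Rightarrow> real"
  assumes "continuous_on UNIV f" "compact K"
  shows "sq_integrable (lebesgue_on K) f"
proof -
  have "bounded (f ` K)"
    using assms by (intro compact_imp_bounded compact_continuous_image) (auto intro: continuous_on_subset)
  then obtain B where "\<forall>x\<in>K. \<bar>f x\<bar> \<le> B" by (auto simp: bounded_iff)
  moreover have "K \<in> lmeasurable" using assms(2) by (rule lmeasurable_compact)
  ultimately show ?thesis
    using assms(1)
    by (intro sq_integrable_bounded[of _ _ B] finite_measure_lebesgue_on borel_measurable_lebesgue_onI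
        borel_measurable_continuous_onI AE_I2) auto
qed

lemma test_function_sq_integrable:
  assumes "\<phi> \<in> test_functions D" "S \<in> lmeasurable"
  shows "sq_integrable (lebesgue_on S) \<phi>"
proof -
  obtain B where "\<And>x. \<bar>\<phi> x\<bar> \<le> B" using test_function_bounded[OF assms(1)] by blast
  then show ?thesis using assms(2)
    by (intro sq_integrable_bounded[of _ _ B] finite_measure_lebesgue_on borel_measurable_lebesgue_onI
        test_function_borel[OF assms(1)] AE_I2)
qed

text \<open>Makes a function on \<open>D\<close> available for convolution. The extension has in
  general no weak derivative across the boundary, so derivatives of its mollification are identified
  only where the kernel stays inside \<open>D\<close>.\<close>

definition extend0 :: "'a set \<Rightarrow> ('a \<Rightarrow> real) \<Rightarrow> 'a \<Rightarrow> real" where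
  "extend0 D u x = indicator D x * u x"

lemma extend0_integrable:
  fixes D :: "'a::euclidean_space set"
  assumes "D \<in> lmeasurable" "sq_integrable (lebesgue_on D) u"
  shows "integrable lebesgue (extend0 D u)" "integrable lebesgue (\<lambda>x. (extend0 D u x)\<^sup>2)"
proof -
  have D: "D \<in> sets lebesgue" using assms(1) by (rule fmeasurableD)
  have "integrable (lebesgue_on D) u"
    using assms by (intro sq_integrable_integrable finite_measure_lebesgue_on)
  then show "integrable lebesgue (extend0 D u)"
    using D by (simp add: integrable_restrict_space extend0_def[abs_def])
  have "integrable (lebesgue_on D) (\<lambda>x. (u x)\<^sup>2)" using assms(2) by (rule sq_integrable_square)
  then have "integrable lebesgue (\<lambda>x. indicator D x *\<^sub>R (u x)\<^sup>2)"
    using D by (simp add: integrable_restrict_space)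
  moreover have "(\<lambda>x. (extend0 D u x)\<^sup>2) = (\<lambda>x. indicator D x *\<^sub>R (u x)\<^sup>2)"
    by (auto simp: extend0_def indicator_def)
  ultimately show "integrable lebesgue (\<lambda>x. (extend0 D u x)\<^sup>2)"
    by (simp only:)
qed

lemma conv_extend0:
  fixes D :: "'a::euclidean_space set"
  shows "D \<in> sets lebesgue \<Longrightarrow> conv (extend0 D u) \<phi> x = (LINT y|lebesgue_on D. u y * \<phi> (x - y))"
  by (simp add: conv_def extend0_def integral_restrict_space mult.assoc)

lemma test_function_reflect:
  assumes \<phi>: "\<phi> \<in> test_functions UNIV" and D: "\<And>y. y \<notin> D \<Longrightarrow> x - y \<notin> K"
    and K: "compact K" "\<And>z. z \<notin> K \<Longrightarrow> \<phi> z = 0"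
  shows "(\<lambda>y. \<phi> (x - y)) \<in> test_functions D"
    and "partial i (\<lambda>y. \<phi> (x - y)) y = - partial i \<phi> (x - y)"
proof -
  show "(\<lambda>y. \<phi> (x - y)) \<in> test_functions D"
  proof (rule test_functionsI)
    show "Ck k (\<lambda>y. \<phi> (x - y))" for k
      using Ck_affine[of k \<phi> x "-1"] \<phi> by (simp add: test_functions_def)
    show "compact ((\<lambda>z. x - z) ` K)"
      using K(1) by (intro compact_continuous_image continuous_intros)
    show "(\<lambda>z. x - z) ` K \<subseteq> D" using D by force
    show "\<phi> (x - y) = 0" if "y \<notin> (\<lambda>z. x - z) ` K" for y
      using that K(2)[of "x - y"] image_eqI[of y "\<lambda>z. x - z" "x - y" K] by auto
  qed
  have d: "\<phi> differentiable (at (x - y))" using \<phi> by (rule test_function_differentiable)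
  have "((\<phi> \<circ> (\<lambda>y. x - y)) has_derivative (frechet_derivative \<phi> (at (x - y)) \<circ> (\<lambda>h. - h))) (at y)"
    using d by (intro diff_chain_at) (auto intro!: derivative_eq_intros simp: frechet_derivative_works[symmetric])
  then have "((\<lambda>y. \<phi> (x - y)) has_derivative (\<lambda>h. frechet_derivative \<phi> (at (x - y)) (- h))) (at y)"
    by (simp add: o_def)
  then show "partial i (\<lambda>y. \<phi> (x - y)) y = - partial i \<phi> (x - y)"
    using linear_frechet_derivative[OF d] by (simp add: partialI linear_neg) (simp add: partial_def)
qed

text \<open>One direction at a time: approximation, product rule and chain rule are coordinatewise,
  and \<open>has_weak_gradient_iff\<close> reassembles the gradient.\<close>

definition weak_partial :: "'a::euclidean_space set \<Rightarrow> 'a \<Rightarrow> ('a \<Rightarrow> real) \<Rightarrow> ('a \<Rightarrow> real) \<Rightarrow> bool" where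
  "weak_partial D i u v \<longleftrightarrow> sq_integrable (lebesgue_on D) u \<and> sq_integrable (lebesgue_on D) v \<and>
     (\<forall>\<phi>\<in>test_functions D. (LINT x|lebesgue_on D. u x * partial i \<phi> x) = - (LINT x|lebesgue_on D. v x * \<phi> x))"

lemma conv_bump_test_function:
  assumes "r > 0" "cball x r \<subseteq> D"
  shows "(\<lambda>y. bump r (x - y)) \<in> test_functions D"
  by (rule test_function_reflect[OF bump_test[OF assms(1)], where K="cball 0 r"])
     (use assms in \<open>auto simp: subset_iff dist_norm norm_minus_commute bump_eq_0\<close>)

text \<open>The reflected kernel around \<open>x\<close> is a test function on \<open>D\<close>. The
  minus sign from differentiating \<open>x - y\<close> in \<open>y\<close> cancels the one in the
  definition of a weak derivative.\<close>

lemma conv_weak_partial: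
  assumes "D \<in> sets lebesgue" "weak_partial D i u v" "r > 0" "cball x r \<subseteq> D"
  shows "conv (extend0 D u) (partial i (bump r)) x = conv (extend0 D v) (bump r) x"
proof -
  let ?\<psi> = "\<lambda>y. bump r (x - y)"
  have p: "partial i ?\<psi> y = - partial i (bump r) (x - y)" for y
    by (rule test_function_reflect(2)[OF bump_test[OF assms(3)], where K="cball 0 r" and D=D])
       (use assms in \<open>auto simp: subset_iff dist_norm norm_minus_commute bump_eq_0\<close>)
  have "?\<psi> \<in> test_functions D" using assms(3,4) by (rule conv_bump_test_function)
  then have "(LINT y|lebesgue_on D. u y * partial i ?\<psi> y) = - (LINT y|lebesgue_on D. v y * ?\<psi> y)"
    using assms(2) by (simp add: weak_partial_def)
  then show ?thesis using assms(1) by (simp add: conv_extend0 p)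
qed

lemma compact_in_open_radius:
  fixes D :: "'a::euclidean_space set"
  assumes "compact K" "open D" "K \<subseteq> D"
  obtains d where "d > 0" "\<And>x. x \<in> K \<Longrightarrow> cball x d \<subseteq> D"
proof -
  have "closed (- D)" "K \<inter> - D = {}" using assms by auto
  then obtain d where d: "d > 0" "\<forall>x\<in>K. \<forall>y\<in>- D. d \<le> dist x y"
    using separate_compact_closed[OF assms(1)] by blast
  have "cball x (d / 2) \<subseteq> D" if "x \<in> K" for x
  proof
    fix y assume "y \<in> cball x (d / 2)"
    then have "\<not> d \<le> dist x y" using d(1) by simp
    then show "y \<in> D" using d(2) that by blast
  qed
  then show ?thesis using that[of "d / 2"] d(1) by simp
qed

lemma integral_square_lebesgue_on_le:
  fixes f :: "'a::euclidean_space \<Rightarrow> real"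
  assumes "K \<in> sets lebesgue" "integrable lebesgue (\<lambda>x. (f x)\<^sup>2)" "(LINT x|lebesgue. (f x)\<^sup>2) \<le> e"
    and "\<And>x. x \<in> K \<Longrightarrow> g x = f x"
  shows "(LINT x|lebesgue_on K. (g x)\<^sup>2) \<le> e"
proof -
  have "(LINT x|lebesgue_on K. (g x)\<^sup>2) = (LINT x|lebesgue. indicator K x *\<^sub>R (g x)\<^sup>2)"
    using assms(1) by (simp add: integral_restrict_space)
  also have "\<dots> \<le> (LINT x|lebesgue. (f x)\<^sup>2)"
    by (rule integral_mono_AE') (use assms in \<open>auto simp: indicator_def\<close>)
  finally show ?thesis using assms(3) by simp
qed

text \<open>Mollification radii below the distance from \<open>K\<close> to the boundary let
  smoothing commute with the derivative on \<open>K\<close>. The sequence depends on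
  \<open>K\<close>, which suffices since weak derivatives are tested one compact support at a
  time.\<close>

lemma local_smooth_approx:
  fixes D :: "'a::euclidean_space set"
  assumes D: "open D" "bounded D" and w: "weak_partial D i u v" and i: "i \<in> Basis"
    and K: "compact K" "K \<subseteq> D"
  obtains w where "\<And>n k. Ck k (w n)" "L2_tendsto (lebesgue_on K) w u"
    "L2_tendsto (lebesgue_on K) (\<lambda>n. partial i (w n)) v"
proof -
  have Dl: "D \<in> lmeasurable" using D by (simp add: lmeasurable_open)
  then have Ds: "D \<in> sets lebesgue" by (rule fmeasurableD)
  have Ks: "K \<in> sets lebesgue" using lmeasurable_compact[OF K(1)] by (rule fmeasurableD)
  have sq: "sq_integrable (lebesgue_on D) u" "sq_integrable (lebesgue_on D) v"
    using w by (auto simp: weak_partial_def)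
  let ?U = "extend0 D u" and ?V = "extend0 D v"
  note iU = extend0_integrable[OF Dl sq(1)] and iV = extend0_integrable[OF Dl sq(2)]
  obtain d where d: "d > 0" "\<And>x. x \<in> K \<Longrightarrow> cball x d \<subseteq> D"
    using compact_in_open_radius[OF K(1) D(1) K(2)] by blast
  have ex: "\<exists>r>0. r < d \<and>
     (integrable lebesgue (\<lambda>x. (conv ?U (bump r) x - ?U x)\<^sup>2) \<and> (LINT x|lebesgue. (conv ?U (bump r) x - ?U x)\<^sup>2) \<le> e) \<and>
     (integrable lebesgue (\<lambda>x. (conv ?V (bump r) x - ?V x)\<^sup>2) \<and> (LINT x|lebesgue. (conv ?V (bump r) x - ?V x)\<^sup>2) \<le> e)"
    if e: "e > 0" for e
  proof -
    obtain d1 where d1: "d1 > 0" "\<And>r. 0 < r \<Longrightarrow> r < d1 \<Longrightarrow>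
        integrable lebesgue (\<lambda>x. (conv ?U (bump r) x - ?U x)\<^sup>2) \<and> (LINT x|lebesgue. (conv ?U (bump r) x - ?U x)\<^sup>2) \<le> e"
      using conv_bump_L2[OF iU e] by blast
    obtain d2 where d2: "d2 > 0" "\<And>r. 0 < r \<Longrightarrow> r < d2 \<Longrightarrow>
        integrable lebesgue (\<lambda>x. (conv ?V (bump r) x - ?V x)\<^sup>2) \<and> (LINT x|lebesgue. (conv ?V (bump r) x - ?V x)\<^sup>2) \<le> e"
      using conv_bump_L2[OF iV e] by blast
    define r where "r = min d (min d1 d2) / 2"
    have "0 < r" "r < d" "r < d1" "r < d2" using d(1) d1(1) d2(1) by (auto simp: r_def)
    then show ?thesis using d1(2) d2(2) by blast
  qed
  have "\<forall>n. \<exists>r>0. r < d \<and>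
     (integrable lebesgue (\<lambda>x. (conv ?U (bump r) x - ?U x)\<^sup>2) \<and> (LINT x|lebesgue. (conv ?U (bump r) x - ?U x)\<^sup>2) \<le> inverse (real (Suc n))) \<and>
     (integrable lebesgue (\<lambda>x. (conv ?V (bump r) x - ?V x)\<^sup>2) \<and> (LINT x|lebesgue. (conv ?V (bump r) x - ?V x)\<^sup>2) \<le> inverse (real (Suc n)))"
    by (intro allI ex) simp
  then obtain r where r: "\<And>n. r n > 0" "\<And>n. r n < d"
     "\<And>n. integrable lebesgue (\<lambda>x. (conv ?U (bump (r n)) x - ?U x)\<^sup>2)"
     "\<And>n. (LINT x|lebesgue. (conv ?U (bump (r n)) x - ?U x)\<^sup>2) \<le> inverse (real (Suc n))"
     "\<And>n. integrable lebesgue (\<lambda>x. (conv ?V (bump (r n)) x - ?V x)\<^sup>2)"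
     "\<And>n. (LINT x|lebesgue. (conv ?V (bump (r n)) x - ?V x)\<^sup>2) \<le> inverse (real (Suc n))"
    by (subst (asm) choice_iff) blast
  define w where "w n = conv ?U (bump (r n))" for n
  have pw: "partial i (w n) = conv ?U (partial i (bump (r n)))" for n
    unfolding w_def using bump_test[OF r(1)] iU(1) i by (rule partial_conv)
  have pK: "partial i (w n) x = conv ?V (bump (r n)) x" if "x \<in> K" for n x
  proof -
    have "cball x (r n) \<subseteq> D" using d(2)[OF that] r(2)[of n] by fastforce
    then show ?thesis unfolding pw by (intro conv_weak_partial[OF Ds \<open>weak_partial D i u v\<close> r(1)])
  qed
  have C: "Ck k (w n)" for k n
    unfolding w_def using bump_test[OF r(1)] iU(1) by (rule Ck_conv)
  have lim: "(\<lambda>n. inverse (real (Suc n))) \<longlonglongrightarrow> 0" by (rule LIMSEQ_inverse_real_of_nat)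
  have "L2_tendsto (lebesgue_on K) w u"
    unfolding L2_tendsto_def
  proof (intro conjI allI)
    show "sq_integrable (lebesgue_on K) (w n)" for n
      using C[of 0 n] K(1) by (intro continuous_sq_integrable_compact) auto
    show "sq_integrable (lebesgue_on K) u"
      using sq(1) K(2) Ds Ks by (rule sq_integrable_subset)
    have "(LINT x|lebesgue_on K. (w n x - u x)\<^sup>2) \<le> inverse (real (Suc n))" for n
      by (rule integral_square_lebesgue_on_le[OF Ks r(3) r(4)])
         (use K(2) in \<open>auto simp: w_def extend0_def\<close>)
    then show "(\<lambda>n. LINT x|lebesgue_on K. (w n x - u x)\<^sup>2) \<longlonglongrightarrow> 0"
      by (rule tendsto_0_le[OF _ lim]) simp
  qed
  moreover have "L2_tendsto (lebesgue_on K) (\<lambda>n. partial i (w n)) v"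
    unfolding L2_tendsto_def
  proof (intro conjI allI)
    show "sq_integrable (lebesgue_on K) (partial i (w n))" for n
    proof -
      have "Ck 0 (partial i (w n))" using C[of "Suc 0" n] i by simp
      then show ?thesis using K(1) by (intro continuous_sq_integrable_compact) auto
    qed
    show "sq_integrable (lebesgue_on K) v"
      using sq(2) K(2) Ds Ks by (rule sq_integrable_subset)
    have "(LINT x|lebesgue_on K. (partial i (w n) x - v x)\<^sup>2) \<le> inverse (real (Suc n))" for n
      by (rule integral_square_lebesgue_on_le[OF Ks r(5) r(6)])
         (use K(2) in \<open>auto simp: pK extend0_def\<close>)
    then show "(\<lambda>n. LINT x|lebesgue_on K. (partial i (w n) x - v x)\<^sup>2) \<longlonglongrightarrow> 0"
      by (rule tendsto_0_le[OF _ lim]) simp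
  qed
  ultimately show ?thesis using that C by blast
qed

text \<open>Small mollifications of \<open>v\<close> vanish on a given compact set, because their
  values there are integrals of \<open>v\<close> against test functions; yet they converge to
  \<open>v\<close> in L2. Countably many compact sets exhaust \<open>D\<close>.\<close>

lemma fundamental_lemma_calculus_of_variations:
  fixes D :: "'a::euclidean_space set"
  assumes D: "open D" "bounded D" and v: "sq_integrable (lebesgue_on D) v"
    and z: "\<And>\<phi>. \<phi> \<in> test_functions D \<Longrightarrow> (LINT x|lebesgue_on D. v x * \<phi> x) = 0"
  shows "AE x in lebesgue_on D. v x = 0"
proof -
  have Dl: "D \<in> lmeasurable" using D by (simp add: lmeasurable_open)
  then have Ds: "D \<in> sets lebesgue" by (rule fmeasurableD)
  let ?V = "extend0 D v"
  note iV = extend0_integrable[OF Dl v]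
  have K0: "AE x in lebesgue_on K. v x = 0" if K: "compact K" "K \<subseteq> D" for K
  proof -
    have Ks: "K \<in> sets lebesgue" using lmeasurable_compact[OF K(1)] by (rule fmeasurableD)
    have sqK: "sq_integrable (lebesgue_on K) v" using v K(2) Ds Ks by (rule sq_integrable_subset)
    obtain d where d: "d > 0" "\<And>x. x \<in> K \<Longrightarrow> cball x d \<subseteq> D"
      using compact_in_open_radius[OF K(1) D(1) K(2)] by blast
    have "(LINT x|lebesgue_on K. (v x)\<^sup>2) \<le> e" if e: "e > 0" for e
    proof -
      obtain d2 where d2: "d2 > 0" "\<And>r. 0 < r \<Longrightarrow> r < d2 \<Longrightarrow>
        integrable lebesgue (\<lambda>x. (conv ?V (bump r) x - ?V x)\<^sup>2) \<and> (LINT x|lebesgue. (conv ?V (bump r) x - ?V x)\<^sup>2) \<le> e"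
        using conv_bump_L2[OF iV e] by blast
      define r where "r = min d d2 / 2"
      have r: "0 < r" "r < d" "r < d2" using d(1) d2(1) by (auto simp: r_def)
      have c0: "conv ?V (bump r) x = 0" if "x \<in> K" for x
      proof -
        have "cball x r \<subseteq> D" using d(2)[OF that] r(2) by fastforce
        then show ?thesis using z[OF conv_bump_test_function[OF r(1)]] Ds by (simp add: conv_extend0)
      qed
      have "(LINT x|lebesgue_on K. (- v x)\<^sup>2) \<le> e"
        by (rule integral_square_lebesgue_on_le[of _ "\<lambda>x. conv ?V (bump r) x - ?V x"])
           (use d2(2)[OF r(1,3)] Ks c0 K(2) in \<open>auto simp: extend0_def\<close>)
      then show ?thesis by simp
    qed
    then have "(LINT x|lebesgue_on K. (v x)\<^sup>2) \<le> 0" by (rule field_le_epsilon) simp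
    moreover have "(LINT x|lebesgue_on K. (v x)\<^sup>2) \<ge> 0" by simp
    ultimately have "(LINT x|lebesgue_on K. (v x)\<^sup>2) = 0" by simp
    then have "AE x in lebesgue_on K. (v x)\<^sup>2 = 0"
      using sq_integrable_square[OF sqK] by (subst (asm) integral_nonneg_eq_0_iff_AE) auto
    then show ?thesis by simp
  qed
  obtain C where C: "\<And>n::nat. compact (C n)" "\<And>n. C n \<subseteq> D" "(\<Union>n. C n) = D"
    using open_Union_compact_subsets[OF D(1)] by metis
  have Cs: "C n \<in> sets lebesgue" for n using lmeasurable_compact[OF C(1)] by (rule fmeasurableD)
  have AEn: "AE x in lebesgue. x \<in> C n \<longrightarrow> v x = 0" for n
    using K0[OF C(1,2), of n] Cs[of n] by (simp add: AE_restrict_space_iff)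
  then have "AE x in lebesgue. \<forall>n. x \<in> C n \<longrightarrow> v x = 0"
    unfolding AE_all_countable using AEn by blast
  then have "AE x in lebesgue. x \<in> D \<longrightarrow> v x = 0"
    by eventually_elim (use C(3) in auto)
  then show ?thesis using Ds by (simp add: AE_restrict_space_iff)
qed

text \<open>By translation invariance the difference quotients of \<open>F\<close> in direction \<open>i\<close> have integral zero.\<close>

lemma integral_partial_eq_0:
  fixes F :: "'a::euclidean_space \<Rightarrow> real"
  assumes d: "\<And>x. F differentiable (at x)" and c: "continuous_on UNIV (partial i F)"
    and K: "compact K" "\<And>x. x \<notin> K \<Longrightarrow> F x = 0" "\<And>x. x \<notin> K \<Longrightarrow> partial i F x = 0"
    and i: "i \<in> Basis"
  shows "(LINT x|lborel. partial i F x) = 0"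
proof -
  have cF: "continuous_on UNIV F"
    using d by (intro differentiable_imp_continuous_on) (auto simp: differentiable_on_def)
  have [measurable]: "F \<in> borel_measurable borel" "partial i F \<in> borel_measurable borel"
    using cF c by (auto intro: borel_measurable_continuous_onI)
  have "bounded (partial i F ` K)"
    using K(1) c by (intro compact_imp_bounded compact_continuous_image) (auto intro: continuous_on_subset)
  then obtain B0 where B0: "\<And>x. x \<in> K \<Longrightarrow> \<bar>partial i F x\<bar> \<le> B0" by (auto simp: bounded_iff)
  define B where "B = max B0 0"
  have B: "\<bar>partial i F x\<bar> \<le> B" "B \<ge> 0" for x
    using B0[of x] K(3)[of x] unfolding B_def by (cases "x \<in> K") auto
  have der: "((\<lambda>t. F (x + t *\<^sub>R i)) has_real_derivative partial i F (x + t *\<^sub>R i)) (at t)" for x t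
  proof -
    have "((F \<circ> (\<lambda>t. x + t *\<^sub>R i)) has_derivative (frechet_derivative F (at (x + t *\<^sub>R i)) \<circ> (\<lambda>h. h *\<^sub>R i))) (at t)"
      using d by (intro diff_chain_at) (auto intro!: derivative_eq_intros simp: frechet_derivative_works[symmetric])
    moreover have "frechet_derivative F (at (x + t *\<^sub>R i)) (h *\<^sub>R i) = partial i F (x + t *\<^sub>R i) * h" for h
      using linear_frechet_derivative[OF d] by (simp add: linear_cmul) (simp add: partial_def mult.commute)
    ultimately show ?thesis 
      unfolding has_field_derivative_def o_def by simp
  qed
  have lip: "\<bar>F (x + t *\<^sub>R i) - F x\<bar> \<le> B * \<bar>t\<bar>" for x t
    using field_differentiable_bound[of UNIV "\<lambda>t. F (x + t *\<^sub>R i)" "\<lambda>t. partial i F (x + t *\<^sub>R i)" B t 0] der B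
    by auto
  define h where "h n = inverse (real (Suc n))" for n
  have h: "h n > 0" "h n \<le> 1" for n by (auto simp: h_def field_simps)
  have hl: "h \<longlonglongrightarrow> 0" unfolding h_def by (rule LIMSEQ_inverse_real_of_nat)
  let ?q = "\<lambda>n x. (F (x + h n *\<^sub>R i) - F x) / h n"
  \<comment> \<open>All steps \<open>h n\<close> are at most 1, so this one compact set contains the
    supports of all the difference quotients and carries the dominating function.\<close>
  let ?K = "{x + y |x y. x \<in> K \<and> y \<in> cball 0 1}"
  have Kc: "compact ?K" using K(1) by (intro compact_sums) auto
  have lim: "(\<lambda>n. LINT x|lborel. ?q n x) \<longlonglongrightarrow> (LINT x|lborel. partial i F x)"
  proof (rule integral_dominated_convergence[where w="\<lambda>x. B * indicator ?K x"])
    have "emeasure lborel ?K < \<infinity>"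
      using emeasure_bounded_finite[OF compact_imp_bounded[OF Kc]] by simp
    moreover have "?K \<in> sets borel" using compact_imp_closed[OF Kc] by (rule borel_closed)
    ultimately show "integrable lborel (\<lambda>x. B * indicator ?K x)" by (intro integrable_mult_right) auto
    show "AE x in lborel. (\<lambda>n. ?q n x) \<longlonglongrightarrow> partial i F x"
    proof (rule AE_I2)
      fix x
      have "((\<lambda>t. (F (x + t *\<^sub>R i) - F x) / t) \<longlongrightarrow> partial i F x) (at 0)"
        using der[of x 0] by (simp add: DERIV_def)
      then show "(\<lambda>n. ?q n x) \<longlonglongrightarrow> partial i F x"
        by (rule filterlim_compose) (use hl h(1) in \<open>auto simp: filterlim_at intro!: always_eventually simp: less_imp_neq[THEN not_sym]\<close>)
    qed
    show "AE x in lborel. norm (?q n x) \<le> B * indicator ?K x" for n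
    proof (rule AE_I2)
      fix x
      show "norm (?q n x) \<le> B * indicator ?K x"
      proof (cases "x \<in> ?K")
        case True
        then show ?thesis using lip[of x "h n"] h(1)[of n] by (simp add: divide_le_eq)
      next
        case False
        have "x \<notin> K"
        proof
          assume "x \<in> K"
          then have "x \<in> ?K" by - (rule CollectI, rule exI[of _ x], rule exI[of _ 0], simp)
          with False show False by contradiction
        qed
        moreover have "x + h n *\<^sub>R i \<notin> K"
        proof
          assume "x + h n *\<^sub>R i \<in> K"
          then have "x \<in> ?K" using h[of n] i
            by - (rule CollectI, rule exI[of _ "x + h n *\<^sub>R i"], rule exI[of _ "- (h n *\<^sub>R i)"], simp)
          with False show False by contradiction
        qed
        ultimately show ?thesis using K(2) False by simp
      qed
    qed
  qed measurable
  have zero: "(LINT x|lborel. ?q n x) = 0" for n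
  proof -
    have iF: "integrable lborel F" using cF K(1,2) by (rule continuous_compact_support_integrable)
    have "integrable lborel (\<lambda>x. F (x - (- (h n *\<^sub>R i))))" using iF by (subst integrable_translate) auto
    moreover have "(LINT x|lborel. F (x - (- (h n *\<^sub>R i)))) = (LINT x|lborel. F x)"
      by (rule integral_translate) measurable
    ultimately show ?thesis using iF by simp
  qed
  show ?thesis by (rule LIMSEQ_unique[OF lim[unfolded zero] tendsto_const])
qed

section \<open>Product rule, integration by parts and chain rule for weak derivatives\<close>

lemma weak_partialD:
  assumes "weak_partial D i u v"
  shows "sq_integrable (lebesgue_on D) u" "sq_integrable (lebesgue_on D) v"
    "\<phi> \<in> test_functions D \<Longrightarrow> (LINT x|lebesgue_on D. u x * partial i \<phi> x) = - (LINT x|lebesgue_on D. v x * \<phi> x)"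
  using assms by (auto simp: weak_partial_def)

lemma sq_integrable_mult_test:
  assumes "\<phi> \<in> test_functions E" "sq_integrable (lebesgue_on S) f"
  shows "sq_integrable (lebesgue_on S) (\<lambda>x. f x * \<phi> x)"
proof -
  obtain B where "\<And>x. \<bar>\<phi> x\<bar> \<le> B" using test_function_bounded[OF assms(1)] by blast
  then have "sq_integrable (lebesgue_on S) (\<lambda>x. \<phi> x * f x)"
    using assms(2) test_function_borel[OF assms(1)]
    by (intro sq_integrable_bounded_mult[where B=B] borel_measurable_lebesgue_onI AE_I2)
  then show ?thesis by (simp add: mult.commute)
qed

text \<open>Only \<open>u1\<close> is mollified: with a smooth \<open>w n\<close> in its place,
  \<open>w n * \<psi>\<close> is an admissible test function for \<open>u2\<close>. In the limit
  only the L2 convergence of \<open>w n\<close> and of its derivative is used, against fixed square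
  integrable factors.\<close>

lemma weak_partial_mult:
  fixes D :: "'a::euclidean_space set"
  assumes D: "open D" "bounded D" and i: "i \<in> Basis"
    and w1: "weak_partial D i u1 v1" and w2: "weak_partial D i u2 v2"
    and sq: "sq_integrable (lebesgue_on D) (\<lambda>x. u1 x * u2 x)"
      "sq_integrable (lebesgue_on D) (\<lambda>x. u1 x * v2 x + v1 x * u2 x)"
  shows "weak_partial D i (\<lambda>x. u1 x * u2 x) (\<lambda>x. u1 x * v2 x + v1 x * u2 x)"
  unfolding weak_partial_def
proof (intro conjI ballI sq)
  fix \<psi> assume \<psi>: "\<psi> \<in> test_functions D"
  have Ds: "D \<in> sets lebesgue" using D by (simp add: fmeasurableD lmeasurable_open)
  obtain K where K: "compact K" "K \<subseteq> D" "\<And>x. x \<notin> K \<Longrightarrow> \<psi> x = 0" "\<And>x. x \<notin> K \<Longrightarrow> partial i \<psi> x = 0"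
    using test_functionsE[OF \<psi>] by metis
  have Ks: "K \<in> sets lebesgue" using lmeasurable_compact[OF K(1)] by (rule fmeasurableD)
  let ?M = "lebesgue_on K"
  note restr = sq_integrable_subset[OF _ K(2) Ds Ks]
  have sK: "sq_integrable ?M u1" "sq_integrable ?M v1" "sq_integrable ?M u2" "sq_integrable ?M v2"
    using weak_partialD(1,2)[OF w1] weak_partialD(1,2)[OF w2] by (auto intro: restr)
  have DK: "(LINT x|lebesgue_on D. f x) = (LINT x|?M. f x)" if "\<And>x. x \<notin> K \<Longrightarrow> f x = 0" for f :: "'a \<Rightarrow> real"
    using that K(2) Ds Ks by (intro integral_lebesgue_on_support) auto
  note d\<psi> = test_functions_partial[OF \<psi> i]
  have s1: "sq_integrable ?M (\<lambda>x. u2 x * partial i \<psi> x)" "sq_integrable ?M (\<lambda>x. u2 x * \<psi> x)"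
    "sq_integrable ?M (\<lambda>x. v2 x * \<psi> x)"
    using sK by (auto intro: sq_integrable_mult_test[OF \<psi>] sq_integrable_mult_test[OF d\<psi>])
  obtain w where w: "\<And>n k. Ck k (w n)" "L2_tendsto ?M w u1" "L2_tendsto ?M (\<lambda>n. partial i (w n)) v1"
    using local_smooth_approx[OF D w1 i K(1,2)] by blast
  have sw: "sq_integrable ?M (w n)" "sq_integrable ?M (partial i (w n))" for n
    using w(2,3) by (auto simp: L2_tendsto_def)
  have eqn: "(LINT x|?M. w n x * (u2 x * partial i \<psi> x)) + (LINT x|?M. partial i (w n) x * (u2 x * \<psi> x))
     = - (LINT x|?M. w n x * (v2 x * \<psi> x))" for n
  proof -
    let ?\<phi> = "\<lambda>x. w n x * \<psi> x"
    have t: "?\<phi> \<in> test_functions D"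
      using w(1) \<psi> K by (intro test_functionsI[of _ K] Ck_mult) (auto simp: test_functions_def)
    have p: "partial i ?\<phi> x = w n x * partial i \<psi> x + partial i (w n) x * \<psi> x" for x
      using w(1)[of "Suc 0" n] test_function_differentiable[OF \<psi>] by (intro partial_mult) auto
    have "(LINT x|lebesgue_on D. u2 x * partial i ?\<phi> x) = - (LINT x|lebesgue_on D. v2 x * ?\<phi> x)"
      by (rule weak_partialD(3)[OF w2 t])
    then have "(LINT x|?M. u2 x * partial i ?\<phi> x) = - (LINT x|?M. v2 x * ?\<phi> x)"
      using K(3,4) by (simp add: DK p)
    moreover have "(LINT x|?M. u2 x * partial i ?\<phi> x) =
       (LINT x|?M. w n x * (u2 x * partial i \<psi> x) + partial i (w n) x * (u2 x * \<psi> x))"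
      by (rule Bochner_Integration.integral_cong) (simp_all only: p, simp add: algebra_simps)
    moreover have "\<dots> = (LINT x|?M. w n x * (u2 x * partial i \<psi> x)) + (LINT x|?M. partial i (w n) x * (u2 x * \<psi> x))"
      using sw s1 by (intro Bochner_Integration.integral_add sq_integrable_mult)
    moreover have "(LINT x|?M. v2 x * ?\<phi> x) = (LINT x|?M. w n x * (v2 x * \<psi> x))"
      by (rule Bochner_Integration.integral_cong) auto
    ultimately show ?thesis by simp
  qed
  have "(\<lambda>n. (LINT x|?M. w n x * (u2 x * partial i \<psi> x)) + (LINT x|?M. partial i (w n) x * (u2 x * \<psi> x)))
     \<longlonglongrightarrow> (LINT x|?M. u1 x * (u2 x * partial i \<psi> x)) + (LINT x|?M. v1 x * (u2 x * \<psi> x))"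
    by (intro tendsto_add L2_tendsto_integral_mult w L2_tendsto_const s1)
  moreover have "(\<lambda>n. - (LINT x|?M. w n x * (v2 x * \<psi> x))) \<longlonglongrightarrow> - (LINT x|?M. u1 x * (v2 x * \<psi> x))"
    by (intro tendsto_minus L2_tendsto_integral_mult w L2_tendsto_const s1)
  ultimately have lim: "(LINT x|?M. u1 x * (u2 x * partial i \<psi> x)) + (LINT x|?M. v1 x * (u2 x * \<psi> x))
     = - (LINT x|?M. u1 x * (v2 x * \<psi> x))"
    unfolding eqn using LIMSEQ_unique by blast
  have "(LINT x|lebesgue_on D. u1 x * u2 x * partial i \<psi> x) = (LINT x|?M. u1 x * (u2 x * partial i \<psi> x))"
    using K(4) by (subst DK) (auto simp: mult.assoc)
  also have "\<dots> = - ((LINT x|?M. u1 x * (v2 x * \<psi> x)) + (LINT x|?M. v1 x * (u2 x * \<psi> x)))"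
    using lim by simp
  also have "(LINT x|?M. u1 x * (v2 x * \<psi> x)) + (LINT x|?M. v1 x * (u2 x * \<psi> x))
      = (LINT x|?M. u1 x * (v2 x * \<psi> x) + v1 x * (u2 x * \<psi> x))"
    using sK s1 by (intro Bochner_Integration.integral_add[symmetric] sq_integrable_mult)
  also have "\<dots> = (LINT x|?M. (u1 x * v2 x + v1 x * u2 x) * \<psi> x)"
    by (rule Bochner_Integration.integral_cong) (auto simp: algebra_simps)
  also have "\<dots> = (LINT x|lebesgue_on D. (u1 x * v2 x + v1 x * u2 x) * \<psi> x)"
    using K(3) by (subst DK) auto
  finally show "(LINT x|lebesgue_on D. u1 x * u2 x * partial i \<psi> x)
     = - (LINT x|lebesgue_on D. (u1 x * v2 x + v1 x * u2 x) * \<psi> x)" .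
qed

lemma integration_by_parts_compact:
  fixes f \<psi> :: "'a::euclidean_space \<Rightarrow> real"
  assumes f: "\<And>x. f differentiable (at x)" "continuous_on UNIV (partial i f)"
    and \<psi>: "\<psi> \<in> test_functions UNIV" "i \<in> Basis"
    and K: "compact K" "\<And>x. x \<notin> K \<Longrightarrow> \<psi> x = 0" "\<And>x. x \<notin> K \<Longrightarrow> partial i \<psi> x = 0"
  shows "(LINT x|lebesgue_on K. f x * partial i \<psi> x) = - (LINT x|lebesgue_on K. partial i f x * \<psi> x)"
proof -
  have Ks: "K \<in> sets lebesgue" using lmeasurable_compact[OF K(1)] by (rule fmeasurableD)
  have cf: "continuous_on UNIV f"
    using f(1) by (intro differentiable_imp_continuous_on) (auto simp: differentiable_on_def)
  have c\<psi>: "continuous_on UNIV \<psi>" "continuous_on UNIV (partial i \<psi>)"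
    using test_function_continuous \<psi> test_functions_partial by blast+
  let ?F = "\<lambda>x. f x * \<psi> x"
  have p: "partial i ?F x = f x * partial i \<psi> x + partial i f x * \<psi> x" for x
    using f(1) test_function_differentiable[OF \<psi>(1)] by (rule partial_mult)
  have cp: "continuous_on UNIV (partial i ?F)"
    unfolding p[abs_def] using cf c\<psi> f(2) by (intro continuous_intros)
  have "(LINT x|lborel. partial i ?F x) = 0"
  proof (rule integral_partial_eq_0[OF _ cp K(1)])
    show "(\<lambda>x. f x * \<psi> x) differentiable at x" for x
      using f(1) test_function_differentiable[OF \<psi>(1)] by (intro differentiable_mult)
  qed (use K \<psi> p in auto)
  moreover have "(LINT x|lborel. partial i ?F x) = (LINT x|lebesgue. partial i ?F x)"
    using cp by (intro integral_completion[symmetric]) (auto intro: borel_measurable_continuous_onI)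
  moreover have "(LINT x|lebesgue. partial i ?F x) = (LINT x|lebesgue_on K. partial i ?F x)"
  proof -
    have "(\<lambda>x. indicator K x *\<^sub>R partial i ?F x) = partial i ?F"
      using K by (auto simp: p indicator_def fun_eq_iff)
    then show ?thesis using Ks by (simp add: integral_restrict_space)
  qed
  ultimately have "(LINT x|lebesgue_on K. f x * partial i \<psi> x + partial i f x * \<psi> x) = 0"
    by (simp add: p)
  moreover have "(LINT x|lebesgue_on K. f x * partial i \<psi> x + partial i f x * \<psi> x) =
     (LINT x|lebesgue_on K. f x * partial i \<psi> x) + (LINT x|lebesgue_on K. partial i f x * \<psi> x)"
    using cf c\<psi> f(2) K(1)
    by (intro Bochner_Integration.integral_add sq_integrable_mult continuous_sq_integrable_compact)
  ultimately show ?thesis by simp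
qed

lemma continuous_on_abs_lipschitz:
  fixes h :: "real \<Rightarrow> real"
  assumes "\<And>s t. \<bar>h s - h t\<bar> \<le> L * \<bar>s - t\<bar>"
  shows "continuous_on UNIV h"
proof (rule lipschitz_on_continuous_on)
  show "(max L 0)-lipschitz_on UNIV h"
  proof (rule lipschitz_onI)
    show "dist (h x) (h y) \<le> max L 0 * dist x y" for x y
      using assms[of x y] mult_right_mono[of L "max L 0" "\<bar>x - y\<bar>"] by (simp add: dist_real_def)
  qed simp
qed

text \<open>With \<open>h\<close> and \<open>h'\<close> both Lipschitz, \<open>h (w n x)\<close> and
  \<open>h' (w n x)\<close> converge in L2 together with the smooth approximants \<open>w n\<close>,
  so the classical chain rule passes to the limit by products of L2 limits.\<close>

lemma weak_partial_chain:
  fixes D :: "'a::euclidean_space set"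
  assumes D: "open D" "bounded D" and i: "i \<in> Basis" and w: "weak_partial D i u v"
    and h: "\<And>s. (h has_real_derivative h' s) (at s)" "\<And>s. \<bar>h' s\<bar> \<le> B" "\<And>s t. \<bar>h' s - h' t\<bar> \<le> L * \<bar>s - t\<bar>"
  shows "weak_partial D i (\<lambda>x. h (u x)) (\<lambda>x. h' (u x) * v x)"
proof -
  have Dl: "D \<in> lmeasurable" using D by (simp add: lmeasurable_open)
  then have Ds: "D \<in> sets lebesgue" by (rule fmeasurableD)
  have sq: "sq_integrable (lebesgue_on D) u" "sq_integrable (lebesgue_on D) v"
    using w by (auto simp: weak_partial_def)
  have hc: "continuous_on UNIV h"
    using h(1) by (intro continuous_at_imp_continuous_on ballI DERIV_isCont) auto
  have h'c: "continuous_on UNIV h'" using h(3) by (rule continuous_on_abs_lipschitz)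
  have [measurable]: "h \<in> borel_measurable borel" "h' \<in> borel_measurable borel"
    using hc h'c by (auto intro: borel_measurable_continuous_onI)
  have hlip: "\<bar>h s - h t\<bar> \<le> B * \<bar>s - t\<bar>" for s t
    using field_differentiable_bound[of UNIV h h' B s t] h(1,2) by auto
  have hlip2: "(h s - h t)\<^sup>2 \<le> B\<^sup>2 * (s - t)\<^sup>2" for s t
    using power_mono[OF hlip[of s t], of 2] by (simp add: power_mult_distrib)
  have h'lip2: "(h' s - h' t)\<^sup>2 \<le> L\<^sup>2 * (s - t)\<^sup>2" for s t
    using power_mono[OF h(3)[of s t], of 2] by (simp add: power_mult_distrib)
  have sqh: "sq_integrable (lebesgue_on D) (\<lambda>x. h (u x))"
  proof -
    have [measurable]: "u \<in> borel_measurable (lebesgue_on D)" using sq(1) by (simp add: sq_integrable_def)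
    have s1: "sq_integrable (lebesgue_on D) (\<lambda>x. h (u x) - h 0)"
      unfolding sq_integrable_def
    proof
      show "integrable (lebesgue_on D) (\<lambda>x. (h (u x) - h 0)\<^sup>2)"
        by (rule Bochner_Integration.integrable_bound[of _ "\<lambda>x. B\<^sup>2 * (u x)\<^sup>2"])
           (use sq_integrable_square[OF sq(1)] hlip2[of _ 0] in auto)
    qed measurable
    have s2: "sq_integrable (lebesgue_on D) (\<lambda>x. h 0)"
      using Dl by (intro sq_integrable_bounded[where B="\<bar>h 0\<bar>"] finite_measure_lebesgue_on) auto
    show ?thesis using sq_integrable_add[OF s1 s2] by simp
  qed
  have sqh': "sq_integrable (lebesgue_on D) (\<lambda>x. h' (u x) * v x)"
  proof -
    have [measurable]: "u \<in> borel_measurable (lebesgue_on D)" using sq(1) by (simp add: sq_integrable_def)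
    show ?thesis using sq(2) h(2) by (intro sq_integrable_bounded_mult[where B=B]) auto
  qed
  show ?thesis
    unfolding weak_partial_def
  proof (intro conjI ballI sqh sqh')
    fix \<psi> assume \<psi>: "\<psi> \<in> test_functions D"
    obtain K where K: "compact K" "K \<subseteq> D" "\<And>x. x \<notin> K \<Longrightarrow> \<psi> x = 0" "\<And>x. x \<notin> K \<Longrightarrow> partial i \<psi> x = 0"
      using test_functionsE[OF \<psi>] by metis
    have Kl: "K \<in> lmeasurable" using lmeasurable_compact[OF K(1)] .
    have Ks: "K \<in> sets lebesgue" using Kl by (rule fmeasurableD)
    let ?M = "lebesgue_on K"
    note restr = sq_integrable_subset[OF _ K(2) Ds Ks]
    have DK: "(LINT x|lebesgue_on D. f x) = (LINT x|?M. f x)" if "\<And>x. x \<notin> K \<Longrightarrow> f x = 0" for f :: "'a \<Rightarrow> real"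
      using that K(2) Ds Ks by (intro integral_lebesgue_on_support) auto
    note d\<psi> = test_functions_partial[OF \<psi> i]
    have \<psi>U: "\<psi> \<in> test_functions UNIV" using \<psi> test_functions_mono[of D UNIV] by auto
    obtain w where w: "\<And>n k. Ck k (w n)" "L2_tendsto ?M w u" "L2_tendsto ?M (\<lambda>n. partial i (w n)) v"
      using local_smooth_approx[OF D w i K(1,2)] by blast
    have wc: "continuous_on UNIV (w n)" "continuous_on UNIV (partial i (w n))" for n
      using w(1)[of 0 n] w(1)[of "Suc 0" n] i by auto
    have wd: "w n differentiable (at x)" for n x using w(1)[of "Suc 0" n] by simp
    have eqn: "(LINT x|?M. h (w n x) * partial i \<psi> x) = - (LINT x|?M. h' (w n x) * (partial i (w n) x * \<psi> x))" for n
    proof -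
      have hw: "((\<lambda>x. h (w n x)) has_derivative (\<lambda>k. frechet_derivative (w n) (at x) k * h' (w n x))) (at x)" for x
        using DERIV_compose_FDERIV[OF h(1), of "w n" "frechet_derivative (w n) (at x)" x UNIV] wd[of n x]
        by (simp add: frechet_derivative_works)
      have p: "partial i (\<lambda>x. h (w n x)) = (\<lambda>x. partial i (w n) x * h' (w n x))"
        by (rule ext) (simp add: partialI[OF hw] partial_def)
      have "(LINT x|?M. h (w n x) * partial i \<psi> x) = - (LINT x|?M. partial i (\<lambda>x. h (w n x)) x * \<psi> x)"
      proof (rule integration_by_parts_compact[OF _ _ \<psi>U i K(1,3,4)])
        show "(\<lambda>x. h (w n x)) differentiable at x" for x using hw by (auto simp: differentiable_def)
        show "continuous_on UNIV (partial i (\<lambda>x. h (w n x)))"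
          unfolding p using wc by (intro continuous_intros continuous_on_compose2[OF h'c]) auto
      qed
      then show ?thesis by (simp add: p mult_ac)
    qed
    have l1: "L2_tendsto ?M (\<lambda>n x. h (w n x)) (\<lambda>x. h (u x))"
    proof (rule L2_tendsto_le[OF w(2) _ restr[OF sqh], where C="B\<^sup>2"])
      show "sq_integrable ?M (\<lambda>x. h (w n x))" for n
        using K(1) by (intro continuous_sq_integrable_compact continuous_on_compose2[OF hc wc(1)]) auto
    qed (use hlip2 in auto)
    have uK: "u \<in> borel_measurable ?M" using w(2) by (auto simp: L2_tendsto_def sq_integrable_def)
    have sqK: "sq_integrable ?M (\<lambda>x. h' (u x))"
      using uK h(2) by (intro sq_integrable_bounded[where B=B] finite_measure_lebesgue_on Kl) auto
    have l2: "L2_tendsto ?M (\<lambda>n x. h' (w n x)) (\<lambda>x. h' (u x))"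
    proof (rule L2_tendsto_le[OF w(2) _ sqK, where C="L\<^sup>2"])
      show "sq_integrable ?M (\<lambda>x. h' (w n x))" for n
        using K(1) by (intro continuous_sq_integrable_compact continuous_on_compose2[OF h'c wc(1)]) auto
    qed (use h'lip2 in auto)
    obtain B\<psi> where B\<psi>: "\<And>x. \<bar>\<psi> x\<bar> \<le> B\<psi>" using test_function_bounded[OF \<psi>] by blast
    have l3: "L2_tendsto ?M (\<lambda>n x. partial i (w n) x * \<psi> x) (\<lambda>x. v x * \<psi> x)"
    proof (rule L2_tendsto_le[OF w(3), where C="B\<psi>\<^sup>2"])
      show "AE x in ?M. (partial i (w n) x * \<psi> x - v x * \<psi> x)\<^sup>2 \<le> B\<psi>\<^sup>2 * (partial i (w n) x - v x)\<^sup>2" for n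
      proof (rule AE_I2)
        fix x
        have "(\<psi> x)\<^sup>2 \<le> B\<psi>\<^sup>2" using B\<psi>[of x] power_mono[of "\<bar>\<psi> x\<bar>" B\<psi> 2] by simp
        then have "(\<psi> x)\<^sup>2 * (partial i (w n) x - v x)\<^sup>2 \<le> B\<psi>\<^sup>2 * (partial i (w n) x - v x)\<^sup>2"
          by (rule mult_right_mono) simp
          moreover have "partial i (w n) x * \<psi> x - v x * \<psi> x = \<psi> x * (partial i (w n) x - v x)"
            by (simp add: algebra_simps)
          ultimately show "(partial i (w n) x * \<psi> x - v x * \<psi> x)\<^sup>2 \<le> B\<psi>\<^sup>2 * (partial i (w n) x - v x)\<^sup>2"
            by (simp only: power_mult_distrib)
      qed
    qed (use w(3) in \<open>auto simp: L2_tendsto_def intro!: sq_integrable_mult_test[OF \<psi>]\<close>)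
    have l4: "sq_integrable ?M (partial i \<psi>)" using d\<psi> Kl by (rule test_function_sq_integrable)
    have "(\<lambda>n. LINT x|?M. h (w n x) * partial i \<psi> x) \<longlonglongrightarrow> (LINT x|?M. h (u x) * partial i \<psi> x)"
      by (intro L2_tendsto_integral_mult l1 L2_tendsto_const l4)
    moreover have "(\<lambda>n. - (LINT x|?M. h' (w n x) * (partial i (w n) x * \<psi> x))) \<longlonglongrightarrow> - (LINT x|?M. h' (u x) * (v x * \<psi> x))"
      by (intro tendsto_minus L2_tendsto_integral_mult l2 l3)
    ultimately have "(LINT x|?M. h (u x) * partial i \<psi> x) = - (LINT x|?M. h' (u x) * (v x * \<psi> x))"
      unfolding eqn using LIMSEQ_unique by blast
    then show "(LINT x|lebesgue_on D. h (u x) * partial i \<psi> x) = - (LINT x|lebesgue_on D. h' (u x) * v x * \<psi> x)"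
      using K(3,4) by (simp add: DK mult.assoc)
  qed
qed

lemma weak_partial_smooth:
  fixes D :: "'a::euclidean_space set"
  assumes D: "open D" "bounded D" and i: "i \<in> Basis" and \<phi>: "\<And>k. Ck k \<phi>"
    "\<And>x. \<bar>\<phi> x\<bar> \<le> B" "\<And>x. \<bar>partial i \<phi> x\<bar> \<le> B"
  shows "weak_partial D i \<phi> (partial i \<phi>)"
  unfolding weak_partial_def
proof (intro conjI ballI)
  have Dl: "D \<in> lmeasurable" using D by (simp add: lmeasurable_open)
  then have Ds: "D \<in> sets lebesgue" by (rule fmeasurableD)
  have c: "continuous_on UNIV \<phi>" "continuous_on UNIV (partial i \<phi>)"
    using \<phi>(1)[of 0] \<phi>(1)[of "Suc 0"] i by auto
  show "sq_integrable (lebesgue_on D) \<phi>" "sq_integrable (lebesgue_on D) (partial i \<phi>)"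
    using c \<phi>(2,3) Dl
    by (auto intro!: sq_integrable_bounded[where B=B] finite_measure_lebesgue_on borel_measurable_lebesgue_onI
        borel_measurable_continuous_onI)
  fix \<psi> assume \<psi>: "\<psi> \<in> test_functions D"
  obtain K where K: "compact K" "K \<subseteq> D" "\<And>x. x \<notin> K \<Longrightarrow> \<psi> x = 0" "\<And>x. x \<notin> K \<Longrightarrow> partial i \<psi> x = 0"
    using test_functionsE[OF \<psi>] by metis
  have Ks: "K \<in> sets lebesgue" using lmeasurable_compact[OF K(1)] by (rule fmeasurableD)
  have DK: "(LINT x|lebesgue_on D. f x) = (LINT x|lebesgue_on K. f x)" if "\<And>x. x \<notin> K \<Longrightarrow> f x = 0" for f :: "'a \<Rightarrow> real"
    using that K(2) Ds Ks by (intro integral_lebesgue_on_support) auto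
  have "\<psi> \<in> test_functions UNIV" using \<psi> test_functions_mono[of D UNIV] by auto
  then have "(LINT x|lebesgue_on K. \<phi> x * partial i \<psi> x) = - (LINT x|lebesgue_on K. partial i \<phi> x * \<psi> x)"
    using \<phi>(1)[of "Suc 0"] c(2) i K by (intro integration_by_parts_compact) auto
  then show "(LINT x|lebesgue_on D. \<phi> x * partial i \<psi> x) = - (LINT x|lebesgue_on D. partial i \<phi> x * \<psi> x)"
    using K(3,4) by (simp add: DK)
qed

lemma weak_partial_diff:
  assumes "weak_partial D i u v" "weak_partial D i u' v'" "D \<in> lmeasurable" "i \<in> Basis"
  shows "weak_partial D i (\<lambda>x. u x - u' x) (\<lambda>x. v x - v' x)"
  unfolding weak_partial_def
proof (intro conjI ballI)
  show "sq_integrable (lebesgue_on D) (\<lambda>x. u x - u' x)" "sq_integrable (lebesgue_on D) (\<lambda>x. v x - v' x)"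
    using assms(1,2) by (auto simp: weak_partial_def intro: sq_integrable_diff)
  fix \<phi> assume \<phi>: "\<phi> \<in> test_functions D"
  have t: "sq_integrable (lebesgue_on D) \<phi>" "sq_integrable (lebesgue_on D) (partial i \<phi>)"
    using \<phi> assms(3,4) test_functions_partial test_function_sq_integrable by blast+
  show "(LINT x|lebesgue_on D. (u x - u' x) * partial i \<phi> x) = - (LINT x|lebesgue_on D. (v x - v' x) * \<phi> x)"
    using assms(1,2) \<phi> t sq_integrable_mult[of "lebesgue_on D" u "partial i \<phi>"] sq_integrable_mult[of "lebesgue_on D" u' "partial i \<phi>"]
      sq_integrable_mult[of "lebesgue_on D" v \<phi>] sq_integrable_mult[of "lebesgue_on D" v' \<phi>]
    by (simp add: weak_partial_def left_diff_distrib)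
qed

text \<open>The difference of the two candidates is a weak derivative of 0, hence orthogonal to all
  test functions.\<close>

lemma weak_partial_unique:
  assumes D: "open D" "bounded D" and "i \<in> Basis" "weak_partial D i u v" "weak_partial D i u v'"
  shows "AE x in lebesgue_on D. v x = v' x"
proof -
  have Dl: "D \<in> lmeasurable" using D by (simp add: lmeasurable_open)
  have w: "weak_partial D i (\<lambda>x. u x - u x) (\<lambda>x. v x - v' x)"
    using assms(4,5) Dl assms(3) by (rule weak_partial_diff)
  have "AE x in lebesgue_on D. v x - v' x = 0"
  proof (rule fundamental_lemma_calculus_of_variations[OF D])
    show "sq_integrable (lebesgue_on D) (\<lambda>x. v x - v' x)" using w by (simp add: weak_partial_def)
    show "(LINT x|lebesgue_on D. (v x - v' x) * \<phi> x) = 0" if "\<phi> \<in> test_functions D" for \<phi>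
      using weak_partialD(3)[OF w that] by simp
  qed
  then show ?thesis by simp
qed

subsection \<open>Sobolev spaces\<close>

lemma sum_inner_Basis_square: "(norm x)\<^sup>2 = (\<Sum>i\<in>Basis. (x \<bullet> i)\<^sup>2)"
  for x :: "'a::euclidean_space"
  unfolding power2_norm_eq_inner by (subst euclidean_inner) (simp add: power2_eq_square)

lemma L2_real_iff: "u \<in> L2 D \<longleftrightarrow> sq_integrable (lebesgue_on D) u"
  for u :: "'a::euclidean_space \<Rightarrow> real"
  by (simp add: L2_def sq_integrable_def)

lemma L2_vector_iff:
  "g \<in> L2 D \<longleftrightarrow> (\<forall>i\<in>Basis. sq_integrable (lebesgue_on D) (\<lambda>x. g x \<bullet> i))"
  for g :: "'a::euclidean_space \<Rightarrow> 'b::euclidean_space"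
proof
  assume g: "g \<in> L2 D"
  then have gm[measurable]: "g \<in> borel_measurable (lebesgue_on D)"
    and gi: "integrable (lebesgue_on D) (\<lambda>x. (norm (g x))\<^sup>2)" by (auto simp: L2_def)
  show "\<forall>i\<in>Basis. sq_integrable (lebesgue_on D) (\<lambda>x. g x \<bullet> i)"
  proof
    fix i :: 'b assume i: "i \<in> Basis"
    have "(g x \<bullet> i)\<^sup>2 \<le> (norm (g x))\<^sup>2" for x
      using Basis_le_norm[OF i, of "g x"] by (simp add: abs_le_square_iff[symmetric])
    then have "integrable (lebesgue_on D) (\<lambda>x. (g x \<bullet> i)\<^sup>2)"
      by (intro Bochner_Integration.integrable_bound[OF gi]) auto
    then show "sq_integrable (lebesgue_on D) (\<lambda>x. g x \<bullet> i)" by (simp add: sq_integrable_def)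
  qed
next
  assume *: "\<forall>i\<in>Basis. sq_integrable (lebesgue_on D) (\<lambda>x. g x \<bullet> i)"
  then have "g \<in> borel_measurable (lebesgue_on D)"
    by (subst borel_measurable_euclidean_space) (auto simp: sq_integrable_def)
  moreover have "integrable (lebesgue_on D) (\<lambda>x. (norm (g x))\<^sup>2)"
    unfolding sum_inner_Basis_square using * by (intro Bochner_Integration.integrable_sum) (auto simp: sq_integrable_def)
  ultimately show "g \<in> L2 D" by (simp add: L2_def)
qed

lemma has_weak_gradient_iff:
  "has_weak_gradient D u g \<longleftrightarrow> (\<forall>i\<in>Basis. weak_partial D i u (\<lambda>x. g x \<bullet> i))"
proof -
  \<comment> \<open>Square integrability of \<open>u\<close> is part of every
    \<open>weak_partial\<close>, so recovering it from a statement about all basis vectors takes at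
    least one of them.\<close>
  obtain i0 :: 'a where i0: "i0 \<in> Basis" using nonempty_Basis by blast
  show ?thesis
  proof
    assume "has_weak_gradient D u g"
    then show "\<forall>i\<in>Basis. weak_partial D i u (\<lambda>x. g x \<bullet> i)"
      unfolding has_weak_gradient_def weak_partial_def L2_real_iff L2_vector_iff by blast
  next
    assume "\<forall>i\<in>Basis. weak_partial D i u (\<lambda>x. g x \<bullet> i)"
    then show "has_weak_gradient D u g"
      using i0 unfolding has_weak_gradient_def weak_partial_def L2_real_iff L2_vector_iff by blast
  qed
qed

lemma L2_norm_square: "(L2_norm D u)\<^sup>2 = (LINT x|lebesgue_on D. (norm (u x))\<^sup>2)"
  by (simp add: L2_norm_def)

lemma has_weak_gradient_weak_grad: "u \<in> H1 D \<Longrightarrow> has_weak_gradient D u (weak_grad D u)"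
  unfolding H1_def weak_grad_def by (simp add: someI_ex)

lemma H1I: "has_weak_gradient D u g \<Longrightarrow> u \<in> H1 D"
  by (auto simp: H1_def)

lemma weak_gradient_unique:
  assumes D: "open D" "bounded D" and g: "has_weak_gradient D u g" "has_weak_gradient D u g'"
  shows "AE x in lebesgue_on D. g x = g' x"
proof -
  have "AE x in lebesgue_on D. \<forall>i\<in>Basis. g x \<bullet> i = g' x \<bullet> i"
    using g by (intro AE_finite_allI finite_Basis weak_partial_unique[OF D]) (auto simp: has_weak_gradient_iff)
  then show ?thesis by eventually_elim (auto intro: euclidean_eqI)
qed

lemma weak_grad_AE_eq:
  assumes "open D" "bounded D" "has_weak_gradient D u g"
  shows "AE x in lebesgue_on D. weak_grad D u x = g x"
  using weak_gradient_unique[OF assms(1,2) has_weak_gradient_weak_grad[OF H1I[OF assms(3)]] assms(3)] .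

lemma has_weak_gradient_diff:
  assumes "has_weak_gradient D u g" "has_weak_gradient D u' g'" "D \<in> lmeasurable"
  shows "has_weak_gradient D (\<lambda>x. u x - u' x) (\<lambda>x. g x - g' x)"
  using assms by (auto simp: has_weak_gradient_iff inner_diff_left intro: weak_partial_diff)

definition gradient :: "('a::euclidean_space \<Rightarrow> real) \<Rightarrow> 'a \<Rightarrow> 'a" where
  "gradient \<phi> x = (\<Sum>i\<in>Basis. partial i \<phi> x *\<^sub>R i)"

lemma gradient_inner: "i \<in> Basis \<Longrightarrow> gradient \<phi> x \<bullet> i = partial i \<phi> x"
  by (simp add: gradient_def)

lemma has_weak_gradient_test_function:
  assumes D: "open D" "bounded D" and \<phi>: "\<phi> \<in> test_functions UNIV"
  shows "has_weak_gradient D \<phi> (gradient \<phi>)"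
  unfolding has_weak_gradient_iff
proof
  fix i :: 'a assume i: "i \<in> Basis"
  obtain B1 where B1: "\<And>x. \<bar>\<phi> x\<bar> \<le> B1" using test_function_bounded[OF \<phi>] by blast
  obtain B2 where B2: "\<And>x. \<bar>partial i \<phi> x\<bar> \<le> B2"
    using test_function_bounded[OF test_functions_partial[OF \<phi> i]] by blast
  have "weak_partial D i \<phi> (partial i \<phi>)"
    by (rule weak_partial_smooth[OF D i, of _ "max B1 B2"])
       (use \<phi> B1 B2 in \<open>auto simp: test_functions_def le_max_iff_disj\<close>)
  then show "weak_partial D i \<phi> (\<lambda>x. gradient \<phi> x \<bullet> i)" using i by (simp add: gradient_inner)
qed

text \<open>The squared H1 distance with the gradients as explicit arguments, which keeps the
  arbitrary representative \<open>weak_grad\<close> out of the approximation arguments.\<close>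

definition H1_dist2 :: "'a::euclidean_space set \<Rightarrow> ('a \<Rightarrow> real) \<Rightarrow> ('a \<Rightarrow> 'a) \<Rightarrow> ('a \<Rightarrow> real) \<Rightarrow> ('a \<Rightarrow> 'a) \<Rightarrow> real" where
  "H1_dist2 D u g v h = (LINT x|lebesgue_on D. (v x - u x)\<^sup>2) + (\<Sum>i\<in>Basis. LINT x|lebesgue_on D. (h x \<bullet> i - g x \<bullet> i)\<^sup>2)"

lemma H1_dist2_nonneg: "H1_dist2 D u g v h \<ge> 0"
  unfolding H1_dist2_def by (intro add_nonneg_nonneg sum_nonneg) auto

lemma H1_norm_diff_square:
  assumes D: "open D" "bounded D" and u: "has_weak_gradient D u g" and v: "has_weak_gradient D v h"
  shows "(H1_norm D (\<lambda>x. v x - u x))\<^sup>2 = H1_dist2 D u g v h"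
proof -
  have Dl: "D \<in> lmeasurable" using D by (simp add: lmeasurable_open)
  have w: "has_weak_gradient D (\<lambda>x. v x - u x) (\<lambda>x. h x - g x)"
    using v u Dl by (rule has_weak_gradient_diff)
  let ?G = "weak_grad D (\<lambda>x. v x - u x)"
  have Gm: "?G \<in> borel_measurable (lebesgue_on D)" "(\<lambda>x. h x - g x) \<in> borel_measurable (lebesgue_on D)"
    using has_weak_gradient_weak_grad[OF H1I[OF w]] w by (auto simp: has_weak_gradient_def L2_def)
  have ae: "AE x in lebesgue_on D. (norm (?G x))\<^sup>2 = (norm (h x - g x))\<^sup>2"
    using weak_grad_AE_eq[OF D w] by eventually_elim simp
  have "(LINT x|lebesgue_on D. (norm (?G x))\<^sup>2) = (LINT x|lebesgue_on D. (norm (h x - g x))\<^sup>2)"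
    using Gm by (intro integral_cong_AE ae) auto
  also have "\<dots> = (LINT x|lebesgue_on D. (\<Sum>i\<in>Basis. (h x \<bullet> i - g x \<bullet> i)\<^sup>2))"
    by (simp add: sum_inner_Basis_square inner_diff_left)
  also have "\<dots> = (\<Sum>i\<in>Basis. LINT x|lebesgue_on D. (h x \<bullet> i - g x \<bullet> i)\<^sup>2)"
  proof (rule Bochner_Integration.integral_sum)
    fix i :: 'a assume "i \<in> Basis"
    then have "weak_partial D i (\<lambda>x. v x - u x) (\<lambda>x. (h x - g x) \<bullet> i)"
      using w by (simp add: has_weak_gradient_iff)
    then show "integrable (lebesgue_on D) (\<lambda>x. (h x \<bullet> i - g x \<bullet> i)\<^sup>2)"
      by (simp add: weak_partial_def sq_integrable_def inner_diff_left)
  qed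
  finally show ?thesis
    using H1_dist2_nonneg[of D u g v h] by (simp add: H1_norm_def H1_dist2_def L2_norm_square)
qed

text \<open>A criterion by epsilons for any known gradient \<open>g\<close>, replacing the sequence
  and the selected gradient in the definition of \<open>H10\<close>.\<close>

lemma H10_iff:
  assumes D: "open D" "bounded D" and u: "has_weak_gradient D u g"
  shows "u \<in> H10 D \<longleftrightarrow> (\<forall>e>0. \<exists>\<phi>\<in>test_functions D. H1_dist2 D u g \<phi> (gradient \<phi>) < e)"
proof -
  have n: "(H1_norm D (\<lambda>x. \<phi> x - u x))\<^sup>2 = H1_dist2 D u g \<phi> (gradient \<phi>)" if "\<phi> \<in> test_functions D" for \<phi>
    using H1_norm_diff_square[OF D u has_weak_gradient_test_function[OF D]] that test_functions_mono[of D UNIV] by auto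
  have n0: "H1_norm D w \<ge> 0" for w by (simp add: H1_norm_def)
  show ?thesis
  proof
    assume "u \<in> H10 D"
    then obtain \<phi> where \<phi>: "\<And>n. \<phi> n \<in> test_functions D" "(\<lambda>n. H1_norm D (\<lambda>x. \<phi> n x - u x)) \<longlonglongrightarrow> 0"
      unfolding H10_def by blast
    show "\<forall>e>0. \<exists>\<phi>\<in>test_functions D. H1_dist2 D u g \<phi> (gradient \<phi>) < e"
    proof (intro allI impI)
      fix e :: real assume "e > 0"
      then have "sqrt e > 0" by simp
      then have "\<forall>\<^sub>F n in sequentially. H1_norm D (\<lambda>x. \<phi> n x - u x) < sqrt e"
        using order_tendstoD(2)[OF \<phi>(2)] by blast
      then obtain n where "H1_norm D (\<lambda>x. \<phi> n x - u x) < sqrt e"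
        unfolding eventually_sequentially by blast
      then have "(H1_norm D (\<lambda>x. \<phi> n x - u x))\<^sup>2 < (sqrt e)\<^sup>2"
        using n0 by (intro power_strict_mono) auto
      then show "\<exists>\<phi>\<in>test_functions D. H1_dist2 D u g \<phi> (gradient \<phi>) < e"
        using n[OF \<phi>(1)] \<phi>(1) \<open>e > 0\<close> by (intro bexI[of _ "\<phi> n"]) auto
    qed
  next
    assume *: "\<forall>e>0. \<exists>\<phi>\<in>test_functions D. H1_dist2 D u g \<phi> (gradient \<phi>) < e"
    have "\<forall>n. \<exists>\<phi>. \<phi> \<in> test_functions D \<and> H1_dist2 D u g \<phi> (gradient \<phi>) < inverse (real (Suc n))"
      using * by (metis inverse_positive_iff_positive of_nat_0_less_iff zero_less_Suc)
    then obtain \<phi> where \<phi>: "\<And>n. \<phi> n \<in> test_functions D"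
      "\<And>n. H1_dist2 D u g (\<phi> n) (gradient (\<phi> n)) < inverse (real (Suc n))"
      by (subst (asm) choice_iff) blast
    have "H1_norm D (\<lambda>x. \<phi> n x - u x) \<le> sqrt (inverse (real (Suc n)))" for n
      using n[OF \<phi>(1)] \<phi>(2)[of n] by (intro real_le_rsqrt) simp
    moreover have "(\<lambda>n. sqrt (inverse (real (Suc n)))) \<longlonglongrightarrow> 0"
      using tendsto_real_sqrt[OF LIMSEQ_inverse_real_of_nat] by simp
    ultimately have "(\<lambda>n. H1_norm D (\<lambda>x. \<phi> n x - u x)) \<longlonglongrightarrow> 0"
      by (rule tendsto_0_le) (rule n0)
    then show "u \<in> H10 D" using u \<phi>(1) unfolding H10_def H1_def by blast
  qed
qed

lemma H1_dist2_triangle: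
  assumes "has_weak_gradient D u g" "has_weak_gradient D v h" "has_weak_gradient D w k"
  shows "H1_dist2 D u g w k \<le> 2 * H1_dist2 D u g v h + 2 * H1_dist2 D v h w k"
proof -
  have le: "(LINT x|M. (c x - a x)\<^sup>2) \<le> 2 * (LINT x|M. (b x - a x)\<^sup>2) + 2 * (LINT x|M. (c x - b x)\<^sup>2)"
    if "sq_integrable M a" "sq_integrable M b" "sq_integrable M c" for M :: "'a measure" and a b c
  proof -
    have i: "integrable M (\<lambda>x. (c x - a x)\<^sup>2)" "integrable M (\<lambda>x. (b x - a x)\<^sup>2)" "integrable M (\<lambda>x. (c x - b x)\<^sup>2)"
      using that by (simp_all add: sq_integrable_square sq_integrable_diff)
    have pt: "(c x - a x)\<^sup>2 \<le> 2 * (b x - a x)\<^sup>2 + 2 * (c x - b x)\<^sup>2" for x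
    proof -
      have "0 \<le> ((b x - a x) - (c x - b x))\<^sup>2" by simp
      then show ?thesis by (simp add: power2_eq_square algebra_simps)
    qed
    show ?thesis
      using integral_mono[OF i(1) Bochner_Integration.integrable_add[OF integrable_mult_right[OF i(2)] integrable_mult_right[OF i(3)]] pt] i
      by simp
  qed
  obtain i0 :: 'a where i0: "i0 \<in> Basis" using nonempty_Basis by blast
  have s0: "sq_integrable (lebesgue_on D) u" "sq_integrable (lebesgue_on D) v" "sq_integrable (lebesgue_on D) w"
    using assms by (auto simp: has_weak_gradient_def L2_real_iff)
  have si: "sq_integrable (lebesgue_on D) (\<lambda>x. g x \<bullet> i)" "sq_integrable (lebesgue_on D) (\<lambda>x. h x \<bullet> i)"
    "sq_integrable (lebesgue_on D) (\<lambda>x. k x \<bullet> i)" if "i \<in> Basis" for i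
    using assms that by (auto simp: has_weak_gradient_iff weak_partial_def)
  have "(\<Sum>i\<in>Basis. LINT x|lebesgue_on D. (k x \<bullet> i - g x \<bullet> i)\<^sup>2) \<le>
    (\<Sum>i\<in>Basis. 2 * (LINT x|lebesgue_on D. (h x \<bullet> i - g x \<bullet> i)\<^sup>2) + 2 * (LINT x|lebesgue_on D. (k x \<bullet> i - h x \<bullet> i)\<^sup>2))"
    using le[OF si] by (intro sum_mono)
  then show ?thesis
    using le[OF s0] by (simp add: H1_dist2_def sum.distrib sum_distrib_left[symmetric])
qed

section \<open>Membership in the closure of the test functions\<close>

lemma H10_closed:
  assumes D: "open D" "bounded D" and v: "has_weak_gradient D v h"
    and s: "\<And>n. has_weak_gradient D (s n) (G n)" "\<And>n. s n \<in> H10 D"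
    and l: "L2_tendsto (lebesgue_on D) s v" "\<And>i. i \<in> Basis \<Longrightarrow> L2_tendsto (lebesgue_on D) (\<lambda>n x. G n x \<bullet> i) (\<lambda>x. h x \<bullet> i)"
  shows "v \<in> H10 D"
  unfolding H10_iff[OF D v]
proof (intro allI impI)
  fix e :: real assume "e > 0"
  have "(\<lambda>n. H1_dist2 D v h (s n) (G n)) \<longlonglongrightarrow> 0 + (\<Sum>i\<in>(Basis::'a set). 0)"
    unfolding H1_dist2_def using L2_tendstoD(3)[OF l(1)] L2_tendstoD(3)[OF l(2)]
    by (intro tendsto_add tendsto_sum) blast+
  then have "(\<lambda>n. H1_dist2 D v h (s n) (G n)) \<longlonglongrightarrow> 0" by simp
  \<comment> \<open>For squared distances the triangle inequality carries a factor 2 on both terms,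
    hence \<open>e / 4\<close> for each.\<close>
  then have "\<forall>\<^sub>F n in sequentially. H1_dist2 D v h (s n) (G n) < e / 4"
    by (rule order_tendstoD(2)) (use \<open>e > 0\<close> in simp)
  then obtain n where n: "H1_dist2 D v h (s n) (G n) < e / 4"
    unfolding eventually_sequentially by blast
  obtain \<phi> where \<phi>: "\<phi> \<in> test_functions D" "H1_dist2 D (s n) (G n) \<phi> (gradient \<phi>) < e / 4"
    using s(2)[of n] \<open>e > 0\<close> unfolding H10_iff[OF D s(1)] by (meson zero_less_divide_iff zero_less_numeral)
  have "H1_dist2 D v h \<phi> (gradient \<phi>) \<le> 2 * H1_dist2 D v h (s n) (G n) + 2 * H1_dist2 D (s n) (G n) \<phi> (gradient \<phi>)"
    using \<phi>(1) test_functions_mono[of D UNIV]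
    by (intro H1_dist2_triangle[OF v s(1)] has_weak_gradient_test_function[OF D]) auto
  then show "\<exists>\<phi>\<in>test_functions D. H1_dist2 D v h \<phi> (gradient \<phi>) < e"
    using n \<phi> by (intro bexI[of _ \<phi>]) auto
qed

text \<open>For a function supported away from the boundary, mollification commutes with the weak
  derivative everywhere, not just on a compact subset: beyond the enlarged support both sides are 0.
  The mollification is itself the test function sought.\<close>

lemma compact_support_in_H10:
  fixes D :: "'a::euclidean_space set"
  assumes D: "open D" "bounded D" and v: "has_weak_gradient D v g"
    and K: "compact K" "K \<subseteq> D" "\<And>x. x \<notin> K \<Longrightarrow> v x = 0" "\<And>x. x \<notin> K \<Longrightarrow> g x = 0"
  shows "v \<in> H10 D"
  unfolding H10_iff[OF D v]
proof (intro allI impI)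
  fix e :: real assume e: "e > 0"
  have Dl: "D \<in> lmeasurable" using D by (simp add: lmeasurable_open)
  then have Ds: "D \<in> sets lebesgue" by (rule fmeasurableD)
  have sqv: "sq_integrable (lebesgue_on D) v" using v by (auto simp: has_weak_gradient_def L2_real_iff)
  have wp: "weak_partial D i v (\<lambda>x. g x \<bullet> i)" if "i \<in> Basis" for i
    using v that by (simp add: has_weak_gradient_iff)
  have sqg: "sq_integrable (lebesgue_on D) (\<lambda>x. g x \<bullet> i)" if "i \<in> Basis" for i
    using wp[OF that] by (simp add: weak_partial_def)
  let ?V = "extend0 D v" and ?G = "\<lambda>i. extend0 D (\<lambda>x. g x \<bullet> i)"
  obtain d where d: "d > 0" "\<And>x. x \<in> K \<Longrightarrow> cball x d \<subseteq> D"
    using compact_in_open_radius[OF K(1) D(1) K(2)] by blast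
  \<comment> \<open>One function term and \<open>DIM('a)\<close> gradient terms, each at most
    \<open>c\<close>, add up to \<open>e / 2\<close>.\<close>
  define c where "c = e / (2 * (real DIM('a) + 1))"
  have c: "c > 0" using e by (simp add: c_def)
  obtain d0 where d0: "d0 > 0" "\<And>r. 0 < r \<Longrightarrow> r < d0 \<Longrightarrow>
        integrable lebesgue (\<lambda>x. (conv ?V (bump r) x - ?V x)\<^sup>2) \<and> (LINT x|lebesgue. (conv ?V (bump r) x - ?V x)\<^sup>2) \<le> c"
    using conv_bump_L2[OF extend0_integrable[OF Dl sqv] c] by blast
  have "\<forall>i\<in>Basis. \<exists>d>0. \<forall>r. 0 < r \<longrightarrow> r < d \<longrightarrow>
        integrable lebesgue (\<lambda>x. (conv (?G i) (bump r) x - ?G i x)\<^sup>2) \<and> (LINT x|lebesgue. (conv (?G i) (bump r) x - ?G i x)\<^sup>2) \<le> c"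
    using conv_bump_L2[OF extend0_integrable[OF Dl sqg] c] by blast
  then obtain di where di: "\<And>i. i \<in> Basis \<Longrightarrow> di i > 0" "\<And>i r. i \<in> Basis \<Longrightarrow> 0 < r \<Longrightarrow> r < di i \<Longrightarrow>
        integrable lebesgue (\<lambda>x. (conv (?G i) (bump r) x - ?G i x)\<^sup>2) \<and> (LINT x|lebesgue. (conv (?G i) (bump r) x - ?G i x)\<^sup>2) \<le> c"
    by (subst (asm) bchoice_iff) blast
  \<comment> \<open>\<open>2 * r < d\<close> because the support grows by \<open>r\<close>, and
    balls of radius \<open>r\<close> around points of the enlarged support must still lie in
    \<open>D\<close>.\<close>
  define r where "r = min (d / 2) (min d0 (Min (di ` Basis))) / 2"
  have "Min (di ` Basis) > 0" using di(1) by (subst Min_gr_iff) auto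
  then have r: "0 < r" "2 * r < d" "r < d0" "r < Min (di ` Basis)" 
    unfolding r_def using d(1) d0(1) by linarith+
  have ri: "r < di i" if "i \<in> Basis" for i
    using r(4) Min_le[of "di ` Basis" "di i"] that by auto
  define \<phi> where "\<phi> = conv ?V (bump r)"
  let ?S = "{x + y |x y. x \<in> K \<and> y \<in> cball 0 r}"
  have S: "compact ?S" using K(1) by (intro compact_sums) auto
  have outS: "y \<notin> K" if "x \<notin> ?S" "norm (x - y) \<le> r" for x y
  proof
    assume "y \<in> K"
    then have "x \<in> ?S" using that(2) by - (rule CollectI, rule exI[of _ y], rule exI[of _ "x - y"], simp)
    with that(1) show False by contradiction
  qed
  have inD: "cball x r \<subseteq> D" if "x \<in> ?S" for x
  proof -
    from that obtain k y where ky: "x = k + y" "k \<in> K" "norm y \<le> r" by auto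
    show ?thesis
    proof
      fix z assume "z \<in> cball x r"
      then have "norm (x - z) \<le> r" by (simp add: dist_norm)
      moreover have "norm (k - z) \<le> norm (x - z) + norm y"
        using norm_triangle_ineq4[of "x - z" y] by (simp add: ky(1) algebra_simps)
      ultimately have "z \<in> cball k d" using r(2) ky(3) by (simp add: dist_norm)
      then show "z \<in> D" using d(2)[OF ky(2)] by blast
    qed
  qed
  have c0: "conv (extend0 D f) \<psi> x = 0" if "x \<notin> ?S" "\<And>y. y \<notin> K \<Longrightarrow> f y = 0" "\<And>z. norm z > r \<Longrightarrow> \<psi> z = 0" for x f \<psi>
  proof (rule conv_eq_0)
    fix y assume "extend0 D f y \<noteq> 0"
    then have "y \<in> K" using that(2)[of y] by (auto simp: extend0_def)
    then have "\<not> norm (x - y) \<le> r" using outS[OF that(1)] by blast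
    then show "\<psi> (x - y) = 0" using that(3) by simp
  qed
  have bp0: "partial i (bump r) z = 0" if "norm z > r" for i and z :: 'a
  proof -
    have "(bump r has_derivative (\<lambda>_. 0)) (at z)"
    proof (rule has_derivative_transform_within_open[OF has_derivative_const[of 0]])
      show "open (- cball (0::'a) r)" by (rule open_Compl) simp
      show "z \<in> - cball 0 r" using that by simp
      show "0 = bump r x" if "x \<in> - cball (0::'a) r" for x
        using that bump_eq_0[OF r(1), of x] by simp
    qed
    then show ?thesis by (simp add: partialI)
  qed
  have C: "Ck k \<phi>" for k
    unfolding \<phi>_def using bump_test[OF r(1)] extend0_integrable(1)[OF Dl sqv] by (rule Ck_conv)
  have S0: "\<phi> x = 0" if "x \<notin> ?S" for x
    unfolding \<phi>_def using that K(3) bump_eq_0[OF r(1), where 'a='a] by (intro c0) auto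
  have "?S \<subseteq> D" using inD r(1) by (meson centre_in_cball less_imp_le subsetD subsetI)
  then have \<phi>: "\<phi> \<in> test_functions D" using C S S0 by (intro test_functionsI)
  have p: "partial i \<phi> x = conv (?G i) (bump r) x" if i: "i \<in> Basis" for i x
  proof -
    have "partial i \<phi> x = conv ?V (partial i (bump r)) x"
      unfolding \<phi>_def using partial_conv[OF bump_test[OF r(1)] extend0_integrable(1)[OF Dl sqv] i] by simp
    also have "\<dots> = conv (?G i) (bump r) x"
    proof (cases "x \<in> ?S")
      case True
      show ?thesis by (rule conv_weak_partial[OF Ds wp[OF i] r(1) inD[OF True]])
    next
      case False
      have "conv ?V (partial i (bump r)) x = 0" using False K(3) bp0 by (intro c0) auto
      moreover have "conv (?G i) (bump r) x = 0" using False K(4) bump_eq_0[OF r(1), where 'a='a] by (intro c0) auto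
      ultimately show ?thesis by simp
    qed
    finally show ?thesis .
  qed
  have "(LINT x|lebesgue_on D. (\<phi> x - v x)\<^sup>2) \<le> c"
    by (rule integral_square_lebesgue_on_le[of _ "\<lambda>x. conv ?V (bump r) x - ?V x"])
       (use d0(2)[OF r(1,3)] Ds in \<open>auto simp: extend0_def \<phi>_def\<close>)
  moreover have "(LINT x|lebesgue_on D. (gradient \<phi> x \<bullet> i - g x \<bullet> i)\<^sup>2) \<le> c" if i: "i \<in> Basis" for i
    by (rule integral_square_lebesgue_on_le[of _ "\<lambda>x. conv (?G i) (bump r) x - ?G i x"])
       (use di(2)[OF i r(1) ri[OF i]] Ds in \<open>auto simp: extend0_def gradient_inner[OF i] p[OF i]\<close>)
  ultimately have "H1_dist2 D v g \<phi> (gradient \<phi>) \<le> c + (\<Sum>i\<in>(Basis::'a set). c)"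
    unfolding H1_dist2_def by (intro add_mono sum_mono)
  also have "\<dots> = (real DIM('a) + 1) * c" by (simp add: algebra_simps)
  also have "\<dots> = e / 2"
  proof -
    have "N * (e / (2 * N)) = e / 2" if "N > 0" for N using that by simp
    from this[of "real DIM('a) + 1"] show ?thesis unfolding c_def by simp
  qed
  also have "\<dots> < e" using e by simp
  finally show "\<exists>\<phi>\<in>test_functions D. H1_dist2 D v g \<phi> (gradient \<phi>) < e" using \<phi> by blast
qed

lemma L2_tendsto_subseq:
  assumes "L2_tendsto M s f" "strict_mono r"
  shows "L2_tendsto M (\<lambda>n. s (r n)) f"
  using assms(1) LIMSEQ_subseq_LIMSEQ[OF L2_tendstoD(3)[OF assms(1)] assms(2)]
  unfolding L2_tendsto_def o_def by blast

text \<open>Besides convergence in H1, pointwise convergence along a subsequence is arranged: it is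
  what makes coefficients such as \<open>h' (\<phi> n x)\<close> converge.\<close>

lemma H10_L2_tendsto:
  assumes D: "open D" "bounded D" and u: "has_weak_gradient D u g" "u \<in> H10 D"
  obtains \<phi> where "\<And>n. \<phi> n \<in> test_functions D" "L2_tendsto (lebesgue_on D) \<phi> u"
    "\<And>i. i \<in> Basis \<Longrightarrow> L2_tendsto (lebesgue_on D) (\<lambda>n. partial i (\<phi> n)) (\<lambda>x. g x \<bullet> i)"
    "AE x in lebesgue_on D. (\<lambda>n. \<phi> n x) \<longlonglongrightarrow> u x"
proof -
  have Dl: "D \<in> lmeasurable" using D by (simp add: lmeasurable_open)
  have squ: "sq_integrable (lebesgue_on D) u" using u by (simp add: has_weak_gradient_def L2_real_iff)
  have sqg: "sq_integrable (lebesgue_on D) (\<lambda>x. g x \<bullet> i)" if "i \<in> Basis" for i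
    using u that by (auto simp: has_weak_gradient_iff weak_partial_def)
  have "\<exists>\<phi>. \<phi> \<in> test_functions D \<and> H1_dist2 D u g \<phi> (gradient \<phi>) < inverse (real (Suc n))" for n
  proof -
    have "inverse (real (Suc n)) > 0" by simp
    then show ?thesis using u(2) unfolding H10_iff[OF D u(1)] by blast
  qed
  then obtain \<phi> where \<phi>: "\<And>n. \<phi> n \<in> test_functions D"
    "\<And>n. H1_dist2 D u g (\<phi> n) (gradient (\<phi> n)) < inverse (real (Suc n))"
    by metis
  have lim: "(\<lambda>n. inverse (real (Suc n))) \<longlonglongrightarrow> 0" by (rule LIMSEQ_inverse_real_of_nat)
  have sp: "0 \<le> (\<Sum>i\<in>(Basis::'a set). LINT x|lebesgue_on D. (gradient (\<phi> n) x \<bullet> i - g x \<bullet> i)\<^sup>2)" for n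
    by (intro sum_nonneg) simp
  have "(LINT x|lebesgue_on D. (\<phi> n x - u x)\<^sup>2) \<le> inverse (real (Suc n))" for n
    using \<phi>(2)[of n] sp[of n] unfolding H1_dist2_def by linarith
  then have "(\<lambda>n. LINT x|lebesgue_on D. (\<phi> n x - u x)\<^sup>2) \<longlonglongrightarrow> 0"
    by (rule tendsto_0_le[OF _ lim]) simp
  then have l1: "L2_tendsto (lebesgue_on D) \<phi> u"
    using squ test_function_sq_integrable[OF \<phi>(1) Dl] unfolding L2_tendsto_def by blast
  have l2: "L2_tendsto (lebesgue_on D) (\<lambda>n. partial i (\<phi> n)) (\<lambda>x. g x \<bullet> i)" if i: "i \<in> Basis" for i
  proof -
    have "(LINT x|lebesgue_on D. (partial i (\<phi> n) x - g x \<bullet> i)\<^sup>2) \<le> inverse (real (Suc n))" for n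
    proof -
      have "(LINT x|lebesgue_on D. (partial i (\<phi> n) x - g x \<bullet> i)\<^sup>2)
        = (LINT x|lebesgue_on D. (gradient (\<phi> n) x \<bullet> i - g x \<bullet> i)\<^sup>2)" using i by (simp add: gradient_inner)
      also have "\<dots> \<le> (\<Sum>i\<in>Basis. LINT x|lebesgue_on D. (gradient (\<phi> n) x \<bullet> i - g x \<bullet> i)\<^sup>2)"
        using i by (intro member_le_sum) auto
      also have "\<dots> \<le> H1_dist2 D u g (\<phi> n) (gradient (\<phi> n))" unfolding H1_dist2_def by simp
      finally show ?thesis using \<phi>(2)[of n] by linarith
    qed
    then have "(\<lambda>n. LINT x|lebesgue_on D. (partial i (\<phi> n) x - g x \<bullet> i)\<^sup>2) \<longlonglongrightarrow> 0"
      by (rule tendsto_0_le[OF _ lim]) simp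
    then show ?thesis
      using sqg[OF i] test_function_sq_integrable[OF test_functions_partial[OF \<phi>(1) i] Dl] unfolding L2_tendsto_def by blast
  qed
  obtain r where r: "strict_mono r" "AE x in lebesgue_on D. (\<lambda>n. \<phi> (r n) x) \<longlonglongrightarrow> u x"
    using L2_tendsto_AE_subseq[OF finite_measure_lebesgue_on[OF Dl] l1] by blast
  show ?thesis
    by (rule that[of "\<lambda>n. \<phi> (r n)"])
       (use \<phi>(1) r L2_tendsto_subseq[OF l1 r(1)] L2_tendsto_subseq[OF l2 r(1)] in blast)+
qed

text \<open>The common form of the test functions built from \<open>u\<close>. The bound on
  \<open>\<delta>\<close> controls the term with \<open>g\<close>, the bound on \<open>h\<close> the
  term with \<open>d\<close>, so that both stay in L2.\<close>

lemma has_weak_gradient_mult_comp: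
  fixes D :: "'a::euclidean_space set"
  assumes D: "open D" "bounded D" and u: "has_weak_gradient D u g"
    and \<delta>: "has_weak_gradient D \<delta> d" "AE x in lebesgue_on D. \<bar>\<delta> x\<bar> \<le> B"
    and h: "\<And>s. (h has_real_derivative h' s) (at s)" "\<And>s. \<bar>h' s\<bar> \<le> B'" "\<And>s t. \<bar>h' s - h' t\<bar> \<le> L * \<bar>s - t\<bar>"
      "\<And>s. \<bar>h s\<bar> \<le> H"
  shows "has_weak_gradient D (\<lambda>x. \<delta> x * h (u x)) (\<lambda>x. (\<delta> x * h' (u x)) *\<^sub>R g x + h (u x) *\<^sub>R d x)"
  unfolding has_weak_gradient_iff
proof
  fix i :: 'a assume i: "i \<in> Basis"
  have w: "weak_partial D i u (\<lambda>x. g x \<bullet> i)" "weak_partial D i \<delta> (\<lambda>x. d x \<bullet> i)"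
    using u \<delta> i by (auto simp: has_weak_gradient_iff)
  have c: "weak_partial D i (\<lambda>x. h (u x)) (\<lambda>x. h' (u x) * (g x \<bullet> i))"
    using D i w(1) h(1-3) by (rule weak_partial_chain)
  note s1 = weak_partialD(1,2)[OF w(2)] weak_partialD(1,2)[OF c]
  have m: "\<delta> \<in> borel_measurable (lebesgue_on D)" "(\<lambda>x. h (u x)) \<in> borel_measurable (lebesgue_on D)"
    using s1 by (auto simp: sq_integrable_def)
  have "weak_partial D i (\<lambda>x. \<delta> x * h (u x)) (\<lambda>x. \<delta> x * (h' (u x) * (g x \<bullet> i)) + (d x \<bullet> i) * h (u x))"
  proof (rule weak_partial_mult[OF D i w(2) c])
    show "sq_integrable (lebesgue_on D) (\<lambda>x. \<delta> x * h (u x))"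
      using s1(3) m(1) \<delta>(2) by (rule sq_integrable_bounded_mult)
    have "sq_integrable (lebesgue_on D) (\<lambda>x. h (u x) * (d x \<bullet> i))"
      using h(4) by (intro sq_integrable_bounded_mult[OF s1(2) m(2), of H] AE_I2)
    then show "sq_integrable (lebesgue_on D) (\<lambda>x. \<delta> x * (h' (u x) * (g x \<bullet> i)) + (d x \<bullet> i) * h (u x))"
      using sq_integrable_bounded_mult[OF s1(4) m(1) \<delta>(2)] by (intro sq_integrable_add) (simp_all add: mult.commute)
  qed
  then show "weak_partial D i (\<lambda>x. \<delta> x * h (u x)) (\<lambda>x. ((\<delta> x * h' (u x)) *\<^sub>R g x + h (u x) *\<^sub>R d x) \<bullet> i)"
    by (simp add: inner_add_left mult_ac)
qed

text \<open>The boundary condition comes entirely from \<open>u\<close>: if \<open>u\<close> is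
  replaced by test functions \<open>\<phi> n\<close>, the product has compact support because
  \<open>h 0 = 0\<close>, even when \<open>\<delta>\<close> does not vanish at the boundary. Then
  the limit is taken in H1.\<close>

lemma H10_mult_comp:
  fixes D :: "'a::euclidean_space set"
  assumes D: "open D" "bounded D" and u: "has_weak_gradient D u g" "u \<in> H10 D"
    and \<delta>: "has_weak_gradient D \<delta> d" "AE x in lebesgue_on D. \<bar>\<delta> x\<bar> \<le> B"
    and h: "\<And>s. (h has_real_derivative h' s) (at s)" "\<And>s. \<bar>h' s\<bar> \<le> B'" "\<And>s t. \<bar>h' s - h' t\<bar> \<le> L * \<bar>s - t\<bar>"
      "\<And>s. \<bar>h s\<bar> \<le> H" "h 0 = 0"
  shows "(\<lambda>x. \<delta> x * h (u x)) \<in> H10 D"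
proof -
  let ?M = "lebesgue_on D"
  have Dl: "D \<in> lmeasurable" using D by (simp add: lmeasurable_open)
  obtain \<phi> where \<phi>: "\<And>n. \<phi> n \<in> test_functions D" "L2_tendsto ?M \<phi> u"
    "\<And>i. i \<in> Basis \<Longrightarrow> L2_tendsto ?M (\<lambda>n. partial i (\<phi> n)) (\<lambda>x. g x \<bullet> i)"
    "AE x in ?M. (\<lambda>n. \<phi> n x) \<longlonglongrightarrow> u x"
    using H10_L2_tendsto[OF D u] by blast
  have \<phi>U: "\<phi> n \<in> test_functions UNIV" for n using \<phi>(1) test_functions_mono[of D UNIV] by auto
  note wg = has_weak_gradient_mult_comp[OF D _ \<delta> h(1-4)]
  let ?v = "\<lambda>n x. \<delta> x * h (\<phi> n x)"
  let ?G = "\<lambda>n x. (\<delta> x * h' (\<phi> n x)) *\<^sub>R gradient (\<phi> n) x + h (\<phi> n x) *\<^sub>R d x"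
  have wn: "has_weak_gradient D (?v n) (?G n)" for n
    by (rule wg[OF has_weak_gradient_test_function[OF D \<phi>U]])
  have w: "has_weak_gradient D (\<lambda>x. \<delta> x * h (u x)) (\<lambda>x. (\<delta> x * h' (u x)) *\<^sub>R g x + h (u x) *\<^sub>R d x)"
    by (rule wg[OF u(1)])
  have hc: "continuous_on UNIV h"
    using h(1) by (intro continuous_at_imp_continuous_on ballI DERIV_isCont) auto
  have h'c: "continuous_on UNIV h'" using h(3) by (rule continuous_on_abs_lipschitz)
  have [measurable]: "h \<in> borel_measurable borel" "h' \<in> borel_measurable borel"
    using hc h'c by (auto intro: borel_measurable_continuous_onI)
  have sq\<delta>: "sq_integrable ?M \<delta>" using \<delta>(1) by (simp add: has_weak_gradient_def L2_real_iff)
  have [measurable]: "\<delta> \<in> borel_measurable ?M" "u \<in> borel_measurable ?M" "\<phi> n \<in> borel_measurable ?M" for n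
    using sq\<delta> L2_tendstoD(1,2)[OF \<phi>(2)] by (auto simp: sq_integrable_def)
  have sqd: "sq_integrable ?M (\<lambda>x. d x \<bullet> i)" if "i \<in> Basis" for i
    using \<delta>(1) that by (auto simp: has_weak_gradient_iff weak_partial_def)
  have hlip2: "(h s - h t)\<^sup>2 \<le> B'\<^sup>2 * (s - t)\<^sup>2" for s t
  proof -
    have "\<bar>h s - h t\<bar> \<le> B' * \<bar>s - t\<bar>"
      using field_differentiable_bound[of UNIV h h' B' s t] h(1,2) by auto
    then show ?thesis using power_mono[of "\<bar>h s - h t\<bar>" _ 2] by (fastforce simp: power_mult_distrib)
  qed
  have B'0: "B' \<ge> 0" using h(2)[of 0] by linarith
  have \<delta>2: "AE x in ?M. (\<delta> x)\<^sup>2 \<le> B\<^sup>2" using \<delta>(2)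
  proof eventually_elim
    case (elim x)
    then show ?case using power_mono[OF elim, of 2] by simp
  qed
  have c1B: "AE x in ?M. \<bar>\<delta> x * h' (\<phi> n x)\<bar> \<le> B * B'" for n
    using \<delta>(2)
  proof eventually_elim
    case (elim x)
    then show ?case using h(2)[of "\<phi> n x"] B'0 by (auto simp: abs_mult intro!: mult_mono)
  qed
  have c1B2: "AE x in ?M. (\<delta> x * h' (\<phi> n x))\<^sup>2 \<le> (B * B')\<^sup>2" for n
    using c1B[of n]
  proof eventually_elim
    case (elim x)
    then show ?case using power_mono[OF elim, of 2] by simp
  qed
  show ?thesis
  proof (rule H10_closed[OF D w wn])
    fix n
    obtain K where K: "compact K" "K \<subseteq> D" "\<And>x. x \<notin> K \<Longrightarrow> \<phi> n x = 0" "\<And>x i. x \<notin> K \<Longrightarrow> partial i (\<phi> n) x = 0"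
      using test_functionsE[OF \<phi>(1)] by metis
    show "?v n \<in> H10 D"
      by (rule compact_support_in_H10[OF D wn K(1,2)]) (auto simp: K(3,4) h(5) gradient_def)
  next
    have sqv: "sq_integrable ?M (?v n)" for n using wn[of n] by (simp add: has_weak_gradient_def L2_real_iff)
    have sqv0: "sq_integrable ?M (\<lambda>x. \<delta> x * h (u x))" using w by (simp add: has_weak_gradient_def L2_real_iff)
    show "L2_tendsto ?M ?v (\<lambda>x. \<delta> x * h (u x))"
    proof (rule L2_tendsto_le[OF \<phi>(2) sqv sqv0, where C="B\<^sup>2 * B'\<^sup>2"])
      fix n
      show "AE x in ?M. (\<delta> x * h (\<phi> n x) - \<delta> x * h (u x))\<^sup>2 \<le> B\<^sup>2 * B'\<^sup>2 * (\<phi> n x - u x)\<^sup>2"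
        using \<delta>2
      proof eventually_elim
        case (elim x)
        have "(\<delta> x)\<^sup>2 * (h (\<phi> n x) - h (u x))\<^sup>2 \<le> B\<^sup>2 * (B'\<^sup>2 * (\<phi> n x - u x)\<^sup>2)"
          using elim hlip2 by (intro mult_mono) auto
        then show ?case by (simp add: right_diff_distrib[symmetric] power_mult_distrib mult.assoc)
      qed
    qed
  next
    fix i :: 'a assume i: "i \<in> Basis"
    have sqg: "sq_integrable ?M (\<lambda>x. g x \<bullet> i)" using L2_tendstoD(2)[OF \<phi>(3)[OF i]] .
    have sqp: "sq_integrable ?M (partial i (\<phi> n))" for n using L2_tendstoD(1)[OF \<phi>(3)[OF i]] .
    \<comment> \<open>The gradient is split into three parts. The error of the gradients of
      \<open>\<phi> n\<close> times a bounded coefficient tends to 0 in L2; in the other two a fixed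
      L2 function has a bounded, pointwise convergent coefficient.\<close>
    have A: "L2_tendsto ?M (\<lambda>n x. (\<delta> x * h' (\<phi> n x)) * (partial i (\<phi> n) x - g x \<bullet> i)) (\<lambda>x. 0)"
    proof (rule L2_tendsto_le[OF \<phi>(3)[OF i], where C="(B * B')\<^sup>2"])
      show "sq_integrable ?M (\<lambda>x. (\<delta> x * h' (\<phi> n x)) * (partial i (\<phi> n) x - g x \<bullet> i))" for n
        using sq_integrable_diff[OF sqp sqg] _ c1B by (rule sq_integrable_bounded_mult) measurable
      show "sq_integrable ?M (\<lambda>x. 0)" by (simp add: sq_integrable_def)
      show "AE x in ?M. ((\<delta> x * h' (\<phi> n x)) * (partial i (\<phi> n) x - g x \<bullet> i) - 0)\<^sup>2
          \<le> (B * B')\<^sup>2 * (partial i (\<phi> n) x - g x \<bullet> i)\<^sup>2" for n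
        using c1B2[of n]
      proof eventually_elim
        case (elim x)
        then have "(\<delta> x * h' (\<phi> n x))\<^sup>2 * (partial i (\<phi> n) x - g x \<bullet> i)\<^sup>2 \<le> (B * B')\<^sup>2 * (partial i (\<phi> n) x - g x \<bullet> i)\<^sup>2"
          by (rule mult_right_mono) simp
        then show ?case by (simp only: power_mult_distrib diff_0_right)
      qed
    qed
    have Bm: "L2_tendsto ?M (\<lambda>n x. (\<delta> x * h' (\<phi> n x)) * (g x \<bullet> i)) (\<lambda>x. (\<delta> x * h' (u x)) * (g x \<bullet> i))"
    proof (rule L2_tendsto_dominated[OF sqg _ _ c1B])
      show "AE x in ?M. (\<lambda>n. \<delta> x * h' (\<phi> n x)) \<longlonglongrightarrow> \<delta> x * h' (u x)"
        using \<phi>(4)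
      proof eventually_elim
        case (elim x)
        then show ?case
          by (intro tendsto_mult tendsto_const continuous_on_tendsto_compose[OF h'c]) auto
      qed
    qed measurable
    have Cm: "L2_tendsto ?M (\<lambda>n x. h (\<phi> n x) * (d x \<bullet> i)) (\<lambda>x. h (u x) * (d x \<bullet> i))"
    proof (rule L2_tendsto_dominated[OF sqd[OF i], of _ _ H])
      show "AE x in ?M. \<bar>h (\<phi> n x)\<bar> \<le> H" for n using h(4) by simp
      show "AE x in ?M. (\<lambda>n. h (\<phi> n x)) \<longlonglongrightarrow> h (u x)"
        using \<phi>(4)
      proof eventually_elim
        case (elim x)
        then show ?case by (intro continuous_on_tendsto_compose[OF hc]) auto
      qed
    qed measurable
    have eq1: "?G n x \<bullet> i = (\<delta> x * h' (\<phi> n x)) * (partial i (\<phi> n) x - g x \<bullet> i) + (\<delta> x * h' (\<phi> n x)) * (g x \<bullet> i) + h (\<phi> n x) * (d x \<bullet> i)" for n x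
      using i by (simp add: inner_add_left gradient_inner algebra_simps)
    have eq2: "((\<delta> x * h' (u x)) *\<^sub>R g x + h (u x) *\<^sub>R d x) \<bullet> i = 0 + (\<delta> x * h' (u x)) * (g x \<bullet> i) + h (u x) * (d x \<bullet> i)" for x
      by (simp add: inner_add_left)
    show "L2_tendsto ?M (\<lambda>n x. ?G n x \<bullet> i) (\<lambda>x. ((\<delta> x * h' (u x)) *\<^sub>R g x + h (u x) *\<^sub>R d x) \<bullet> i)"
      unfolding eq1 eq2 by (rule L2_tendsto_add[OF L2_tendsto_add[OF A Bm] Cm])
  qed
qed

text \<open>Frees the weak formulation from the selected \<open>weak_grad\<close>: any weak
  gradients of the solution and of the test function may be used.\<close>

lemma weak_solution_test:
  assumes D: "open D" "bounded D" and sol: "weak_solution D a F u" and a: "a \<in> borel_measurable (lebesgue_on D)"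
    and u: "has_weak_gradient D u g" and v: "has_weak_gradient D v k" "v \<in> H10 D"
  shows "(LINT x|lebesgue_on D. a x * (g x \<bullet> k x)) = F v"
proof -
  note a[measurable]
  have m[measurable]: "g \<in> borel_measurable (lebesgue_on D)" "k \<in> borel_measurable (lebesgue_on D)"
    "weak_grad D u \<in> borel_measurable (lebesgue_on D)" "weak_grad D v \<in> borel_measurable (lebesgue_on D)"
    using u v(1) has_weak_gradient_weak_grad[OF H1I[OF u]] has_weak_gradient_weak_grad[OF H1I[OF v(1)]]
    by (auto simp: has_weak_gradient_def L2_def)
  have "(LINT x|lebesgue_on D. a x * (g x \<bullet> k x)) = (LINT x|lebesgue_on D. a x * (weak_grad D u x \<bullet> weak_grad D v x))"
  proof (rule integral_cong_AE)
    show "AE x in lebesgue_on D. a x * (g x \<bullet> k x) = a x * (weak_grad D u x \<bullet> weak_grad D v x)"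
      using weak_grad_AE_eq[OF D u] weak_grad_AE_eq[OF D v(1)] by eventually_elim simp
  qed measurable
  then show ?thesis using sol v(2) by (simp add: weak_solution_def)
qed

lemma has_weak_gradient_const:
  assumes D: "open D" "bounded D"
  shows "has_weak_gradient D (\<lambda>x. c) (\<lambda>x. 0)"
  unfolding has_weak_gradient_iff
proof
  fix i :: 'a assume i: "i \<in> Basis"
  have p: "partial i (\<lambda>x. c) = (\<lambda>x. 0)" by (rule ext) (simp add: partial_def)
  show "weak_partial D i (\<lambda>x. c) (\<lambda>x. 0 \<bullet> i)"
    using weak_partial_smooth[OF D i Ck_const[of _ c], of "\<bar>c\<bar>"] by (simp add: p)
qed

section \<open>The truncation functions\<close>

text \<open>The function q of the overview. It is a bounded substitute for truncation at level
  \<open>e\<close> whose derivative is globally Lipschitz, as the chain rule demands; the absolute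
  value removes the pole. With \<open>e = lam\<close> it also produces 1/a, and with
  \<open>e = 1\<close> its negative values give \<open>softneg\<close>.\<close>

definition softsign :: "real \<Rightarrow> real \<Rightarrow> real" where
  "softsign e s = s / (e + \<bar>s\<bar>)"

definition softsign' :: "real \<Rightarrow> real \<Rightarrow> real" where
  "softsign' e s = e / (e + \<bar>s\<bar>)\<^sup>2"

lemma softsign_has_derivative:
  assumes "e > 0" shows "(softsign e has_real_derivative softsign' e s) (at s)"
proof -
  consider "s < 0" | "s = 0" | "s > 0" by linarith
  then show ?thesis
  proof cases
    case 1
    have "((\<lambda>s. s / (e - s)) has_real_derivative softsign' e s) (at s)"
      using 1 assms by (auto intro!: derivative_eq_intros simp: softsign'_def power2_eq_square field_simps)
    then show ?thesis
      by (rule has_field_derivative_transform_within_open[of _ _ _ "{..<0}"])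
         (use 1 in \<open>auto simp: softsign_def\<close>)
  next
    case 2
    have "((\<lambda>h. 1 / (e + \<bar>h\<bar>)) \<longlongrightarrow> 1 / (e + \<bar>0\<bar>)) (at 0)"
      using assms by (intro tendsto_intros) auto
    moreover have "\<forall>\<^sub>F h in at 0. 1 / (e + \<bar>h\<bar>) = softsign e h / h"
      by (simp add: softsign_def eventually_at_filter)
    ultimately have "((\<lambda>h. softsign e h / h) \<longlongrightarrow> 1 / (e + \<bar>0\<bar>)) (at 0)"
      by (rule Lim_transform_eventually)
    then have "((\<lambda>h. softsign e h / h) \<longlongrightarrow> 1 / e) (at 0)" by simp
    then show ?thesis using 2 assms by (simp add: DERIV_def softsign'_def power2_eq_square) (simp add: softsign_def)
  next
    case 3
    have "((\<lambda>s. s / (e + s)) has_real_derivative softsign' e s) (at s)"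
      using 3 assms by (auto intro!: derivative_eq_intros simp: softsign'_def power2_eq_square field_simps)
    then show ?thesis
      by (rule has_field_derivative_transform_within_open[of _ _ _ "{0<..}"])
         (use 3 in \<open>auto simp: softsign_def\<close>)
  qed
qed

lemma softsign'_pos: "e > 0 \<Longrightarrow> softsign' e s > 0"
  by (simp add: softsign'_def add_pos_nonneg)

lemma softsign'_le: "e > 0 \<Longrightarrow> softsign' e s \<le> 1 / e"
proof -
  assume e: "e > 0"
  then have "e\<^sup>2 \<le> (e + \<bar>s\<bar>)\<^sup>2" by (intro power_mono) auto
  then have "e / (e + \<bar>s\<bar>)\<^sup>2 \<le> e / e\<^sup>2" using e by (intro divide_left_mono) (auto simp: add_pos_nonneg)
  then show ?thesis using e by (simp add: softsign'_def power2_eq_square)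
qed

lemma softsign'_abs_le: "e > 0 \<Longrightarrow> \<bar>softsign' e s\<bar> \<le> 1 / e"
  using softsign'_pos[of e s] softsign'_le[of e s] by simp

lemma softsign_abs_le: "e > 0 \<Longrightarrow> \<bar>softsign e s\<bar> \<le> 1"
  by (simp add: softsign_def divide_le_eq)

lemma softsign_0: "softsign e 0 = 0"
  by (simp add: softsign_def)

lemma softsign'_lipschitz:
  assumes "e > 0" shows "\<bar>softsign' e s - softsign' e t\<bar> \<le> (2 / e\<^sup>2) * \<bar>s - t\<bar>"
proof -
  define x where "x = e + \<bar>s\<bar>"
  define y where "y = e + \<bar>t\<bar>"
  have xy: "x \<ge> e" "y \<ge> e" "x > 0" "y > 0" using assms by (auto simp: x_def y_def)
  \<comment> \<open>The difference of the inverse squares is factored so that each summand in the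
    last bracket is a product of three factors at most \<open>1 / e\<close>.\<close>
  have "softsign' e s - softsign' e t = e * (y - x) * ((1 / x) * (1 / y) * (1 / y) + (1 / x) * (1 / x) * (1 / y))"
    using xy by (simp add: softsign'_def x_def[symmetric] y_def[symmetric] field_simps power2_eq_square)
  then have "\<bar>softsign' e s - softsign' e t\<bar> = e * \<bar>y - x\<bar> * ((1 / x) * (1 / y) * (1 / y) + (1 / x) * (1 / x) * (1 / y))"
    using xy assms by (simp add: abs_mult)
  also have "\<dots> \<le> e * \<bar>s - t\<bar> * ((1 / e) * (1 / e) * (1 / e) + (1 / e) * (1 / e) * (1 / e))"
    using xy assms by (intro mult_mono add_mono) (auto simp: x_def y_def frac_le)
  also have "\<dots> = (2 / e\<^sup>2) * \<bar>s - t\<bar>" using assms by (simp add: field_simps power2_eq_square)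
  finally show ?thesis .
qed

text \<open>The \<open>C\<^sup>1\<^sup>,\<^sup>1\<close> substitute for the negative part of its argument.\<close>

definition softneg :: "real \<Rightarrow> real" where
  "softneg s = (min (softsign 1 s) 0)\<^sup>2"

definition softneg' :: "real \<Rightarrow> real" where
  "softneg' s = 2 * min (softsign 1 s) 0 * softsign' 1 s"

lemma softsign_neg_iff: "e > 0 \<Longrightarrow> softsign e s < 0 \<longleftrightarrow> s < 0"
  by (simp add: softsign_def divide_less_0_iff add_pos_nonneg not_less) linarith

lemma softsign_lipschitz: "e > 0 \<Longrightarrow> \<bar>softsign e s - softsign e t\<bar> \<le> (1 / e) * \<bar>s - t\<bar>"
  using field_differentiable_bound[of UNIV "softsign e" "softsign' e" "1 / e" s t]
    softsign_has_derivative softsign'_abs_le by auto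

lemma softneg_has_derivative: "(softneg has_real_derivative softneg' s) (at s)"
proof -
  \<comment> \<open>Squaring removes the corner of \<open>min y 0\<close> at the origin.\<close>
  have d: "((\<lambda>y. (min y 0)\<^sup>2) has_real_derivative 2 * min y 0) (at y)" for y :: real
  proof -
    consider "y < 0" | "y = 0" | "y > 0" by linarith
    then show ?thesis
    proof cases
      case 1
      have "((\<lambda>y. y\<^sup>2) has_real_derivative 2 * min y 0) (at y)"
        using 1 by (auto intro!: derivative_eq_intros)
      then show ?thesis
        by (rule has_field_derivative_transform_within_open[of _ _ _ "{..<0}"]) (use 1 in auto)
    next
      case 2
      have "((\<lambda>h::real. min h 0) \<longlongrightarrow> min 0 0) (at 0)" by (intro tendsto_intros)
      moreover have "\<forall>\<^sub>F h::real in at 0. min h 0 = (min h 0)\<^sup>2 / h"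
        by (simp add: eventually_at_filter min_def power2_eq_square)
      ultimately have "((\<lambda>h::real. (min h 0)\<^sup>2 / h) \<longlongrightarrow> min 0 0) (at 0)"
        by (rule Lim_transform_eventually)
      then have "((\<lambda>h::real. (min h 0)\<^sup>2 / h) \<longlongrightarrow> 0) (at 0)" by simp
      then show ?thesis using 2 by (simp add: DERIV_def)
    next
      case 3
      have "((\<lambda>y. 0) has_real_derivative 2 * min y 0) (at y)"
        using 3 by auto
      then show ?thesis
        by (rule has_field_derivative_transform_within_open[of _ _ _ "{0<..}"]) (use 3 in auto)
    qed
  qed
  show ?thesis
    unfolding softneg_def[abs_def] softneg'_def
    using DERIV_chain2[OF d softsign_has_derivative[of 1 s]] by simp
qed

lemma softneg'_abs_le: "\<bar>softneg' s\<bar> \<le> 2"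
proof -
  have "\<bar>min (softsign 1 s) 0\<bar> \<le> 1" using softsign_abs_le[of 1 s] by linarith
  then have "\<bar>min (softsign 1 s) 0\<bar> * \<bar>softsign' 1 s\<bar> \<le> 1 * 1"
    using softsign'_abs_le[of 1 s] by (intro mult_mono) auto
  then show ?thesis by (simp add: softneg'_def abs_mult)
qed

lemma softneg'_lipschitz: "\<bar>softneg' s - softneg' t\<bar> \<le> 6 * \<bar>s - t\<bar>"
proof -
  let ?m = "\<lambda>s. min (softsign 1 s) 0"
  have m1: "\<bar>?m s\<bar> \<le> 1" using softsign_abs_le[of 1 s] by linarith
  have m2: "\<bar>?m s - ?m t\<bar> \<le> \<bar>s - t\<bar>" using softsign_lipschitz[of 1 s t] by simp
  have tri: "\<bar>x\<bar> \<le> 2 * (\<bar>p\<bar> + \<bar>q\<bar>)" if "x = 2 * (p + q)" for x p q :: real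
  proof -
    have "\<bar>x\<bar> = 2 * \<bar>p + q\<bar>" unfolding that abs_mult by simp
    also have "\<dots> \<le> 2 * (\<bar>p\<bar> + \<bar>q\<bar>)" by (intro mult_left_mono abs_triangle_ineq) simp
    finally show ?thesis .
  qed
  have "softneg' s - softneg' t = 2 * (?m s * (softsign' 1 s - softsign' 1 t) + (?m s - ?m t) * softsign' 1 t)"
    by (simp add: softneg'_def algebra_simps)
  then have "\<bar>softneg' s - softneg' t\<bar> \<le> 2 * (\<bar>?m s\<bar> * \<bar>softsign' 1 s - softsign' 1 t\<bar> + \<bar>?m s - ?m t\<bar> * \<bar>softsign' 1 t\<bar>)"
    unfolding abs_mult[symmetric] by (rule tri)
  also have "\<dots> \<le> 2 * (1 * (2 * \<bar>s - t\<bar>) + \<bar>s - t\<bar> * 1)"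
    using m1 m2 softsign'_lipschitz[of 1 s t] softsign'_abs_le[of 1 t]
    by (intro mult_left_mono add_mono mult_mono) auto
  finally show ?thesis by simp
qed

lemma softneg_bounds: "\<bar>softneg s\<bar> \<le> 1" "softneg s \<ge> 0" "softneg 0 = 0" "softneg' s \<le> 0"
proof -
  have "\<bar>min (softsign 1 s) 0\<bar> \<le> 1" using softsign_abs_le[of 1 s] by linarith
  then show "\<bar>softneg s\<bar> \<le> 1" by (simp add: softneg_def abs_square_le_1)
  show "softneg' s \<le> 0" using softsign'_pos[of 1 s]
    by (simp add: softneg'_def mult_nonpos_nonneg)
qed (auto simp: softneg_def softsign_0)

lemma softneg_eq_0D: "softneg s = 0 \<Longrightarrow> s \<ge> 0"
  using softsign_neg_iff[of 1 s] by (auto simp: softneg_def min_def split: if_splits)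

subsection \<open>The boundary of a Lipschitz domain\<close>

lemma lebesgue_measure_translate:
  fixes S :: "'a::euclidean_space set"
  assumes "S \<in> sets borel"
  shows "measure lebesgue ((+) c ` S) = measure lebesgue S"
  using measure_translation[of c S] by simp

lemma layer_borel:
  fixes f :: "'a::euclidean_space \<Rightarrow> real"
  assumes "continuous_on UNIV f"
  shows "{x \<in> ball p r. f x < x \<bullet> e \<and> x \<bullet> e \<le> f x + t} \<in> sets borel"
proof -
  have "open {x. f x < x \<bullet> e}" "closed {x. x \<bullet> e \<le> f x + t}"
    by (intro open_Collect_less closed_Collect_le continuous_intros assms)+
  then have "ball p r \<inter> ({x. f x < x \<bullet> e} \<inter> {x. x \<bullet> e \<le> f x + t}) \<in> sets borel"
    by (rule sets.Int[OF borel_open[OF open_ball] sets.Int[OF borel_open borel_closed]])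
  moreover have "ball p r \<inter> ({x. f x < x \<bullet> e} \<inter> {x. x \<bullet> e \<le> f x + t}) = {x \<in> ball p r. f x < x \<bullet> e \<and> x \<bullet> e \<le> f x + t}"
    by blast
  ultimately show ?thesis by (simp only:)
qed

text \<open>The translates of the layer by \<open>j t e\<close>, \<open>j < 1/t\<close>, are disjoint subsets of a fixed ball.\<close>

lemma lipschitz_layer_measure:
  fixes e :: "'a::euclidean_space"
  assumes e: "norm e = 1" and f: "continuous_on UNIV f" "\<And>x s. f (x + s *\<^sub>R e) = f x"
    and t: "0 < t" "t \<le> 1"
  shows "measure lebesgue {x \<in> ball p r. f x < x \<bullet> e \<and> x \<bullet> e \<le> f x + t} \<le> 2 * t * measure lebesgue (ball p (r + 1))"
proof -
  let ?S = "{x \<in> ball p r. f x < x \<bullet> e \<and> x \<bullet> e \<le> f x + t}"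
  have Sb: "?S \<in> sets borel" using f(1) by (rule layer_borel)
  define N where "N = nat \<lfloor>1 / t\<rfloor>"
  have N: "real N \<le> 1 / t" "1 / t < real N + 1"
    using t by (auto simp: N_def)
  have N1: "N \<ge> 1" using t by (auto simp: N_def le_nat_iff le_floor_iff)
  let ?T = "\<lambda>j. (+) ((real j * t) *\<^sub>R e) ` ?S"
  have ee: "e \<bullet> e = 1" using e by (simp add: dot_square_norm)
  have lm: "?S \<in> lmeasurable"
  proof (rule bounded_set_imp_lmeasurable)
    show "bounded ?S" by (rule bounded_subset[OF bounded_ball[of p r]]) blast
    show "?S \<in> sets lebesgue" using Sb by simp
  qed
  have Tlm: "?T j \<in> lmeasurable" for j using lm by (rule measurable_translation)
  have inT: "f x + real j * t < x \<bullet> e \<and> x \<bullet> e \<le> f x + real j * t + t" if xT: "x \<in> ?T j" for x j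
  proof -
    obtain y where y: "y \<in> ?S" "x = (real j * t) *\<^sub>R e + y" using xT by blast
    have "f x = f y" using f(2)[of y "real j * t"] by (simp add: y(2) add.commute)
    moreover have "x \<bullet> e = real j * t + y \<bullet> e" by (simp add: y(2) inner_add_left ee)
    ultimately show ?thesis using y(1) by auto
  qed
  have disj: "disjoint_family_on ?T {..<N}"
    unfolding disjoint_family_on_def
  proof (intro ballI impI)
    fix i j :: nat assume "i \<noteq> j"
    have *: "?T i \<inter> ?T j = {}" if "i < j" for i j :: nat
    proof (rule ccontr)
      assume "?T i \<inter> ?T j \<noteq> {}"
      then obtain x where x: "x \<in> ?T i" "x \<in> ?T j" by blast
      have "f x + real j * t < f x + real i * t + t" using inT[OF x(1)] inT[OF x(2)] by linarith
      then have "real j * t < (real i + 1) * t" by (simp add: algebra_simps)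
      then have "real j < real i + 1" using t(1) by simp
      then show False using that by simp
    qed
    show "?T i \<inter> ?T j = {}"
      using *[of i j] *[of j i] \<open>i \<noteq> j\<close> by (cases "i < j") (auto simp: not_less Int_commute)
  qed
  have sub: "(\<Union>j\<in>{..<N}. ?T j) \<subseteq> ball p (r + 1)"
  proof
    fix x assume "x \<in> (\<Union>j\<in>{..<N}. ?T j)"
    then obtain j y where j: "j < N" and y: "y \<in> ?S" "x = (real j * t) *\<^sub>R e + y" by blast
    have "real j * t \<le> real N * t" using j t(1) by simp
    also have "\<dots> \<le> 1" using N(1) t(1) by (simp add: field_simps)
    finally have "norm ((real j * t) *\<^sub>R e) \<le> 1" using e t(1) by simp
    moreover have "dist p y < r" using y(1) by simp
    moreover have "dist p x \<le> dist p y + norm ((real j * t) *\<^sub>R e)"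
      using norm_triangle_ineq4[of "p - y" "(real j * t) *\<^sub>R e"] by (simp add: dist_norm y(2) algebra_simps)
    ultimately show "x \<in> ball p (r + 1)" by simp
  qed
  have "real N * measure lebesgue ?S = (\<Sum>j\<in>{..<N}. measure lebesgue (?T j))"
    by (simp only: lebesgue_measure_translate[OF Sb] sum_constant card_lessThan)
  also have "\<dots> = measure lebesgue (\<Union>j\<in>{..<N}. ?T j)"
  proof (rule measure_finite_Union[symmetric])
    show "?T ` {..<N} \<subseteq> sets lebesgue" using fmeasurableD[OF Tlm] by blast
    show "emeasure lebesgue (?T j) \<noteq> \<infinity>" for j
      unfolding infinity_ennreal_def by (rule fmeasurableD2[OF Tlm])
  qed (simp, rule disj)
  also have "\<dots> \<le> measure lebesgue (ball p (r + 1))"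
    using Tlm by (intro measure_mono_fmeasurable sub fmeasurableD fmeasurable.finite_UN) auto
  finally have le: "real N * measure lebesgue ?S \<le> measure lebesgue (ball p (r + 1))" .
  \<comment> \<open>\<open>N\<close> is the integer part of \<open>1 / t\<close> and at least 1, so
    \<open>N + 1 \<le> 2 * N\<close>; this is the origin of the factor 2.\<close>
  have "1 \<le> 2 * t * real N"
  proof -
    have "1 < (real N + 1) * t" using N(2) t(1) by (simp add: field_simps)
    also have "\<dots> \<le> 2 * real N * t" using N1 t(1) by (intro mult_right_mono) auto
    finally show ?thesis by (simp add: mult_ac)
  qed
  then have "measure lebesgue ?S \<le> (2 * t * real N) * measure lebesgue ?S"
    using mult_right_mono[of 1 "2 * t * real N" "measure lebesgue ?S"] by simp
  also have "\<dots> \<le> 2 * t * measure lebesgue (ball p (r + 1))"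
    using mult_left_mono[OF le, of "2 * t"] t(1) by (simp add: mult_ac)
  finally show ?thesis .
qed

text \<open>Finitely many charts cover the compact boundary. A point of the strip is within
  \<open>t\<close> of a boundary point, and in the chart around that point it lies above the graph
  by at most \<open>(1 + L p) * t\<close>. The strip is thus covered by layers of known
  measure.\<close>

lemma lipschitz_domain_boundary_strip:
  fixes D :: "'a::euclidean_space set"
  assumes "lipschitz_domain D"
  obtains C where "C > 0" "\<And>t. 0 < t \<Longrightarrow> measure lebesgue {x \<in> D. infdist x (- D) \<le> t} \<le> C * t"
proof -
  have D: "open D" "bounded D" "D \<noteq> {}" using assms by (auto simp: lipschitz_domain_def bounded_domain_def)
  have Dl: "D \<in> lmeasurable" using D by (simp add: lmeasurable_open)
  let ?W = "\<lambda>t. {x \<in> D. infdist x (- D) \<le> t}"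
  have Wm: "?W t \<in> lmeasurable" for t
  proof (rule bounded_set_imp_lmeasurable)
    show "bounded (?W t)" using D(2) by (rule bounded_subset) auto
    have "?W t = D \<inter> {x. infdist x (- D) \<le> t}" by auto
    moreover have "{x. infdist x (- D) \<le> t} \<in> sets borel"
      by (intro borel_closed closed_Collect_le continuous_intros continuous_on_infdist)
    ultimately show "?W t \<in> sets lebesgue" using D(1) by (auto intro!: sets.Int)
  qed
  \<comment> \<open>Packing a chart into one predicate lets the nested existential quantifiers be
    turned into choice functions one at a time.\<close>
  define Q where "Q p r e \<gamma> L \<longleftrightarrow> r > 0 \<and> norm e = 1 \<and> lipschitz_on L {y. y \<bullet> e = 0} \<gamma> \<and>
        D \<inter> ball p r = {x \<in> ball p r. \<gamma> (x - (x \<bullet> e) *\<^sub>R e) < x \<bullet> e}" for p e :: 'a and r L :: real and \<gamma> :: "'a \<Rightarrow> real"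
  have Q0: "\<forall>p\<in>frontier D. \<exists>r e \<gamma> L. Q p r e \<gamma> L"
    using assms unfolding lipschitz_domain_def Q_def by blast
  obtain r where Q1: "\<forall>p\<in>frontier D. \<exists>e \<gamma> L. Q p (r p) e \<gamma> L" using bchoice[OF Q0] by blast
  obtain e where Q2: "\<forall>p\<in>frontier D. \<exists>\<gamma> L. Q p (r p) (e p) \<gamma> L" using bchoice[OF Q1] by blast
  obtain \<gamma> where Q3: "\<forall>p\<in>frontier D. \<exists>L. Q p (r p) (e p) (\<gamma> p) L" using bchoice[OF Q2] by blast
  obtain L where Q4: "\<forall>p\<in>frontier D. Q p (r p) (e p) (\<gamma> p) (L p)" using bchoice[OF Q3] by blast
  have ch: "\<And>p. p \<in> frontier D \<Longrightarrow> r p > 0" "\<And>p. p \<in> frontier D \<Longrightarrow> norm (e p) = 1"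
     "\<And>p. p \<in> frontier D \<Longrightarrow> (L p)-lipschitz_on {y. y \<bullet> e p = 0} (\<gamma> p)"
     "\<And>p. p \<in> frontier D \<Longrightarrow> D \<inter> ball p (r p) = {x \<in> ball p (r p). \<gamma> p (x - (x \<bullet> e p) *\<^sub>R e p) < x \<bullet> e p}"
    using Q4 unfolding Q_def by blast+
  have cf: "compact (frontier D)" using D(2) by (simp add: compact_frontier_bounded)
  \<comment> \<open>Balls of half the radius: a point close to a boundary point in the half ball
    then still lies in the full chart.\<close>
  have sub: "frontier D \<subseteq> (\<Union>p\<in>frontier D. ball p (r p / 2))"
    using ch(1) by fastforce
  obtain P where P: "P \<subseteq> frontier D" "finite P" "frontier D \<subseteq> (\<Union>p\<in>P. ball p (r p / 2))"
    using compactE_image[of "frontier D" "frontier D" "\<lambda>p. ball p (r p / 2)", OF cf _ sub] open_ball by blast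
  \<comment> \<open>The chart function composed with the projection to its hyperplane: defined on
    the whole space, constant along \<open>e p\<close>, and Lipschitz with the same constant, since
    the projection does not increase distances.\<close>
  define f where "f p x = \<gamma> p (x - (x \<bullet> e p) *\<^sub>R e p)" for p x
  define S where "S p t = {x \<in> ball p (r p). f p x < x \<bullet> e p \<and> x \<bullet> e p \<le> f p x + t}" for p t
  have ep: "e p \<bullet> e p = 1" if "p \<in> P" for p using ch(2)[of p] that P(1) by (auto simp: dot_square_norm)
  have hyp: "(x - (x \<bullet> e p) *\<^sub>R e p) \<bullet> e p = 0" if "p \<in> P" for p x
    using ep[OF that] by (simp add: inner_diff_left)
  have Lip: "(L p)-lipschitz_on {y. y \<bullet> e p = 0} (\<gamma> p)" "L p \<ge> 0" if "p \<in> P" for p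
    using ch(3)[of p] that P(1) lipschitz_on_nonneg by blast+
  have flip: "\<bar>f p x - f p y\<bar> \<le> L p * norm (x - y)" if "p \<in> P" for p x y
  proof -
    let ?z = "x - y"
    have "\<bar>f p x - f p y\<bar> \<le> L p * norm ((x - (x \<bullet> e p) *\<^sub>R e p) - (y - (y \<bullet> e p) *\<^sub>R e p))"
      using lipschitz_onD[OF Lip(1)[OF that], of "x - (x \<bullet> e p) *\<^sub>R e p" "y - (y \<bullet> e p) *\<^sub>R e p"] hyp[OF that]
      by (simp add: f_def dist_norm)
    also have "(x - (x \<bullet> e p) *\<^sub>R e p) - (y - (y \<bullet> e p) *\<^sub>R e p) = ?z - (?z \<bullet> e p) *\<^sub>R e p"
      by (simp add: inner_diff_left algebra_simps)
    also have "L p * norm (?z - (?z \<bullet> e p) *\<^sub>R e p) \<le> L p * norm ?z"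
    proof (intro mult_left_mono Lip(2)[OF that])
      have "(norm (?z - (?z \<bullet> e p) *\<^sub>R e p))\<^sup>2 = (norm ?z)\<^sup>2 - (?z \<bullet> e p)\<^sup>2"
        unfolding power2_norm_eq_inner using ep[OF that]
        by (simp add: inner_diff_left inner_diff_right inner_commute power2_eq_square algebra_simps)
      also have "\<dots> \<le> (norm ?z)\<^sup>2" by simp
      finally show "norm (?z - (?z \<bullet> e p) *\<^sub>R e p) \<le> norm ?z" by (rule power2_le_imp_le) simp
    qed
    finally show ?thesis .
  qed
  have fc: "continuous_on UNIV (f p)" if "p \<in> P" for p
  proof -
    have "(L p)-lipschitz_on UNIV (f p)"
      using flip[OF that] Lip(2)[OF that] by (intro lipschitz_onI) (auto simp: dist_norm)
    then show ?thesis by (rule lipschitz_on_continuous_on)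
  qed
  have ft: "f p (x + s *\<^sub>R e p) = f p x" if "p \<in> P" for p x s
    using ep[OF that] by (simp add: f_def inner_add_left algebra_simps)
  \<comment> \<open>The second condition keeps the points of the strip inside the chart; the third
    keeps the layers thin enough for \<open>lipschitz_layer_measure\<close>.\<close>
  obtain t0 where t0: "t0 > 0" "\<And>p. p \<in> P \<Longrightarrow> t0 \<le> r p / 2" "\<And>p. p \<in> P \<Longrightarrow> (1 + L p) * t0 \<le> 1"
  proof -
    let ?A = "insert 1 ((\<lambda>p. min (r p / 2) (1 / (1 + L p))) ` P)"
    have fA: "finite ?A" using P(2) by simp
    have pos: "min (r p / 2) (1 / (1 + L p)) > 0" if "p \<in> P" for p
      using ch(1)[of p] that P(1) Lip(2)[OF that] by auto
    have "Min ?A > 0" using fA pos by (subst Min_gr_iff) auto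
    moreover have le: "Min ?A \<le> min (r p / 2) (1 / (1 + L p))" if "p \<in> P" for p
      using fA that by (intro Min_le) auto
    moreover have "(1 + L p) * Min ?A \<le> 1" if "p \<in> P" for p
    proof -
      have "Min ?A \<le> 1 / (1 + L p)" using le[OF that] by simp
      then show ?thesis using Lip(2)[OF that] by (simp add: field_simps)
    qed
    ultimately show ?thesis by (intro that[of "Min ?A"]) auto
  qed
  define C1 where "C1 = (\<Sum>p\<in>P. 2 * (1 + L p) * measure lebesgue (ball p (r p + 1)))"
  have C1: "C1 \<ge> 0" unfolding C1_def using Lip(2) by (intro sum_nonneg) auto
  have small: "measure lebesgue (?W t) \<le> C1 * t" if t: "0 < t" "t \<le> t0" for t
  proof -
    have cover: "?W t \<subseteq> (\<Union>p\<in>P. S p ((1 + L p) * t))"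
    proof
      fix x assume x: "x \<in> ?W t"
      have "- D \<noteq> {}"
      proof
        assume "- D = {}"
        then have "D = UNIV" by auto
        then show False using D(2) not_bounded_UNIV by simp
      qed
      moreover have "closed (- D)" using D(1) by (rule closed_Compl)
      ultimately obtain y where y: "y \<in> - D" "infdist x (- D) = dist x y"
        using infdist_attains_inf by blast
      \<comment> \<open>The segment from \<open>x\<close> in \<open>D\<close> to a nearest point of
        the complement meets the boundary, at distance at most \<open>t\<close> from
        \<open>x\<close>.\<close>
      have "\<exists>z. z \<in> closed_segment x y \<and> z \<in> frontier D"
      proof -
        have "closed_segment x y \<inter> frontier D \<noteq> {}"
          using x y(1) by (intro connected_Int_frontier connected_segment) auto
        then show ?thesis by blast
      qed
      then obtain z where z: "z \<in> closed_segment x y" "z \<in> frontier D" by blast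
      have xz: "norm (x - z) \<le> t"
        using segment_bound1[OF z(1)] x y(2) by (simp add: dist_norm norm_minus_commute)
      obtain p where p: "p \<in> P" "dist p z < r p / 2" using P(3) z(2) by fastforce
      have tr: "t \<le> r p / 2" using t(2) t0(2)[OF p(1)] by linarith
      have zb: "z \<in> ball p (r p)" using p(2) ch(1)[of p] P(1) p(1) by auto
      have xb: "x \<in> ball p (r p)"
        using p(2) tr xz dist_triangle[of p x z] by (simp add: dist_norm norm_minus_commute)
      have Dp: "D \<inter> ball p (r p) = {x \<in> ball p (r p). f p x < x \<bullet> e p}"
        using ch(4)[of p] P(1) p(1) unfolding f_def by blast
      have "z \<notin> D" using z(2) D(1) by (simp add: frontier_def interior_open)
      \<comment> \<open>The boundary point is on or below the graph and \<open>x\<close> is above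
        it. Going from \<open>z\<close> to \<open>x\<close> changes the height by at most
        \<open>t\<close> and the graph by at most \<open>L p * t\<close>.\<close>
      then have "\<not> f p z < z \<bullet> e p" using Dp zb by blast
      then have fz: "z \<bullet> e p \<le> f p z" by simp
      have fx: "f p x < x \<bullet> e p" using Dp xb x by blast
      have "x \<bullet> e p - z \<bullet> e p \<le> norm (x - z) * norm (e p)"
        using norm_cauchy_schwarz[of "x - z" "e p"] by (simp add: inner_diff_left)
      then have "x \<bullet> e p \<le> z \<bullet> e p + t" using ch(2)[of p] P(1) p(1) xz by auto
      also have "\<dots> \<le> f p x + L p * norm (x - z) + t" using fz flip[OF p(1), of x z] by linarith
      also have "\<dots> \<le> f p x + L p * t + t" using xz Lip(2)[OF p(1)] by (simp add: mult_left_mono)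
      finally have "x \<bullet> e p \<le> f p x + (1 + L p) * t" by (simp add: algebra_simps)
      then show "x \<in> (\<Union>p\<in>P. S p ((1 + L p) * t))" using p(1) xb fx by (auto simp: S_def)
    qed
    have Slm: "S p s \<in> lmeasurable" if "p \<in> P" for p s
    proof (rule bounded_set_imp_lmeasurable)
      show "bounded (S p s)" unfolding S_def by (rule bounded_subset[OF bounded_ball[of p "r p"]]) blast
      have "S p s \<in> sets borel" unfolding S_def using fc[OF that] by (rule layer_borel)
      then show "S p s \<in> sets lebesgue" by simp
    qed
    have "measure lebesgue (?W t) \<le> measure lebesgue (\<Union>p\<in>P. S p ((1 + L p) * t))"
      using Slm P(2) Wm by (intro measure_mono_fmeasurable cover fmeasurableD fmeasurable.finite_UN) auto
    also have "\<dots> \<le> (\<Sum>p\<in>P. measure lebesgue (S p ((1 + L p) * t)))"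
      using Slm P(2) by (intro measure_UNION_le) auto
    also have "\<dots> \<le> (\<Sum>p\<in>P. 2 * ((1 + L p) * t) * measure lebesgue (ball p (r p + 1)))"
    proof (rule sum_mono)
      fix p assume p: "p \<in> P"
      have "(1 + L p) * t \<le> (1 + L p) * t0" using Lip(2)[OF p] t(2) by (intro mult_left_mono) auto
      then have "(1 + L p) * t \<le> 1" using t0(3)[OF p] by linarith
      moreover have "0 < (1 + L p) * t" using Lip(2)[OF p] t(1) by simp
      ultimately show "measure lebesgue (S p ((1 + L p) * t)) \<le> 2 * ((1 + L p) * t) * measure lebesgue (ball p (r p + 1))"
        unfolding S_def using ch(2)[of p] P(1) p
        by (intro lipschitz_layer_measure fc[OF p] ft[OF p]) auto
    qed
    also have "\<dots> = C1 * t" 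
      unfolding C1_def sum_distrib_right by (intro sum.cong) (simp_all only: mult_ac)
    finally show ?thesis .
  qed
  \<comment> \<open>The middle term serves the widths above \<open>t0\<close>, where the measure of
    \<open>D\<close> is bound enough; the 1 makes the constant positive.\<close>
  define C where "C = C1 + measure lebesgue D / t0 + 1"
  have "measure lebesgue (?W t) \<le> C * t" if t: "0 < t" for t
  proof (cases "t \<le> t0")
    case True
    have "C1 * t \<le> C * t" using t t0(1) by (intro mult_right_mono) (auto simp: C_def)
    then show ?thesis using small[OF t True] by linarith
  next
    case False
    have "measure lebesgue (?W t) \<le> measure lebesgue D"
      using Wm Dl by (intro measure_mono_fmeasurable) auto
    also have "\<dots> = (measure lebesgue D / t0) * t0" using t0(1) by simp
    also have "\<dots> \<le> (measure lebesgue D / t0) * t" using False t0(1) by (intro mult_left_mono) auto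
    also have "\<dots> \<le> C * t" using t C1 by (intro mult_right_mono) (auto simp: C_def)
    finally show ?thesis .
  qed
  moreover have "C > 0" unfolding C_def using C1 t0(1) by (intro add_nonneg_pos add_nonneg_nonneg) auto
  ultimately show ?thesis using that by blast
qed

text \<open>A piecewise linear function of the distance to the complement is mollified. With
  \<open>c = t / 4\<close> it rises with slope \<open>1 / c\<close> from 0 at distance
  \<open>2 * c\<close> to 1 at distance \<open>3 * c\<close>. A kernel of radius \<open>c\<close>
  shifts distances by less than \<open>c\<close>, so the result is 0 below \<open>c\<close> and 1
  above \<open>4 * c = t\<close>, and it keeps the Lipschitz constant
  \<open>1 / c = 4 / t\<close>.\<close>

lemma smooth_cutoff:
  fixes D :: "'a::euclidean_space set"
  assumes D: "open D" "bounded D" and t: "t > 0"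
  obtains \<phi> where "\<phi> \<in> test_functions D" "\<And>x. t < infdist x (- D) \<Longrightarrow> \<phi> x = 1"
    "\<And>x i. t < infdist x (- D) \<Longrightarrow> i \<in> Basis \<Longrightarrow> partial i \<phi> x = 0"
    "\<And>x i. i \<in> Basis \<Longrightarrow> \<bar>partial i \<phi> x\<bar> \<le> 4 / t"
proof -
  have Dne: "- D \<noteq> {}"
  proof
    assume "- D = {}"
    then have "D = UNIV" by auto
    then show False using D(2) not_bounded_UNIV by simp
  qed
  define \<rho> where "\<rho> x = infdist x (- D)" for x
  have \<rho>lip: "\<bar>\<rho> x - \<rho> y\<bar> \<le> norm (x - y)" for x y
    using infdist_triangle_abs[of x "- D" y] by (simp add: \<rho>_def dist_norm)
  have \<rho>0: "\<rho> x = 0" if "x \<notin> D" for x using that by (simp add: \<rho>_def)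
  define c where "c = t / 4"
  have c: "c > 0" using t by (simp add: c_def)
  define \<psi> where "\<psi> x = max 0 (min 1 ((\<rho> x - 2 * c) / c))" for x
  have \<psi>lip: "\<bar>\<psi> x - \<psi> y\<bar> \<le> norm (x - y) / c" for x y
  proof -
    have "\<bar>\<psi> x - \<psi> y\<bar> \<le> \<bar>(\<rho> x - 2 * c) / c - (\<rho> y - 2 * c) / c\<bar>" unfolding \<psi>_def by linarith
    also have "\<dots> = \<bar>\<rho> x - \<rho> y\<bar> / c" using c by (simp add: diff_divide_distrib[symmetric])
    also have "\<dots> \<le> norm (x - y) / c" using \<rho>lip c by (intro divide_right_mono) auto
    finally show ?thesis .
  qed
  have \<psi>0: "\<psi> x = 0" if "\<rho> x \<le> 2 * c" for x using that c by (simp add: \<psi>_def divide_nonpos_pos)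
  have \<psi>1: "\<psi> x = 1" if "\<rho> x \<ge> 3 * c" for x
  proof -
    have "(\<rho> x - 2 * c) / c \<ge> 1" using that c by (simp add: field_simps)
    then show ?thesis by (simp add: \<psi>_def)
  qed
  have "(1 / c)-lipschitz_on UNIV \<psi>"
    using \<psi>lip c by (intro lipschitz_onI) (auto simp: dist_norm field_simps)
  then have \<psi>c: "continuous_on UNIV \<psi>" by (rule lipschitz_on_continuous_on)
  have \<rho>c: "continuous_on UNIV \<rho>" unfolding \<rho>_def by (intro continuous_intros)
  let ?K = "{x. c \<le> \<rho> x}"
  have K: "compact ?K" "?K \<subseteq> D"
  proof -
    show sub: "?K \<subseteq> D" using \<rho>0 c by fastforce
    have "closed ?K" by (intro closed_Collect_le \<rho>c continuous_on_const)
    then show "compact ?K" using bounded_subset[OF D(2) sub] by (simp add: compact_eq_bounded_closed)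
  qed
  have \<psi>i: "integrable lborel \<psi>"
    by (rule continuous_compact_support_integrable[OF \<psi>c K(1)]) (use \<psi>0 c in force)
  then have \<psi>il: "integrable lebesgue \<psi>" by (simp add: integrable_completion)
  have [measurable]: "\<psi> \<in> borel_measurable borel" using \<psi>c by (rule borel_measurable_continuous_onI)
  let ?\<eta> = "bump c :: 'a \<Rightarrow> real"
  have [measurable]: "?\<eta> \<in> borel_measurable borel" using bump_test[OF c] by (rule test_function_borel)
  define \<phi> where "\<phi> = conv \<psi> ?\<eta>"
  have C: "Ck k \<phi>" for k unfolding \<phi>_def using bump_test[OF c] \<psi>il by (rule Ck_conv)
  have i: "integrable lborel (\<lambda>z. ?\<eta> z * \<psi> (x - z))" for x
  proof -
    have "integrable lborel (\<lambda>y. \<psi> y * ?\<eta> (x - y))"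
      using test_function_conv_integrable[OF bump_test[OF c] \<psi>il, of x] by (simp add: integrable_completion)
    then show ?thesis using integrable_reflect[of "\<lambda>y. \<psi> y * ?\<eta> (x - y)" x] by (simp add: mult.commute)
  qed
  have \<phi>eq: "\<phi> x = (LINT z|lborel. ?\<eta> z * \<psi> (x - z))" for x
  proof -
    have "\<phi> x = (LINT y|lborel. \<psi> y * ?\<eta> (x - y))"
      unfolding \<phi>_def conv_def by (rule integral_completion) measurable
    then show ?thesis using integral_reflect[of "\<lambda>y. \<psi> y * ?\<eta> (x - y)" x] by (simp add: mult.commute)
  qed
  have \<rho>z: "\<bar>\<rho> (x - z) - \<rho> x\<bar> < c" if "?\<eta> z \<noteq> 0" for x z
  proof -
    have "norm z < c" using that bump_eq_0[OF c, of z] by force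
    then show ?thesis using \<rho>lip[of "x - z" x] by simp
  qed
  have \<phi>0: "\<phi> x = 0" if "x \<notin> ?K" for x
  proof -
    have z: "?\<eta> z * \<psi> (x - z) = 0" for z
    proof (cases "?\<eta> z = 0")
      case False
      then have "\<rho> (x - z) \<le> 2 * c" using \<rho>z[OF False, of x] that by simp
      then show ?thesis using \<psi>0 by simp
    qed simp
    show ?thesis unfolding \<phi>eq z by simp
  qed
  have \<phi>1: "\<phi> x = 1" if "\<rho> x > 4 * c" for x
  proof -
    have z: "?\<eta> z * \<psi> (x - z) = ?\<eta> z" for z
    proof (cases "?\<eta> z = 0")
      case False
      then have "\<rho> (x - z) \<ge> 3 * c" using \<rho>z[OF False, of x] that by simp
      then show ?thesis using \<psi>1 by simp
    qed simp
    show ?thesis unfolding \<phi>eq z by (rule bump_integral[OF c])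
  qed
  have \<phi>lip: "\<bar>\<phi> x - \<phi> y\<bar> \<le> norm (x - y) / c" for x y
  proof -
    have "\<phi> x - \<phi> y = (LINT z|lborel. ?\<eta> z * \<psi> (x - z) - ?\<eta> z * \<psi> (y - z))"
      unfolding \<phi>eq using i[of x] i[of y] by simp
    then have "\<bar>\<phi> x - \<phi> y\<bar> \<le> (LINT z|lborel. \<bar>?\<eta> z * \<psi> (x - z) - ?\<eta> z * \<psi> (y - z)\<bar>)"
      using integral_norm_bound[of lborel "\<lambda>z. ?\<eta> z * \<psi> (x - z) - ?\<eta> z * \<psi> (y - z)"] by simp
    also have "\<dots> \<le> (LINT z|lborel. ?\<eta> z * (norm (x - y) / c))"
    proof (rule integral_mono)
      show "integrable lborel (\<lambda>z. \<bar>?\<eta> z * \<psi> (x - z) - ?\<eta> z * \<psi> (y - z)\<bar>)" using i[of x] i[of y] by auto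
      show "integrable lborel (\<lambda>z. ?\<eta> z * (norm (x - y) / c))"
        using bump_integrable[OF c, where 'a='a] by (intro integrable_mult_left) auto
      fix z
      have "?\<eta> z * \<bar>\<psi> (x - z) - \<psi> (y - z)\<bar> \<le> ?\<eta> z * (norm (x - y) / c)"
        using \<psi>lip[of "x - z" "y - z"] bump_nonneg[OF c, of z] by (intro mult_left_mono) auto
      then show "\<bar>?\<eta> z * \<psi> (x - z) - ?\<eta> z * \<psi> (y - z)\<bar> \<le> ?\<eta> z * (norm (x - y) / c)"
        using bump_nonneg[OF c, of z] by (simp add: right_diff_distrib[symmetric] abs_mult)
    qed
    also have "\<dots> = norm (x - y) / c" using bump_integral[OF c, where 'a='a] by simp
    finally show ?thesis .
  qed
  have \<phi>t: "\<phi> \<in> test_functions D" using C K \<phi>0 by (intro test_functionsI)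
  \<comment> \<open>The bound is read off from the Lipschitz constant of \<open>\<phi>\<close>; a
    bound through the gradient of the kernel would introduce an unspecified constant.\<close>
  have pb: "\<bar>partial i \<phi> x\<bar> \<le> 1 / c" if i: "i \<in> Basis" for i x
  proof -
    have d: "\<phi> differentiable (at x)" using \<phi>t by (rule test_function_differentiable)
    have "((\<phi> \<circ> (\<lambda>s. x + s *\<^sub>R i)) has_derivative (frechet_derivative \<phi> (at (x + 0 *\<^sub>R i)) \<circ> (\<lambda>h. h *\<^sub>R i))) (at (0::real))"
      using d by (intro diff_chain_at) (auto intro!: derivative_eq_intros simp: frechet_derivative_works[symmetric])
    moreover have "frechet_derivative \<phi> (at x) (h *\<^sub>R i) = partial i \<phi> x * h" for h
      using linear_frechet_derivative[OF d] by (simp add: linear_cmul) (simp add: partial_def mult.commute)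
    ultimately have "((\<lambda>s. \<phi> (x + s *\<^sub>R i)) has_real_derivative partial i \<phi> x) (at 0)"
      unfolding has_field_derivative_def o_def by simp
    then have "((\<lambda>h. (\<phi> (x + h *\<^sub>R i) - \<phi> x) / h) \<longlongrightarrow> partial i \<phi> x) (at 0)"
      by (simp add: DERIV_def)
    then have "((\<lambda>h. \<bar>(\<phi> (x + h *\<^sub>R i) - \<phi> x) / h\<bar>) \<longlongrightarrow> \<bar>partial i \<phi> x\<bar>) (at 0)" by (rule tendsto_rabs)
    then show ?thesis
    proof (rule tendsto_upperbound)
      have "\<bar>(\<phi> (x + h *\<^sub>R i) - \<phi> x) / h\<bar> \<le> 1 / c" if "h \<noteq> 0" for h
      proof -
        have "\<bar>\<phi> (x + h *\<^sub>R i) - \<phi> x\<bar> \<le> \<bar>h\<bar> / c" using \<phi>lip[of "x + h *\<^sub>R i" x] i by simp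
        then have "\<bar>\<phi> (x + h *\<^sub>R i) - \<phi> x\<bar> / \<bar>h\<bar> \<le> (\<bar>h\<bar> / c) / \<bar>h\<bar>" by (rule divide_right_mono) simp
        then show ?thesis using that by simp
      qed
      then show "\<forall>\<^sub>F h in at 0. \<bar>(\<phi> (x + h *\<^sub>R i) - \<phi> x) / h\<bar> \<le> 1 / c"
        by (auto simp: eventually_at_filter)
    qed simp
  qed
  have p0: "partial i \<phi> x = 0" if x: "t < infdist x (- D)" and i: "i \<in> Basis" for i x
  proof -
    have o: "open {x. 4 * c < \<rho> x}" by (intro open_Collect_less continuous_on_const \<rho>c)
    have "(\<phi> has_derivative (\<lambda>_. 0)) (at x)"
    proof (rule has_derivative_transform_within_open[OF has_derivative_const[of 1] o])
      show "x \<in> {x. 4 * c < \<rho> x}" using x by (simp add: \<rho>_def c_def)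
      show "1 = \<phi> y" if "y \<in> {x. 4 * c < \<rho> x}" for y using that \<phi>1[of y] by simp
    qed
    then show ?thesis by (simp add: partialI)
  qed
  show ?thesis
  proof (rule that[OF \<phi>t])
    show "\<phi> x = 1" if "t < infdist x (- D)" for x using \<phi>1[of x] that by (simp add: \<rho>_def c_def)
    show "\<bar>partial i \<phi> x\<bar> \<le> 4 / t" if "i \<in> Basis" for x i using pb[OF that, of x] by (simp add: c_def)
  qed (rule p0)
qed

subsection \<open>One solution\<close>

lemma H10_test_function:
  assumes D: "open D" "bounded D" and \<phi>: "\<phi> \<in> test_functions D"
  shows "\<phi> \<in> H10 D"
proof -
  have \<phi>U: "\<phi> \<in> test_functions UNIV" using \<phi> test_functions_mono[of D UNIV] by auto
  obtain K where K: "compact K" "K \<subseteq> D" "\<And>x. x \<notin> K \<Longrightarrow> \<phi> x = 0" "\<And>x i. x \<notin> K \<Longrightarrow> partial i \<phi> x = 0"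
    using test_functionsE[OF \<phi>] by metis
  show ?thesis
    by (rule compact_support_in_H10[OF D has_weak_gradient_test_function[OF D \<phi>U] K(1,2)])
       (auto simp: K(3,4) gradient_def)
qed

lemma test_function_square:
  assumes "\<phi> \<in> test_functions D"
  shows "(\<lambda>x. \<phi> x * \<phi> x) \<in> test_functions D"
    and "gradient (\<lambda>x. \<phi> x * \<phi> x) x = (2 * \<phi> x) *\<^sub>R gradient \<phi> x"
proof -
  obtain K where K: "compact K" "K \<subseteq> D" "\<And>x. x \<notin> K \<Longrightarrow> \<phi> x = 0"
    using test_functionsE[OF assms] by metis
  show "(\<lambda>x. \<phi> x * \<phi> x) \<in> test_functions D"
    using K assms by (intro test_functionsI[of _ K] Ck_mult) (auto simp: test_functions_def)
  have d: "\<phi> differentiable (at x)" using assms by (rule test_function_differentiable)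
  show "gradient (\<lambda>x. \<phi> x * \<phi> x) x = (2 * \<phi> x) *\<^sub>R gradient \<phi> x"
    by (simp add: gradient_def partial_mult[OF d d] scaleR_sum_right) (simp add: algebra_simps)
qed

lemma L2_norm_sq_integrable:
  "g \<in> L2 D \<Longrightarrow> sq_integrable (lebesgue_on D) (\<lambda>x. norm (g x))"
  by (auto simp: L2_def sq_integrable_def)

lemma L2_inner_integrable:
  assumes "g \<in> L2 D" "k \<in> L2 D" "c \<in> borel_measurable (lebesgue_on D)" "AE x in lebesgue_on D. \<bar>c x\<bar> \<le> B"
  shows "integrable (lebesgue_on D) (\<lambda>x. c x * (g x \<bullet> k x))"
proof (rule Bochner_Integration.integrable_bound)
  have [measurable]: "g \<in> borel_measurable (lebesgue_on D)" "k \<in> borel_measurable (lebesgue_on D)"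
    "c \<in> borel_measurable (lebesgue_on D)" using assms by (auto simp: L2_def)
  show "integrable (lebesgue_on D) (\<lambda>x. B * (norm (g x) * norm (k x)))"
    using sq_integrable_mult[OF assms(1,2)[THEN L2_norm_sq_integrable]] by simp
  show "(\<lambda>x. c x * (g x \<bullet> k x)) \<in> borel_measurable (lebesgue_on D)" by measurable
  show "AE x in lebesgue_on D. norm (c x * (g x \<bullet> k x)) \<le> norm (B * (norm (g x) * norm (k x)))"
    using assms(4)
  proof eventually_elim
    case (elim x)
    have "\<bar>c x\<bar> * \<bar>g x \<bullet> k x\<bar> \<le> B * (norm (g x) * norm (k x))"
      using elim Cauchy_Schwarz_ineq2[of "g x" "k x"] by (intro mult_mono) auto
    then show ?case unfolding real_norm_def abs_mult[of "c x"] by (rule order_trans[OF _ abs_ge_self])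
  qed
qed

lemma Cauchy_Schwarz_L2_norm:
  assumes "g \<in> L2 D" "k \<in> L2 D"
  shows "(LINT x|lebesgue_on D. norm (g x) * norm (k x)) \<le> L2_norm D g * L2_norm D k"
proof -
  have "(LINT x|lebesgue_on D. norm (g x) * norm (k x))\<^sup>2 \<le> (L2_norm D g)\<^sup>2 * (L2_norm D k)\<^sup>2"
    using Cauchy_Schwarz_integral[OF assms[THEN L2_norm_sq_integrable]] by (simp add: L2_norm_square)
  then have "(LINT x|lebesgue_on D. norm (g x) * norm (k x))\<^sup>2 \<le> (L2_norm D g * L2_norm D k)\<^sup>2"
    by (simp add: power_mult_distrib)
  then show ?thesis
    by (rule power2_le_imp_le) (simp add: L2_norm_def)
qed

text \<open>Excludes the degenerate case of a null domain, in which almost everywhere statements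
  carry no information and an essential supremum can be minus infinity.\<close>

lemma not_AE_False:
  assumes "D \<in> lmeasurable" "measure lebesgue D > 0"
  shows "\<not> (AE x in lebesgue_on D. False)"
proof
  assume "AE x in lebesgue_on D. False"
  then have "(LINT x|lebesgue_on D. 1 :: real) = (LINT x|lebesgue_on D. 0)"
    by (intro integral_cong_AE) auto
  then show False using assms by (simp add: measure_restrict_space)
qed

lemma indicator_lebesgue_on:
  fixes D :: "'a::euclidean_space set"
  assumes "D \<in> sets lebesgue" "W \<in> lmeasurable" "W \<subseteq> D"
  shows "integrable (lebesgue_on D) (indicator W :: 'a \<Rightarrow> real)"
    and "(LINT x|lebesgue_on D. indicator W x) = measure lebesgue W"
proof -
  have ind: "(\<lambda>x. indicator D x *\<^sub>R (indicator W x :: real)) = indicator W"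
    using assms(3) by (auto simp: indicator_def fun_eq_iff)
  have D: "D \<inter> space lebesgue \<in> sets lebesgue" using assms(1) by simp
  show "integrable (lebesgue_on D) (indicator W :: 'a \<Rightarrow> real)"
    unfolding integrable_restrict_space[OF D] ind using assms(2) by (simp add: lmeasurable_iff_integrable)
  show "(LINT x|lebesgue_on D. indicator W x) = measure lebesgue W"
    unfolding integral_restrict_space[OF D] ind by simp
qed

text \<open>The first identity absorbs the mixed term in the estimate near the boundary. The second
  gives \<open>1 - softsign e s \<ge> 1 / 2\<close> for \<open>s \<le> e\<close>, and for
  \<open>e = lam\<close> and \<open>s = a x - lam\<close> it gives \<open>lam / a x\<close>.\<close>

lemma softsign_nonneg_identity:
  assumes "e > 0" "s \<ge> 0"
  shows "(1 - softsign e s)\<^sup>2 = e * softsign' e s" "1 - softsign e s = e / (e + s)"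
proof -
  show "1 - softsign e s = e / (e + s)" using assms by (simp add: softsign_def field_simps)
  then show "(1 - softsign e s)\<^sup>2 = e * softsign' e s"
    using assms by (simp add: softsign'_def power_divide power2_eq_square)
qed

lemma softsign_borel: "e > 0 \<Longrightarrow> softsign e \<in> borel_measurable borel"
  by (intro borel_measurable_continuous_onI continuous_at_imp_continuous_on ballI DERIV_isCont[OF softsign_has_derivative])

lemma softsign'_borel [measurable]: "softsign' e \<in> borel_measurable borel"
  unfolding softsign'_def[abs_def] by measurable

text \<open>One equation with its data. \<open>g\<close> is any weak gradient of \<open>u\<close>,
  so no selected representative occurs; \<open>F\<close> will be the essential supremum norm of
  \<open>f\<close>.\<close>

locale diffusion_solution =
  fixes D :: "'a::euclidean_space set" and a f u :: "'a \<Rightarrow> real" and g :: "'a \<Rightarrow> 'a" and lam Lam cf F :: real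
  assumes D: "open D" "bounded D"
    and lam: "lam > 0" and cf: "cf > 0"
    and am [measurable]: "a \<in> borel_measurable (lebesgue_on D)" and a: "AE x in lebesgue_on D. lam \<le> a x \<and> a x \<le> Lam"
    and fm [measurable]: "f \<in> borel_measurable (lebesgue_on D)" and f: "AE x in lebesgue_on D. cf \<le> f x" "AE x in lebesgue_on D. \<bar>f x\<bar> \<le> F"
    and sol: "weak_solution D a (functional_of D f) u" and g: "has_weak_gradient D u g"
begin

lemma Dl: "D \<in> lmeasurable" and fin: "finite_measure (lebesgue_on D)"
  using D finite_measure_lebesgue_on[of D] by (simp_all add: lmeasurable_open)

lemma um [measurable]: "u \<in> borel_measurable (lebesgue_on D)"
  and gL: "g \<in> L2 D" and gm [measurable]: "g \<in> borel_measurable (lebesgue_on D)"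
  using g by (auto simp: has_weak_gradient_def L2_def)

lemma u_H10: "u \<in> H10 D"
  using sol by (simp add: weak_solution_def)

lemma a_abs: "AE x in lebesgue_on D. \<bar>a x\<bar> \<le> Lam"
  using a by eventually_elim (use lam in auto)

lemma test:
  "has_weak_gradient D v k \<Longrightarrow> v \<in> H10 D \<Longrightarrow> (LINT x|lebesgue_on D. a x * (g x \<bullet> k x)) = (LINT x|lebesgue_on D. f x * v x)"
  using weak_solution_test[OF D sol am g] by (simp add: functional_of_def)

lemma f_mult_integrable:
  assumes "v \<in> borel_measurable (lebesgue_on D)" "AE x in lebesgue_on D. \<bar>v x\<bar> \<le> B"
  shows "integrable (lebesgue_on D) (\<lambda>x. f x * v x)"
  by (rule sq_integrable_mult[OF sq_integrable_bounded[OF fin fm f(2)] sq_integrable_bounded[OF fin assms]])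

lemma const_one: "has_weak_gradient D (\<lambda>x. 1) (\<lambda>x. 0)" "AE x in lebesgue_on D. \<bar>1::real\<bar> \<le> 1"
  using has_weak_gradient_const[OF D, of 1] by auto

text \<open>Weak maximum principle. Testing with \<open>softneg (u x)\<close> makes the energy side
  at most 0, as \<open>softneg'\<close> is nonpositive, and the side with \<open>f\<close> at least
  0, as \<open>f\<close> is positive. Both vanish, and with them
  \<open>softneg (u x)\<close>.\<close>

lemma u_nonneg: "AE x in lebesgue_on D. u x \<ge> 0"
proof -
  let ?v = "\<lambda>x. 1 * softneg (u x)" and ?k = "\<lambda>x. (1 * softneg' (u x)) *\<^sub>R g x + softneg (u x) *\<^sub>R (0::'a)"
  have w: "has_weak_gradient D ?v ?k"
    by (rule has_weak_gradient_mult_comp[OF D g const_one softneg_has_derivative softneg'_abs_le softneg'_lipschitz softneg_bounds(1)])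
  have v: "?v \<in> H10 D"
    by (rule H10_mult_comp[OF D g u_H10 const_one softneg_has_derivative softneg'_abs_le softneg'_lipschitz softneg_bounds(1,3)])
  have vm[measurable]: "?v \<in> borel_measurable (lebesgue_on D)" using w by (simp add: has_weak_gradient_def L2_def)
  have i: "integrable (lebesgue_on D) (\<lambda>x. f x * ?v x)"
    using softneg_bounds(1) by (intro f_mult_integrable[OF vm, of 1]) simp
  have nn: "AE x in lebesgue_on D. 0 \<le> f x * ?v x"
    using f(1) by eventually_elim (use cf softneg_bounds(2) in auto)
  have "0 \<le> (LINT x|lebesgue_on D. - (a x * (g x \<bullet> ?k x)))"
  proof (rule integral_nonneg_AE)
    show "AE x in lebesgue_on D. 0 \<le> - (a x * (g x \<bullet> ?k x))"
      using a
    proof eventually_elim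
      case (elim x)
      have "softneg' (u x) * (g x \<bullet> g x) \<le> 0" using softneg_bounds(4) by (intro mult_nonpos_nonneg) auto
      then show ?case using elim lam by (simp add: mult_nonneg_nonpos)
    qed
  qed
  then have "(LINT x|lebesgue_on D. f x * ?v x) \<le> 0" using test[OF w v] by simp
  moreover have "(LINT x|lebesgue_on D. f x * ?v x) \<ge> 0" using nn by (rule integral_nonneg_AE)
  ultimately have "AE x in lebesgue_on D. f x * ?v x = 0"
    using integral_nonneg_eq_0_iff_AE[OF i nn] by linarith
  then show ?thesis using f(1)
    by eventually_elim (use cf softneg_eq_0D in auto)
qed

text \<open>Testing with \<open>softsign e (u x)\<close> bounds the integral of \<open>a\<close>
  times \<open>softsign'\<close> times the squared gradient by \<open>F\<close> times the measure of
  \<open>D\<close>. One of the two factors \<open>softsign'\<close> in the claim is estimated by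
  \<open>1 / e\<close>; this is the source of the later term \<open>sqrt (F / e)\<close>.\<close>

lemma energy:
  assumes e: "e > 0"
  shows "integrable (lebesgue_on D) (\<lambda>x. (softsign' e (u x))\<^sup>2 * (norm (g x))\<^sup>2)"
    "(LINT x|lebesgue_on D. (softsign' e (u x))\<^sup>2 * (norm (g x))\<^sup>2) \<le> F * measure lebesgue D / (lam * e)"
proof -
  let ?v = "\<lambda>x. 1 * softsign e (u x)" and ?k = "\<lambda>x. (1 * softsign' e (u x)) *\<^sub>R g x + softsign e (u x) *\<^sub>R (0::'a)"
  have w: "has_weak_gradient D ?v ?k"
    by (rule has_weak_gradient_mult_comp[OF D g const_one softsign_has_derivative softsign'_abs_le softsign'_lipschitz softsign_abs_le]) (rule e)+
  have v: "?v \<in> H10 D"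
    by (rule H10_mult_comp[OF D g u_H10 const_one softsign_has_derivative softsign'_abs_le softsign'_lipschitz softsign_abs_le softsign_0]) (rule e)+
  have vm[measurable]: "?v \<in> borel_measurable (lebesgue_on D)" and kL: "?k \<in> L2 D"
    using w by (auto simp: has_weak_gradient_def L2_def)
  have i: "integrable (lebesgue_on D) (\<lambda>x. f x * ?v x)"
    using softsign_abs_le[OF e] by (intro f_mult_integrable[OF vm, of 1]) simp
  have ia: "integrable (lebesgue_on D) (\<lambda>x. a x * (g x \<bullet> ?k x))" by (rule L2_inner_integrable[OF gL kL am a_abs])
  have pt: "AE x in lebesgue_on D. (softsign' e (u x))\<^sup>2 * (norm (g x))\<^sup>2 \<le> (1 / (lam * e)) * (a x * (g x \<bullet> ?k x))"
    using a
  proof eventually_elim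
    case (elim x)
    have p: "softsign' e (u x) > 0" "softsign' e (u x) \<le> 1 / e" using softsign'_pos[OF e] softsign'_le[OF e] by auto
    have "(softsign' e (u x))\<^sup>2 \<le> (1 / e) * softsign' e (u x)"
      unfolding power2_eq_square using p by (intro mult_right_mono) auto
    also have "\<dots> \<le> (a x / lam) * ((1 / e) * softsign' e (u x))"
      using mult_right_mono[of 1 "a x / lam" "(1 / e) * softsign' e (u x)"] elim lam e p by (simp add: field_simps)
    finally have "(softsign' e (u x))\<^sup>2 * (norm (g x))\<^sup>2 \<le> (a x / lam) * ((1 / e) * softsign' e (u x)) * (norm (g x))\<^sup>2"
      by (rule mult_right_mono) simp
    also have "\<dots> = (1 / (lam * e)) * (a x * (g x \<bullet> ?k x))" by (simp add: power2_norm_eq_inner)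
    finally show ?case .
  qed
  show int: "integrable (lebesgue_on D) (\<lambda>x. (softsign' e (u x))\<^sup>2 * (norm (g x))\<^sup>2)"
  proof (rule Bochner_Integration.integrable_bound[OF integrable_mult_right[OF ia, of "1 / (lam * e)"]])
    show "AE x in lebesgue_on D. norm ((softsign' e (u x))\<^sup>2 * (norm (g x))\<^sup>2) \<le> norm ((1 / (lam * e)) * (a x * (g x \<bullet> ?k x)))"
      using pt
    proof eventually_elim
      case (elim x)
      show ?case unfolding real_norm_def by (rule order_trans[OF _ abs_ge_self]) (use elim in simp)
    qed
  qed measurable
  have "(LINT x|lebesgue_on D. (softsign' e (u x))\<^sup>2 * (norm (g x))\<^sup>2) \<le> (LINT x|lebesgue_on D. (1 / (lam * e)) * (a x * (g x \<bullet> ?k x)))"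
    by (rule integral_mono_AE[OF int integrable_mult_right[OF ia] pt])
  also have "\<dots> = (1 / (lam * e)) * (LINT x|lebesgue_on D. f x * ?v x)" using test[OF w v] by simp
  also have "\<dots> \<le> (1 / (lam * e)) * (LINT x|lebesgue_on D. F)"
  proof (rule mult_left_mono[OF integral_mono_AE[OF i]])
    show "integrable (lebesgue_on D) (\<lambda>x. F)" using finite_measure.integrable_const[OF fin] .
    show "AE x in lebesgue_on D. f x * ?v x \<le> F"
      using f(2)
    proof eventually_elim
      case (elim x)
      have "\<bar>f x\<bar> * \<bar>?v x\<bar> \<le> F * 1" using elim softsign_abs_le[OF e, of "u x"] by (intro mult_mono) auto
      then show ?case using abs_ge_self[of "f x * ?v x"] by (simp add: abs_mult)
    qed
  qed (use lam e in simp)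
  also have "(LINT x|lebesgue_on D. F) = F * measure lebesgue D"
    using Dl by (simp add: measure_restrict_space)
  finally show "(LINT x|lebesgue_on D. (softsign' e (u x))\<^sup>2 * (norm (g x))\<^sup>2) \<le> F * measure lebesgue D / (lam * e)" by simp
qed

text \<open>Testing with \<open>\<phi>\<^sup>2 (1 - softsign e u)\<close>, which is essentially \<open>e \<phi>\<^sup>2 / (e + u)\<close>: the quadratic
  term has the good sign and absorbs the mixed one because \<open>(1 - softsign e)\<^sup>2 = e softsign' e\<close>.\<close>

lemma layer_integral:
  assumes e: "e > 0" and \<phi>: "\<phi> \<in> test_functions D"
  shows "integrable (lebesgue_on D) (\<lambda>x. (\<phi> x)\<^sup>2 * (1 - softsign e (u x)))"
    "cf * (LINT x|lebesgue_on D. (\<phi> x)\<^sup>2 * (1 - softsign e (u x))) \<le> Lam * e * (LINT x|lebesgue_on D. (norm (gradient \<phi> x))\<^sup>2)"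
proof -
  let ?q = "\<lambda>x. softsign e (u x)" and ?q' = "\<lambda>x. softsign' e (u x)"
  let ?\<phi>2 = "\<lambda>x. \<phi> x * \<phi> x"
  note \<phi>2 = test_function_square(1)[OF \<phi>]
  have U: "\<phi> \<in> test_functions UNIV" "?\<phi>2 \<in> test_functions UNIV" using \<phi> \<phi>2 test_functions_mono[of D UNIV] by auto
  have w1: "has_weak_gradient D ?\<phi>2 (gradient ?\<phi>2)" by (rule has_weak_gradient_test_function[OF D U(2)])
  have v1: "?\<phi>2 \<in> H10 D" by (rule H10_test_function[OF D \<phi>2])
  obtain B where B: "\<And>x. \<bar>?\<phi>2 x\<bar> \<le> B" using test_function_bounded[OF \<phi>2] by blast
  have B0: "0 \<le> B" using abs_ge_zero B by (rule order_trans)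
  have BAE: "AE x in lebesgue_on D. \<bar>?\<phi>2 x\<bar> \<le> B" using B by simp
  let ?v = "\<lambda>x. ?\<phi>2 x * ?q x" and ?k = "\<lambda>x. (?\<phi>2 x * ?q' x) *\<^sub>R g x + ?q x *\<^sub>R gradient ?\<phi>2 x"
  have w2: "has_weak_gradient D ?v ?k"
    by (rule has_weak_gradient_mult_comp[OF D g w1 BAE softsign_has_derivative softsign'_abs_le softsign'_lipschitz softsign_abs_le]) (rule e)+
  have v2: "?v \<in> H10 D"
    by (rule H10_mult_comp[OF D g u_H10 w1 BAE softsign_has_derivative softsign'_abs_le softsign'_lipschitz softsign_abs_le softsign_0]) (rule e)+
  have L: "gradient ?\<phi>2 \<in> L2 D" "?k \<in> L2 D" using w1 w2 by (auto simp: has_weak_gradient_def)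
  have m[measurable]: "?\<phi>2 \<in> borel_measurable (lebesgue_on D)" "?v \<in> borel_measurable (lebesgue_on D)"
    "\<phi> \<in> borel_measurable (lebesgue_on D)"
    using w1 w2 test_function_borel[OF \<phi>] borel_measurable_lebesgue_onI by (auto simp: has_weak_gradient_def L2_def)
  have q01: "0 \<le> 1 - ?q x" "1 - ?q x \<le> 2" for x using softsign_abs_le[OF e, of "u x"] by auto
  have [measurable]: "softsign e \<in> borel_measurable borel" using softsign_borel[OF e] .
  have B2: "AE x in lebesgue_on D. \<bar>(\<phi> x)\<^sup>2 * (1 - ?q x)\<bar> \<le> B * 2"
  proof (rule AE_I2)
    fix x
    have "\<bar>?\<phi>2 x\<bar> * \<bar>1 - ?q x\<bar> \<le> B * 2" using B[of x] q01[of x] B0 by (intro mult_mono) auto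
    then show "\<bar>(\<phi> x)\<^sup>2 * (1 - ?q x)\<bar> \<le> B * 2" by (simp add: abs_mult power2_eq_square)
  qed
  have m2: "(\<lambda>x. (\<phi> x)\<^sup>2 * (1 - ?q x)) \<in> borel_measurable (lebesgue_on D)" by measurable
  show int: "integrable (lebesgue_on D) (\<lambda>x. (\<phi> x)\<^sup>2 * (1 - ?q x))"
    by (rule sq_integrable_integrable[OF fin sq_integrable_bounded[OF fin m2 B2]])
  have fi: "integrable (lebesgue_on D) (\<lambda>x. f x * ((\<phi> x)\<^sup>2 * (1 - ?q x)))" by (rule f_mult_integrable[OF m2 B2])
  have fi1: "integrable (lebesgue_on D) (\<lambda>x. f x * ?\<phi>2 x)" by (rule f_mult_integrable[OF m(1) BAE])
  have fi2: "integrable (lebesgue_on D) (\<lambda>x. f x * ?v x)"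
  proof (rule f_mult_integrable[OF m(2)])
    show "AE x in lebesgue_on D. \<bar>?v x\<bar> \<le> B * 1"
    proof (rule AE_I2)
      fix x
      have "\<bar>?\<phi>2 x\<bar> * \<bar>?q x\<bar> \<le> B * 1" using B[of x] softsign_abs_le[OF e, of "u x"] B0 by (intro mult_mono) auto
      then show "\<bar>?v x\<bar> \<le> B * 1" by (simp only: abs_mult)
    qed
  qed
  have ai: "integrable (lebesgue_on D) (\<lambda>x. a x * (g x \<bullet> gradient ?\<phi>2 x))" "integrable (lebesgue_on D) (\<lambda>x. a x * (g x \<bullet> ?k x))"
    using L2_inner_integrable[OF gL _ am a_abs] L by blast+
  have gi: "integrable (lebesgue_on D) (\<lambda>x. (norm (gradient \<phi> x))\<^sup>2)"
    using has_weak_gradient_test_function[OF D U(1)] by (simp add: has_weak_gradient_def L2_def)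
  have "cf * (LINT x|lebesgue_on D. (\<phi> x)\<^sup>2 * (1 - ?q x)) = (LINT x|lebesgue_on D. cf * ((\<phi> x)\<^sup>2 * (1 - ?q x)))" by simp
  also have "\<dots> \<le> (LINT x|lebesgue_on D. f x * ((\<phi> x)\<^sup>2 * (1 - ?q x)))"
  proof (rule integral_mono_AE[OF integrable_mult_right[OF int] fi])
    show "AE x in lebesgue_on D. cf * ((\<phi> x)\<^sup>2 * (1 - ?q x)) \<le> f x * ((\<phi> x)\<^sup>2 * (1 - ?q x))"
      using f(1) by eventually_elim (use q01 in \<open>auto intro!: mult_right_mono\<close>)
  qed
  also have "\<dots> = (LINT x|lebesgue_on D. f x * ?\<phi>2 x - f x * ?v x)"
    by (rule Bochner_Integration.integral_cong) (auto simp: power2_eq_square algebra_simps)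
  also have "\<dots> = (LINT x|lebesgue_on D. a x * (g x \<bullet> gradient ?\<phi>2 x)) - (LINT x|lebesgue_on D. a x * (g x \<bullet> ?k x))"
    unfolding Bochner_Integration.integral_diff[OF fi1 fi2] test[OF w1 v1] test[OF w2 v2] ..
  also have "\<dots> = (LINT x|lebesgue_on D. a x * (g x \<bullet> gradient ?\<phi>2 x) - a x * (g x \<bullet> ?k x))"
    by (rule Bochner_Integration.integral_diff[OF ai, symmetric])
  also have "\<dots> \<le> (LINT x|lebesgue_on D. (Lam * e) * (norm (gradient \<phi> x))\<^sup>2)"
  proof (rule integral_mono_AE[OF Bochner_Integration.integrable_diff[OF ai] integrable_mult_right[OF gi]])
    show "AE x in lebesgue_on D. a x * (g x \<bullet> gradient ?\<phi>2 x) - a x * (g x \<bullet> ?k x) \<le> (Lam * e) * (norm (gradient \<phi> x))\<^sup>2"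
      using a u_nonneg
    proof eventually_elim
      case (elim x)
      define s where "s = 1 - ?q x"
      have s: "s \<ge> 0" "s\<^sup>2 = e * ?q' x"
        using q01(1)[of x] softsign_nonneg_identity(1)[OF e elim(2)] by (auto simp: s_def)
      define P where "P = norm (gradient \<phi> x)"
      define A where "A = \<bar>\<phi> x\<bar> * norm (g x)"
      have PA: "P \<ge> 0" "A \<ge> 0" by (auto simp: P_def A_def)
      have q': "?q' x = s\<^sup>2 / e" using s(2) e by simp
      have gg: "(\<phi> x)\<^sup>2 * (g x \<bullet> g x) = A\<^sup>2" by (simp add: A_def power_mult_distrib power2_norm_eq_inner)
      have "(g x \<bullet> gradient ?\<phi>2 x) - (g x \<bullet> ?k x) = 2 * s * (\<phi> x * (g x \<bullet> gradient \<phi> x)) - ?q' x * ((\<phi> x)\<^sup>2 * (g x \<bullet> g x))"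
        by (simp add: test_function_square(2)[OF \<phi>] s_def inner_add_right algebra_simps power2_eq_square)
      also have "\<dots> \<le> 2 * s * (A * P) - (s\<^sup>2 / e) * A\<^sup>2"
      proof -
        have "\<phi> x * (g x \<bullet> gradient \<phi> x) \<le> \<bar>\<phi> x\<bar> * \<bar>g x \<bullet> gradient \<phi> x\<bar>" by (metis abs_ge_self abs_mult)
        also have "\<dots> \<le> \<bar>\<phi> x\<bar> * (norm (g x) * P)" unfolding P_def by (intro mult_left_mono Cauchy_Schwarz_ineq2) auto
        finally have "\<phi> x * (g x \<bullet> gradient \<phi> x) \<le> A * P" by (simp add: A_def mult.assoc)
        then have "2 * s * (\<phi> x * (g x \<bullet> gradient \<phi> x)) \<le> 2 * s * (A * P)" using s(1) by (intro mult_left_mono) auto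
        then show ?thesis by (simp only: gg q')
      qed
      also have "\<dots> \<le> e * P\<^sup>2"
      proof -
        \<comment> \<open>Young's inequality with weight \<open>e\<close>: the mixed term is
          absorbed by the good quadratic term, and what is left no longer involves the gradient of
          \<open>u\<close>.\<close>
        have "0 \<le> (s * A - e * P)\<^sup>2 / e" using e by simp
        also have "\<dots> = e * P\<^sup>2 - (2 * s * (A * P) - (s\<^sup>2 / e) * A\<^sup>2)"
          using e by (simp add: power2_eq_square field_simps)
        finally show ?thesis by simp
      qed
      finally have le: "(g x \<bullet> gradient ?\<phi>2 x) - (g x \<bullet> ?k x) \<le> e * P\<^sup>2" .
      have "a x * ((g x \<bullet> gradient ?\<phi>2 x) - (g x \<bullet> ?k x)) \<le> a x * (e * P\<^sup>2)"
        using elim(1) lam by (intro mult_left_mono le) auto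
      also have "\<dots> \<le> Lam * (e * P\<^sup>2)" using elim(1) e by (intro mult_right_mono) auto
      finally show ?case by (simp only: right_diff_distrib P_def mult.assoc)
    qed
  qed
  finally show "cf * (LINT x|lebesgue_on D. (\<phi> x)\<^sup>2 * (1 - ?q x)) \<le> Lam * e * (LINT x|lebesgue_on D. (norm (gradient \<phi> x))\<^sup>2)"
    by simp
qed

text \<open>A point with \<open>u x < e\<close> lies in the boundary strip, or else the cutoff is 1
  there and \<open>1 - softsign e (u x)\<close> is at least 1/2. Hence the measure is at most that
  of the strip plus twice the integral from \<open>layer_integral\<close>. The gradient of the
  cutoff lives on the strip, so its energy is of order \<open>(1 / t)\<^sup>2\<close> times the
  width \<open>t\<close>; 32 is twice the square of 4.\<close>

lemma sublevel_measure:
  assumes e: "e > 0" and C: "\<And>t. 0 < t \<Longrightarrow> measure lebesgue {x \<in> D. infdist x (- D) \<le> t} \<le> C * t" "C \<ge> 0" and Lam: "Lam > 0"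
  shows "measure lebesgue {x \<in> D. u x < e} \<le> C * (1 + 32 * real DIM('a) * Lam / cf) * sqrt e"
proof -
  \<comment> \<open>For width \<open>t\<close> the two contributions are of order \<open>t\<close>
    and \<open>e / t\<close>; this choice balances them.\<close>
  define t where "t = sqrt e"
  have t: "t > 0" "t * t = e" using e by (auto simp: t_def)
  let ?n = "real DIM('a)"
  have Ds: "D \<in> sets lebesgue" using Dl by (rule fmeasurableD)
  obtain \<phi> where \<phi>: "\<phi> \<in> test_functions D" "\<And>x. t < infdist x (- D) \<Longrightarrow> \<phi> x = 1"
    "\<And>x i. t < infdist x (- D) \<Longrightarrow> i \<in> Basis \<Longrightarrow> partial i \<phi> x = 0"
    "\<And>x i. i \<in> Basis \<Longrightarrow> \<bar>partial i \<phi> x\<bar> \<le> 4 / t"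
    using smooth_cutoff[OF D t(1)] by blast
  let ?W = "{x \<in> D. infdist x (- D) \<le> t}"
  have closedW: "closed {x. infdist x (- D) \<le> t}"
    by (intro closed_Collect_le continuous_intros continuous_on_infdist)
  have WD: "?W = D \<inter> {x. infdist x (- D) \<le> t}" by auto
  have Ws: "?W \<in> sets lebesgue" unfolding WD using Ds closedW by (intro sets.Int) auto
  have Wl: "?W \<in> lmeasurable" by (rule fmeasurableI2[OF Dl _ Ws]) auto
  have U: "\<phi> \<in> test_functions UNIV" using \<phi>(1) test_functions_mono[of D UNIV] by auto
  have gi: "integrable (lebesgue_on D) (\<lambda>x. (norm (gradient \<phi> x))\<^sup>2)"
    using has_weak_gradient_test_function[OF D U] by (simp add: has_weak_gradient_def L2_def)
  have iW: "integrable (lebesgue_on D) (indicator ?W :: 'a \<Rightarrow> real)"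
    and mW: "(LINT x|lebesgue_on D. indicator ?W x) = measure lebesgue ?W"
    by (rule indicator_lebesgue_on[OF Ds Wl], blast)+
  have "(LINT x|lebesgue_on D. (norm (gradient \<phi> x))\<^sup>2) \<le> (LINT x|lebesgue_on D. (?n * (4 / t)\<^sup>2) * indicator ?W x)"
  proof (rule integral_mono[OF gi integrable_mult_right[OF iW]])
    fix x assume "x \<in> space (lebesgue_on D)"
    then have xD: "x \<in> D" by simp
    have eq: "(norm (gradient \<phi> x))\<^sup>2 = (\<Sum>i\<in>Basis. (partial i \<phi> x)\<^sup>2)"
      unfolding sum_inner_Basis_square by (intro sum.cong) (auto simp: gradient_inner)
    show "(norm (gradient \<phi> x))\<^sup>2 \<le> (?n * (4 / t)\<^sup>2) * indicator ?W x"
    proof (cases "x \<in> ?W")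
      case True
      have "(\<Sum>i\<in>(Basis::'a set). (partial i \<phi> x)\<^sup>2) \<le> (\<Sum>i\<in>(Basis::'a set). (4 / t)\<^sup>2)"
      proof (rule sum_mono)
        fix i :: 'a assume "i \<in> Basis"
        then show "(partial i \<phi> x)\<^sup>2 \<le> (4 / t)\<^sup>2" using power_mono[OF \<phi>(4)[of i x], of 2] by simp
      qed
      then show ?thesis using True by (simp add: eq)
    next
      case False
      then show ?thesis using \<phi>(3)[of x] xD by (simp add: eq)
    qed
  qed
  also have "\<dots> = (?n * (4 / t)\<^sup>2) * measure lebesgue ?W" using mW by simp
  also have "\<dots> \<le> (?n * (4 / t)\<^sup>2) * (C * t)" using C(1)[OF t(1)] by (intro mult_left_mono) auto
  also have "\<dots> = 16 * ?n * C / t" using t(1) by (simp add: power2_eq_square)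
  finally have grad: "(LINT x|lebesgue_on D. (norm (gradient \<phi> x))\<^sup>2) \<le> 16 * ?n * C / t" .
  let ?S = "{x \<in> D. u x < e}"
  have Ss: "?S \<in> sets (lebesgue_on D)"
  proof -
    have "{x \<in> space (lebesgue_on D). u x < e} \<in> sets (lebesgue_on D)" by measurable
    then show ?thesis by simp
  qed
  then have Ssl: "?S \<in> sets lebesgue" using Ds by (simp add: sets_restrict_space_iff)
  have Sl: "?S \<in> lmeasurable" by (rule fmeasurableI2[OF Dl _ Ssl]) auto
  have iS: "integrable (lebesgue_on D) (indicator ?S :: 'a \<Rightarrow> real)"
    and mS: "(LINT x|lebesgue_on D. indicator ?S x) = measure lebesgue ?S"
    by (rule indicator_lebesgue_on[OF Ds Sl], blast)+
  note LI = layer_integral[OF e \<phi>(1)]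
  have "measure lebesgue ?S \<le> (LINT x|lebesgue_on D. indicator ?W x + 2 * ((\<phi> x)\<^sup>2 * (1 - softsign e (u x))))"
    unfolding mS[symmetric]
  proof (rule integral_mono_AE[OF iS Bochner_Integration.integrable_add[OF iW integrable_mult_right[OF LI(1)]]])
    have "AE x in lebesgue_on D. x \<in> space (lebesgue_on D)" by (rule AE_space)
    then show "AE x in lebesgue_on D. indicator ?S x \<le> indicator ?W x + 2 * ((\<phi> x)\<^sup>2 * (1 - softsign e (u x)))"
      using u_nonneg
    proof eventually_elim
      case (elim x)
      have q: "0 \<le> 1 - softsign e (u x)" using softsign_abs_le[OF e, of "u x"] by auto
      then have q2: "0 \<le> (\<phi> x)\<^sup>2 * (1 - softsign e (u x))" by simp
      show ?case
      proof (cases "x \<in> ?W \<or> x \<notin> ?S")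
        case True
        then show ?thesis using q2 by (auto simp: indicator_def)
      next
        case False
        then have "\<phi> x = 1" "u x < e" using \<phi>(2)[of x] by auto
        moreover have "1 / 2 \<le> 1 - softsign e (u x)"
          unfolding softsign_nonneg_identity(2)[OF e elim(2)] using \<open>u x < e\<close> e elim(2) by (simp add: field_simps)
        ultimately show ?thesis using False by (auto simp: indicator_def)
      qed
    qed
  qed
  also have "\<dots> = measure lebesgue ?W + 2 * (LINT x|lebesgue_on D. (\<phi> x)\<^sup>2 * (1 - softsign e (u x)))"
    using iW LI(1) mW by simp
  also have "\<dots> \<le> C * t + 2 * (Lam * e * (16 * ?n * C / t) / cf)"
  proof -
    have "cf * (LINT x|lebesgue_on D. (\<phi> x)\<^sup>2 * (1 - softsign e (u x))) \<le> Lam * e * (16 * ?n * C / t)"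
      using LI(2) mult_left_mono[OF grad, of "Lam * e"] e Lam by (auto intro: order_trans)
    then have "(LINT x|lebesgue_on D. (\<phi> x)\<^sup>2 * (1 - softsign e (u x))) \<le> Lam * e * (16 * ?n * C / t) / cf"
      unfolding pos_le_divide_eq[OF cf] by (simp only: mult.commute[of _ cf])
    then show ?thesis using C(1)[OF t(1)] by linarith
  qed
  also have "\<dots> = C * (1 + 32 * ?n * Lam / cf) * t"
    using t cf by (simp add: t(2)[symmetric] field_simps)
  finally show ?thesis by (simp add: t_def)
qed

end

subsection \<open>Two coefficients\<close>

lemma has_weak_gradient_mult:
  fixes D :: "'a::euclidean_space set"
  assumes D: "open D" "bounded D"
    and u: "has_weak_gradient D u g" "AE x in lebesgue_on D. \<bar>u x\<bar> \<le> B"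
    and v: "has_weak_gradient D v h" "AE x in lebesgue_on D. \<bar>v x\<bar> \<le> B'"
  shows "has_weak_gradient D (\<lambda>x. u x * v x) (\<lambda>x. u x *\<^sub>R h x + v x *\<^sub>R g x)"
  unfolding has_weak_gradient_iff
proof
  fix i :: 'a assume i: "i \<in> Basis"
  have w: "weak_partial D i u (\<lambda>x. g x \<bullet> i)" "weak_partial D i v (\<lambda>x. h x \<bullet> i)"
    using u v i by (auto simp: has_weak_gradient_iff)
  note s = weak_partialD(1,2)[OF w(1)] weak_partialD(1,2)[OF w(2)]
  have m: "u \<in> borel_measurable (lebesgue_on D)" "v \<in> borel_measurable (lebesgue_on D)"
    using s by (auto simp: sq_integrable_def)
  have "weak_partial D i (\<lambda>x. u x * v x) (\<lambda>x. u x * (h x \<bullet> i) + (g x \<bullet> i) * v x)"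
  proof (rule weak_partial_mult[OF D i w])
    show "sq_integrable (lebesgue_on D) (\<lambda>x. u x * v x)"
      using s(3) m(1) u(2) by (rule sq_integrable_bounded_mult)
    show "sq_integrable (lebesgue_on D) (\<lambda>x. u x * (h x \<bullet> i) + (g x \<bullet> i) * v x)"
      using sq_integrable_bounded_mult[OF s(4) m(1) u(2)] sq_integrable_bounded_mult[OF s(2) m(2) v(2)]
      by (intro sq_integrable_add) (simp_all add: mult.commute)
  qed
  then show "weak_partial D i (\<lambda>x. u x * v x) (\<lambda>x. (u x *\<^sub>R h x + v x *\<^sub>R g x) \<bullet> i)"
    by (simp add: inner_add_left mult.commute)
qed

lemma norm_add_square_le: "(norm (x + y))\<^sup>2 \<le> 2 * (norm x)\<^sup>2 + 2 * (norm y)\<^sup>2"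
  for x y :: "'a::real_normed_vector"
proof -
  have "(norm (x + y))\<^sup>2 \<le> (norm x + norm y)\<^sup>2" by (intro power_mono norm_triangle_ineq) simp
  moreover have "0 \<le> (norm x - norm y)\<^sup>2" by simp
  ultimately show ?thesis by (simp add: power2_eq_square algebra_simps)
qed

locale diffusion_pair = A: diffusion_solution D a f u g lam Lam cf F + B: diffusion_solution D b f ub gb lam Lam cf F
  for D :: "'a::euclidean_space set" and a b f u ub :: "'a \<Rightarrow> real" and g gb :: "'a \<Rightarrow> 'a" and lam Lam cf F :: real +
  fixes da db :: "'a \<Rightarrow> 'a" and G :: real
  assumes da: "has_weak_gradient D a da" and db: "has_weak_gradient D b db"
    and G: "L2_norm D da \<le> G" "L2_norm D db \<le> G" and Lam: "Lam > 0" and F: "F \<ge> 0"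
begin

lemmas D = A.D and lam = A.lam and cf = A.cf and am [measurable] = A.am and bm [measurable] = B.am

section \<open>The multiplier built from the two coefficients\<close>

text \<open>Equal to \<open>lam * (a x - b x) / a x\<close> where \<open>a x \<ge> lam\<close>.
  Written with \<open>softsign\<close>, it falls under the rule for products with a composition, and
  no quotient rule for weak derivatives is needed.\<close>

definition \<delta> :: "'a \<Rightarrow> real" where
  "\<delta> x = (a x - b x) * (1 - softsign lam (a x - lam))"

definition d :: "'a \<Rightarrow> 'a" where
  "d x = ((a x - b x) * (- softsign' lam (a x - lam))) *\<^sub>R da x + (1 - softsign lam (a x - lam)) *\<^sub>R (da x - db x)"

lemma ab_le: "AE x in lebesgue_on D. \<bar>a x - b x\<bar> \<le> Lam"
  using A.a B.a by eventually_elim (use lam in auto)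

lemma \<delta>_eq: "AE x in lebesgue_on D. a x * \<delta> x = lam * (a x - b x) \<and> \<bar>1 - softsign lam (a x - lam)\<bar> \<le> 1"
  using A.a
proof eventually_elim
  case (elim x)
  then have s: "a x - lam \<ge> 0" "a x > 0" using lam by auto
  have "1 - softsign lam (a x - lam) = lam / a x"
    using softsign_nonneg_identity(2)[OF lam s(1)] by simp
  then show ?case using s elim lam by (simp add: \<delta>_def)
qed

lemma \<delta>_le: "AE x in lebesgue_on D. \<bar>\<delta> x\<bar> \<le> Lam"
  using ab_le \<delta>_eq
proof eventually_elim
  case (elim x)
  have "\<bar>a x - b x\<bar> * \<bar>1 - softsign lam (a x - lam)\<bar> \<le> Lam * 1"
    using elim Lam by (intro mult_mono) auto
  then show ?case by (simp add: \<delta>_def abs_mult)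
qed

lemma \<delta>_gradient: "has_weak_gradient D \<delta> d"
proof -
  have diff: "has_weak_gradient D (\<lambda>x. a x - b x) (\<lambda>x. da x - db x)"
    using da db A.Dl by (rule has_weak_gradient_diff)
  have "((\<lambda>s. 1 - softsign lam (s - lam)) has_real_derivative - softsign' lam (s - lam)) (at s)" for s
  proof -
    have "((\<lambda>s. softsign lam (s - lam)) has_real_derivative softsign' lam (s - lam) * 1) (at s)"
      by (rule DERIV_chain2[where f="softsign lam" and g="\<lambda>s. s - lam", OF softsign_has_derivative[OF lam]])
         (auto intro!: derivative_eq_intros)
    from DERIV_diff[OF DERIV_const[of 1] this] show ?thesis by simp
  qed
  moreover have "\<bar>- softsign' lam (s - lam)\<bar> \<le> 1 / lam" for s using softsign'_abs_le[OF lam] by simp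
  moreover have "\<bar>- softsign' lam (s - lam) - - softsign' lam (t - lam)\<bar> \<le> (2 / lam\<^sup>2) * \<bar>s - t\<bar>" for s t
    using softsign'_lipschitz[OF lam, of "t - lam" "s - lam"] by (simp add: abs_minus_commute)
  moreover have "\<bar>1 - softsign lam (s - lam)\<bar> \<le> 2" for s
    using softsign_abs_le[OF lam, of "s - lam"] by linarith
  ultimately show ?thesis
    unfolding \<delta>_def[abs_def] d_def[abs_def]
    by (intro has_weak_gradient_mult_comp[OF D da diff ab_le]) blast+
qed

lemma \<delta>m [measurable]: "\<delta> \<in> borel_measurable (lebesgue_on D)" and dL: "d \<in> L2 D"
  using \<delta>_gradient by (auto simp: has_weak_gradient_def L2_def)

text \<open>In \<open>d\<close> the gradient of \<open>a\<close> has a coefficient of size at most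
  \<open>Lam / lam + 1\<close>, where \<open>Lam / lam\<close> comes from differentiating the factor
  \<open>lam / a\<close>, and the gradient of \<open>b\<close> one of size at most 1. The factors 2
  come from squaring a sum.\<close>

definition \<kappa> :: real where "\<kappa> = 2 * (Lam / lam + 1)\<^sup>2 + 2"

lemma d_norm: "(LINT x|lebesgue_on D. (norm (d x))\<^sup>2) \<le> \<kappa> * G\<^sup>2"
proof -
  have iab: "integrable (lebesgue_on D) (\<lambda>x. (norm (da x))\<^sup>2)" "integrable (lebesgue_on D) (\<lambda>x. (norm (db x))\<^sup>2)"
    "integrable (lebesgue_on D) (\<lambda>x. (norm (d x))\<^sup>2)"
    using da db dL by (auto simp: has_weak_gradient_def L2_def)
  let ?c = "Lam / lam + 1"
  have c: "?c \<ge> 0" using Lam lam by simp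
  have "(LINT x|lebesgue_on D. (norm (d x))\<^sup>2) \<le> (LINT x|lebesgue_on D. (2 * ?c\<^sup>2) * (norm (da x))\<^sup>2 + 2 * (norm (db x))\<^sup>2)"
  proof (rule integral_mono_AE[OF iab(3) Bochner_Integration.integrable_add[OF integrable_mult_right[OF iab(1)] integrable_mult_right[OF iab(2)]]])
    show "AE x in lebesgue_on D. (norm (d x))\<^sup>2 \<le> (2 * ?c\<^sup>2) * (norm (da x))\<^sup>2 + 2 * (norm (db x))\<^sup>2"
      using ab_le \<delta>_eq
    proof eventually_elim
      case (elim x)
      define h where "h = 1 - softsign lam (a x - lam)"
      define k where "k = (a x - b x) * (- softsign' lam (a x - lam))"
      have h: "\<bar>h\<bar> \<le> 1" using elim by (simp add: h_def)
      have "\<bar>a x - b x\<bar> * \<bar>- softsign' lam (a x - lam)\<bar> \<le> Lam * (1 / lam)"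
        using elim softsign'_abs_le[OF lam, of "a x - lam"] Lam by (intro mult_mono) auto
      then have k: "\<bar>k\<bar> \<le> Lam / lam" by (simp add: k_def abs_mult)
      have eq: "d x = (k + h) *\<^sub>R da x + (- h) *\<^sub>R db x" by (simp add: d_def h_def k_def algebra_simps)
      have 1: "(norm ((k + h) *\<^sub>R da x))\<^sup>2 \<le> ?c\<^sup>2 * (norm (da x))\<^sup>2"
      proof -
        have "\<bar>k + h\<bar> \<le> ?c" using h k by linarith
        then have "(k + h)\<^sup>2 \<le> ?c\<^sup>2" using power_mono[of "\<bar>k + h\<bar>" ?c 2] by simp
        then show ?thesis by (simp add: power_mult_distrib mult_right_mono)
      qed
      have 2: "(norm ((- h) *\<^sub>R db x))\<^sup>2 \<le> (norm (db x))\<^sup>2"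
      proof -
        have "h\<^sup>2 \<le> 1" using h by (simp add: abs_square_le_1)
        then have "h\<^sup>2 * (norm (db x))\<^sup>2 \<le> 1 * (norm (db x))\<^sup>2" by (rule mult_right_mono) simp
        then show ?thesis by (simp add: power_mult_distrib)
      qed
      show ?case unfolding eq using norm_add_square_le[of "(k + h) *\<^sub>R da x" "(- h) *\<^sub>R db x"] 1 2 by linarith
    qed
  qed
  also have "\<dots> = (2 * ?c\<^sup>2) * (L2_norm D da)\<^sup>2 + 2 * (L2_norm D db)\<^sup>2"
    unfolding L2_norm_square using iab by simp
  also have "\<dots> \<le> (2 * ?c\<^sup>2) * G\<^sup>2 + 2 * G\<^sup>2"
    using G by (intro add_mono mult_left_mono power_mono) (auto simp: L2_norm_def)
  finally show ?thesis by (simp add: \<kappa>_def algebra_simps)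
qed

definition E :: real where "E = L2_norm D (\<lambda>x. gb x - g x)"

lemma E_nonneg: "E \<ge> 0" by (simp add: E_def L2_norm_def)

lemma diff_L2: "(\<lambda>x. gb x - g x) \<in> L2 D"
  using has_weak_gradient_diff[OF B.g A.g A.Dl] by (simp add: has_weak_gradient_def)

text \<open>Testing both equations with \<open>\<delta> q(u)\<close> and the first one with \<open>\<delta>\<^sup>2 q(u)\<close>, where \<open>q = softsign e\<close>:
  the two test functions combine so that the term \<open>a \<delta> q \<nabla>u \<cdot> \<nabla>\<delta>\<close> drops out.\<close>

lemma weighted_difference:
  assumes e: "e > 0"
  shows "integrable (lebesgue_on D) (\<lambda>x. (\<delta> x)\<^sup>2 * softsign e (u x))"
    "cf * (LINT x|lebesgue_on D. (\<delta> x)\<^sup>2 * softsign e (u x))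
      \<le> 2 * lam * Lam * E * sqrt (2 * Lam\<^sup>2 * (F * measure lebesgue D / (lam * e)) + 2 * (\<kappa> * G\<^sup>2))"
proof -
  let ?q = "\<lambda>x. softsign e (u x)" and ?q' = "\<lambda>x. softsign' e (u x)"
  have [measurable]: "softsign e \<in> borel_measurable borel" using softsign_borel[OF e] .
  note um = A.um[measurable]
  let ?v = "\<lambda>x. \<delta> x * ?q x" and ?k = "\<lambda>x. (\<delta> x * ?q' x) *\<^sub>R g x + ?q x *\<^sub>R d x"
  have wv: "has_weak_gradient D ?v ?k"
    by (rule has_weak_gradient_mult_comp[OF D A.g \<delta>_gradient \<delta>_le softsign_has_derivative softsign'_abs_le softsign'_lipschitz softsign_abs_le]) (rule e)+
  have v: "?v \<in> H10 D"
    by (rule H10_mult_comp[OF D A.g A.u_H10 \<delta>_gradient \<delta>_le softsign_has_derivative softsign'_abs_le softsign'_lipschitz softsign_abs_le softsign_0]) (rule e)+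
  let ?\<delta>2 = "\<lambda>x. \<delta> x * \<delta> x" and ?d2 = "\<lambda>x. \<delta> x *\<^sub>R d x + \<delta> x *\<^sub>R d x"
  have w2: "has_weak_gradient D ?\<delta>2 ?d2" by (rule has_weak_gradient_mult[OF D \<delta>_gradient \<delta>_le \<delta>_gradient \<delta>_le])
  have \<delta>2_le: "AE x in lebesgue_on D. \<bar>?\<delta>2 x\<bar> \<le> Lam * Lam"
    using \<delta>_le
  proof eventually_elim
    case (elim x)
    then show ?case unfolding abs_mult using Lam by (intro mult_mono) auto
  qed
  let ?w = "\<lambda>x. ?\<delta>2 x * ?q x" and ?l = "\<lambda>x. (?\<delta>2 x * ?q' x) *\<^sub>R g x + ?q x *\<^sub>R ?d2 x"
  have ww: "has_weak_gradient D ?w ?l"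
    by (rule has_weak_gradient_mult_comp[OF D A.g w2 \<delta>2_le softsign_has_derivative softsign'_abs_le softsign'_lipschitz softsign_abs_le]) (rule e)+
  have w: "?w \<in> H10 D"
    by (rule H10_mult_comp[OF D A.g A.u_H10 w2 \<delta>2_le softsign_has_derivative softsign'_abs_le softsign'_lipschitz softsign_abs_le softsign_0]) (rule e)+
  have kL: "?k \<in> L2 D" "?l \<in> L2 D" using wv ww by (auto simp: has_weak_gradient_def)
  have w_bd: "AE x in lebesgue_on D. \<bar>?w x\<bar> \<le> Lam * Lam * 1"
    using \<delta>2_le
  proof eventually_elim
    case (elim x)
    show ?case unfolding abs_mult[of "\<delta> x * \<delta> x"] using elim softsign_abs_le[OF e, of "u x"] Lam by (intro mult_mono) auto
  qed
  have wm[measurable]: "?w \<in> borel_measurable (lebesgue_on D)" by measurable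
  have iw: "integrable (lebesgue_on D) ?w"
    by (rule sq_integrable_integrable[OF A.fin sq_integrable_bounded[OF A.fin wm w_bd]])
  then show "integrable (lebesgue_on D) (\<lambda>x. (\<delta> x)\<^sup>2 * ?q x)" by (simp add: power2_eq_square)
  have ifw: "integrable (lebesgue_on D) (\<lambda>x. f x * ?w x)" by (rule A.f_mult_integrable[OF wm w_bd])
  have iag: "integrable (lebesgue_on D) (\<lambda>x. a x * (g x \<bullet> ?l x))" "integrable (lebesgue_on D) (\<lambda>x. a x * (g x \<bullet> ?k x))"
    using L2_inner_integrable[OF A.gL _ am A.a_abs] kL by blast+
  have ibg: "integrable (lebesgue_on D) (\<lambda>x. b x * (gb x \<bullet> ?k x))" "integrable (lebesgue_on D) (\<lambda>x. b x * (g x \<bullet> ?k x))"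
    using L2_inner_integrable[OF B.gL kL(1) bm B.a_abs] L2_inner_integrable[OF A.gL kL(1) bm B.a_abs] by blast+
  have ink: "integrable (lebesgue_on D) (\<lambda>x. norm (gb x - g x) * norm (?k x))"
    by (rule sq_integrable_mult[OF L2_norm_sq_integrable[OF diff_L2] L2_norm_sq_integrable[OF kL(1)]])
  have "cf * (LINT x|lebesgue_on D. (\<delta> x)\<^sup>2 * ?q x) = (LINT x|lebesgue_on D. cf * ?w x)" by (simp add: power2_eq_square)
  also have "\<dots> \<le> (LINT x|lebesgue_on D. f x * ?w x)"
  proof (rule integral_mono_AE[OF integrable_mult_right[OF iw] ifw])
    show "AE x in lebesgue_on D. cf * ?w x \<le> f x * ?w x"
      using A.f(1) A.u_nonneg
    proof eventually_elim
      case (elim x)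
      have "?q x \<ge> 0" using softsign_neg_iff[OF e, of "u x"] elim by linarith
      then have "?w x \<ge> 0" by simp
      then show ?case using elim(1) by (rule mult_right_mono[rotated])
    qed
  qed
  also have "\<dots> = (LINT x|lebesgue_on D. a x * (g x \<bullet> ?l x))" by (rule A.test[OF ww w, symmetric])
  also have "\<dots> \<le> (LINT x|lebesgue_on D. (2 * lam) * (a x * (g x \<bullet> ?k x) - b x * (g x \<bullet> ?k x)))"
  proof (rule integral_mono_AE[OF iag(1) integrable_mult_right[OF Bochner_Integration.integrable_diff[OF iag(2) ibg(2)]]])
    show "AE x in lebesgue_on D. a x * (g x \<bullet> ?l x) \<le> (2 * lam) * (a x * (g x \<bullet> ?k x) - b x * (g x \<bullet> ?k x))"
      using \<delta>_eq A.a
    proof eventually_elim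
      case (elim x)
      have "(2 * lam) * (a x * (g x \<bullet> ?k x) - b x * (g x \<bullet> ?k x)) = 2 * (lam * (a x - b x)) * (g x \<bullet> ?k x)"
        by (simp add: algebra_simps)
      also have "\<dots> = 2 * (a x * \<delta> x) * (g x \<bullet> ?k x)" using elim(1) by simp
      \<comment> \<open>Twice the form tested with \<open>\<delta> q(u)\<close> exceeds the form
        tested with its product by \<open>\<delta>\<close> exactly by a nonnegative term. The parts
        containing the gradient of \<open>\<delta>\<close> agree, because \<open>\<delta>\<close>
        squared differentiates to \<open>2 * \<delta>\<close> times \<open>d\<close>.\<close>
      also have "\<dots> = a x * (g x \<bullet> ?l x) + a x * ?q' x * (\<delta> x)\<^sup>2 * (g x \<bullet> g x)"
        by (simp add: inner_add_right power2_eq_square algebra_simps)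
      also have "\<dots> \<ge> a x * (g x \<bullet> ?l x)" using elim(2) lam softsign'_pos[OF e, of "u x"] by simp
      finally show ?case .
    qed
  qed
  also have "\<dots> = (2 * lam) * ((LINT x|lebesgue_on D. a x * (g x \<bullet> ?k x)) - (LINT x|lebesgue_on D. b x * (g x \<bullet> ?k x)))"
    by (simp only: integral_mult_right_zero Bochner_Integration.integral_diff[OF iag(2) ibg(2)])
  \<comment> \<open>Both equations have the same right side \<open>f\<close>, so the flux of the
    first solution may be exchanged for that of the second. What remains is the difference of the
    gradients, weighted by \<open>b\<close>.\<close>
  also have "(LINT x|lebesgue_on D. a x * (g x \<bullet> ?k x)) = (LINT x|lebesgue_on D. b x * (gb x \<bullet> ?k x))"
    unfolding A.test[OF wv v] B.test[OF wv v] ..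
  also have "(LINT x|lebesgue_on D. b x * (gb x \<bullet> ?k x)) - (LINT x|lebesgue_on D. b x * (g x \<bullet> ?k x))
      = (LINT x|lebesgue_on D. b x * (gb x \<bullet> ?k x) - b x * (g x \<bullet> ?k x))"
    by (rule Bochner_Integration.integral_diff[OF ibg, symmetric])
  also have "(2 * lam) * \<dots> \<le> (2 * lam) * (LINT x|lebesgue_on D. Lam * (norm (gb x - g x) * norm (?k x)))"
  proof (rule mult_left_mono[OF integral_mono_AE[OF Bochner_Integration.integrable_diff[OF ibg] integrable_mult_right[OF ink]]])
    show "AE x in lebesgue_on D. b x * (gb x \<bullet> ?k x) - b x * (g x \<bullet> ?k x) \<le> Lam * (norm (gb x - g x) * norm (?k x))"
      using B.a
    proof eventually_elim
      case (elim x)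
      have "b x * (gb x \<bullet> ?k x) - b x * (g x \<bullet> ?k x) = b x * ((gb x - g x) \<bullet> ?k x)"
        by (simp only: inner_diff_left right_diff_distrib)
      also have "\<dots> \<le> b x * (norm (gb x - g x) * norm (?k x))"
        using elim lam by (intro mult_left_mono norm_cauchy_schwarz) auto
      also have "\<dots> \<le> Lam * (norm (gb x - g x) * norm (?k x))"
        using elim by (intro mult_right_mono) auto
      finally show ?case .
    qed
  qed (use lam in simp)
  also have "(LINT x|lebesgue_on D. Lam * (norm (gb x - g x) * norm (?k x))) = Lam * (LINT x|lebesgue_on D. norm (gb x - g x) * norm (?k x))"
    by (rule integral_mult_right_zero)
  also have "(2 * lam) * \<dots> \<le> (2 * lam) * (Lam * (E * L2_norm D ?k))"
    unfolding E_def using Cauchy_Schwarz_L2_norm[OF diff_L2 kL(1)] lam Lam by (intro mult_left_mono) auto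
  also have "\<dots> \<le> (2 * lam) * (Lam * (E * sqrt (2 * Lam\<^sup>2 * (F * measure lebesgue D / (lam * e)) + 2 * (\<kappa> * G\<^sup>2))))"
  proof -
    note en = A.energy[OF e]
    have id: "integrable (lebesgue_on D) (\<lambda>x. (norm (d x))\<^sup>2)" using dL by (simp add: L2_def)
    \<comment> \<open>The part with \<open>g\<close> is paid for by \<open>energy\<close>, using the
      bound \<open>Lam\<close> on \<open>\<delta>\<close>; the part with \<open>d\<close> by
      \<open>d_norm\<close>, using that \<open>softsign\<close> is at most 1 in absolute
      value.\<close>
    have "(LINT x|lebesgue_on D. (norm (?k x))\<^sup>2) \<le> (LINT x|lebesgue_on D. (2 * Lam\<^sup>2) * ((?q' x)\<^sup>2 * (norm (g x))\<^sup>2) + 2 * (norm (d x))\<^sup>2)"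
    proof (rule integral_mono_AE[OF _ Bochner_Integration.integrable_add[OF integrable_mult_right[OF en(1)] integrable_mult_right[OF id]]])
      show "integrable (lebesgue_on D) (\<lambda>x. (norm (?k x))\<^sup>2)" using kL(1) unfolding L2_def by blast
      show "AE x in lebesgue_on D. (norm (?k x))\<^sup>2 \<le> (2 * Lam\<^sup>2) * ((?q' x)\<^sup>2 * (norm (g x))\<^sup>2) + 2 * (norm (d x))\<^sup>2"
        using \<delta>_le
      proof eventually_elim
        case (elim x)
        have "(\<delta> x)\<^sup>2 \<le> Lam\<^sup>2" using power_mono[OF elim, of 2] by simp
        then have "(\<delta> x)\<^sup>2 * ((?q' x)\<^sup>2 * (norm (g x))\<^sup>2) \<le> Lam\<^sup>2 * ((?q' x)\<^sup>2 * (norm (g x))\<^sup>2)"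
          by (rule mult_right_mono) simp
        then have 1: "(norm ((\<delta> x * ?q' x) *\<^sub>R g x))\<^sup>2 \<le> Lam\<^sup>2 * ((?q' x)\<^sup>2 * (norm (g x))\<^sup>2)"
          by (simp add: power_mult_distrib mult.assoc)
        have "(?q x)\<^sup>2 \<le> 1" using softsign_abs_le[OF e, of "u x"] by (simp add: abs_square_le_1)
        then have "(?q x)\<^sup>2 * (norm (d x))\<^sup>2 \<le> 1 * (norm (d x))\<^sup>2" by (rule mult_right_mono) simp
        then have 2: "(norm (?q x *\<^sub>R d x))\<^sup>2 \<le> (norm (d x))\<^sup>2" by (simp add: power_mult_distrib)
        show ?case using norm_add_square_le[of "(\<delta> x * ?q' x) *\<^sub>R g x" "?q x *\<^sub>R d x"] 1 2 by linarith
      qed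
    qed
    also have "\<dots> = (2 * Lam\<^sup>2) * (LINT x|lebesgue_on D. (?q' x)\<^sup>2 * (norm (g x))\<^sup>2) + 2 * (LINT x|lebesgue_on D. (norm (d x))\<^sup>2)"
      using en(1) id by simp
    also have "\<dots> \<le> (2 * Lam\<^sup>2) * (F * measure lebesgue D / (lam * e)) + 2 * (\<kappa> * G\<^sup>2)"
      using en(2) d_norm by (intro add_mono mult_left_mono) auto
    finally have "L2_norm D ?k \<le> sqrt (2 * Lam\<^sup>2 * (F * measure lebesgue D / (lam * e)) + 2 * (\<kappa> * G\<^sup>2))"
      unfolding L2_norm_def by (rule real_sqrt_le_mono)
    then show ?thesis using lam Lam E_nonneg by (intro mult_left_mono) auto
  qed
  finally show "cf * (LINT x|lebesgue_on D. (\<delta> x)\<^sup>2 * ?q x)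
      \<le> 2 * lam * Lam * E * sqrt (2 * Lam\<^sup>2 * (F * measure lebesgue D / (lam * e)) + 2 * (\<kappa> * G\<^sup>2))"
    by (simp only: mult.assoc)
qed

section \<open>From the weighted estimate to the difference of the coefficients\<close>

definition N :: real where "N = L2_norm D (\<lambda>x. a x - b x)"

text \<open>The fraction is the product of \<open>2 * (Lam / lam)\<^sup>2\<close>, the cost of
  recovering the difference \<open>a x - b x\<close> from \<open>\<delta>\<close> where
  \<open>u x \<ge> e\<close>, and of \<open>2 * lam * Lam / cf\<close> from
  \<open>weighted_difference\<close>. The two roots are the coefficients of
  \<open>sqrt (F / e)\<close> and of \<open>G\<close>.\<close>

definition K1 :: real where
  "K1 = 4 * Lam ^ 3 / (lam * cf) * (sqrt (2 * Lam\<^sup>2 * (measure lebesgue D / lam)) + sqrt (2 * \<kappa>))"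

lemma N_square_trivial: "N\<^sup>2 \<le> Lam\<^sup>2 * measure lebesgue D"
proof -
  have i: "integrable (lebesgue_on D) (\<lambda>x. (a x - b x)\<^sup>2)"
    using sq_integrable_square[OF sq_integrable_bounded[OF A.fin _ ab_le]] by measurable
  have "N\<^sup>2 = (LINT x|lebesgue_on D. (a x - b x)\<^sup>2)" by (simp add: N_def L2_norm_square)
  also have "\<dots> \<le> (LINT x|lebesgue_on D. Lam\<^sup>2)"
  proof (rule integral_mono_AE[OF i finite_measure.integrable_const[OF A.fin]])
    show "AE x in lebesgue_on D. (a x - b x)\<^sup>2 \<le> Lam\<^sup>2"
      using ab_le
    proof eventually_elim
      case (elim x)
      then show ?case using power_mono[OF elim, of 2] by simp
    qed
  qed
  also have "\<dots> = Lam\<^sup>2 * measure lebesgue D" using A.Dl by (simp add: measure_restrict_space)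
  finally show ?thesis .
qed

text \<open>Where \<open>u x \<ge> e\<close> the weight \<open>softsign e (u x)\<close> is at least
  1/2 and the difference \<open>a x - b x\<close> is \<open>(a x / lam) * \<delta> x\<close>, so the
  weighted estimate applies. Elsewhere the difference is bounded by \<open>Lam\<close>, and the
  measure of the exceptional set is of order \<open>sqrt e\<close>.\<close>

lemma N_square_le:
  assumes e: "e > 0" and C: "\<And>t. 0 < t \<Longrightarrow> measure lebesgue {x \<in> D. infdist x (- D) \<le> t} \<le> C * t" "C \<ge> 0"
  shows "N\<^sup>2 \<le> K1 * E * (sqrt (F / e) + G) + Lam\<^sup>2 * (C * (1 + 32 * real DIM('a) * Lam / cf)) * sqrt e"
proof -
  let ?S = "{x \<in> D. u x < e}"
  note WD = weighted_difference[OF e]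
  have Ds: "D \<in> sets lebesgue" using A.Dl by (rule fmeasurableD)
  have Ssl: "?S \<in> sets lebesgue"
  proof -
    have "{x \<in> space (lebesgue_on D). u x < e} \<in> sets (lebesgue_on D)" using A.um by measurable
    then show ?thesis using Ds by (simp add: sets_restrict_space_iff)
  qed
  have Sl: "?S \<in> lmeasurable" by (rule fmeasurableI2[OF A.Dl _ Ssl]) auto
  have iS: "integrable (lebesgue_on D) (indicator ?S :: 'a \<Rightarrow> real)"
    and mS: "(LINT x|lebesgue_on D. indicator ?S x) = measure lebesgue ?S"
    by (rule indicator_lebesgue_on[OF Ds Sl], blast)+
  have i: "integrable (lebesgue_on D) (\<lambda>x. (a x - b x)\<^sup>2)"
    using sq_integrable_square[OF sq_integrable_bounded[OF A.fin _ ab_le]] by measurable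
  let ?c = "2 * (Lam / lam)\<^sup>2"
  have "N\<^sup>2 = (LINT x|lebesgue_on D. (a x - b x)\<^sup>2)" by (simp add: N_def L2_norm_square)
  also have "\<dots> \<le> (LINT x|lebesgue_on D. ?c * ((\<delta> x)\<^sup>2 * softsign e (u x)) + Lam\<^sup>2 * indicator ?S x)"
  proof (rule integral_mono_AE[OF i Bochner_Integration.integrable_add[OF integrable_mult_right[OF WD(1)] integrable_mult_right[OF iS]]])
    have "AE x in lebesgue_on D. x \<in> space (lebesgue_on D)" by (rule AE_space)
    then show "AE x in lebesgue_on D. (a x - b x)\<^sup>2 \<le> ?c * ((\<delta> x)\<^sup>2 * softsign e (u x)) + Lam\<^sup>2 * indicator ?S x"
      using ab_le \<delta>_eq A.a A.u_nonneg
    proof eventually_elim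
      case (elim x)
      have q: "softsign e (u x) \<ge> 0" using softsign_neg_iff[OF e, of "u x"] elim(5) by linarith
      then have nn: "0 \<le> ?c * ((\<delta> x)\<^sup>2 * softsign e (u x))" by simp
      show ?case
      proof (cases "x \<in> ?S")
        case True
        have "(a x - b x)\<^sup>2 \<le> Lam\<^sup>2" using power_mono[OF elim(2), of 2] by simp
        moreover have "indicator ?S x = (1::real)" using True by simp
        ultimately show ?thesis using add_increasing[OF nn] by (simp only: mult_1_right)
      next
        case False
        then have ue: "u x \<ge> e" using elim(1) by auto
        have "e / (e + u x) \<le> 1 / 2" using ue e by (simp add: field_simps)
        then have q2: "1 / 2 \<le> softsign e (u x)" using softsign_nonneg_identity(2)[OF e elim(5)] by linarith
        have "a x - b x = (a x / lam) * \<delta> x" using elim(3) lam by (simp add: field_simps)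
        then have "(a x - b x)\<^sup>2 = (a x / lam)\<^sup>2 * (\<delta> x)\<^sup>2" by (simp only: power_mult_distrib)
        also have "\<dots> \<le> (Lam / lam)\<^sup>2 * (\<delta> x)\<^sup>2"
          using elim(4) lam by (intro mult_right_mono power_mono divide_right_mono) auto
        also have "\<dots> \<le> (Lam / lam)\<^sup>2 * (\<delta> x)\<^sup>2 * (2 * softsign e (u x))"
          using mult_left_mono[of 1 "2 * softsign e (u x)" "(Lam / lam)\<^sup>2 * (\<delta> x)\<^sup>2"] q2 by simp
        finally show ?thesis using False by (simp add: mult_ac)
      qed
    qed
  qed
  also have "\<dots> = ?c * (LINT x|lebesgue_on D. (\<delta> x)\<^sup>2 * softsign e (u x)) + Lam\<^sup>2 * measure lebesgue ?S"
    using WD(1) iS mS by simp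
  also have "\<dots> \<le> K1 * E * (sqrt (F / e) + G) + Lam\<^sup>2 * (C * (1 + 32 * real DIM('a) * Lam / cf) * sqrt e)"
  proof (rule add_mono)
    show "Lam\<^sup>2 * measure lebesgue ?S \<le> Lam\<^sup>2 * (C * (1 + 32 * real DIM('a) * Lam / cf) * sqrt e)"
      by (intro mult_left_mono A.sublevel_measure[OF e C Lam]) auto
    have G0: "G \<ge> 0" using G(1) by (rule order_trans[rotated]) (simp add: L2_norm_def)
    have k0: "\<kappa> \<ge> 0" by (simp add: \<kappa>_def)
    define S1 where "S1 = sqrt (2 * Lam\<^sup>2 * (measure lebesgue D / lam))"
    define S2 where "S2 = sqrt (2 * \<kappa>)"
    have S0: "S1 \<ge> 0" "S2 \<ge> 0" using lam k0 by (auto simp: S1_def S2_def)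
    \<comment> \<open>The root of the sum is split by subadditivity; adding the nonnegative cross
      terms then lets the constants factor out of \<open>sqrt (F / e) + G\<close>.\<close>
    let ?X = "2 * Lam\<^sup>2 * (F * measure lebesgue D / (lam * e))" and ?Y = "2 * (\<kappa> * G\<^sup>2)"
    have "?X = (2 * Lam\<^sup>2 * (measure lebesgue D / lam)) * (F / e)" using lam e by simp
    then have X: "sqrt ?X = S1 * sqrt (F / e)" unfolding S1_def by (simp only: real_sqrt_mult)
    have Y: "sqrt ?Y = S2 * G" unfolding S2_def using G0 by (simp add: real_sqrt_mult)
    have "sqrt (?X + ?Y) \<le> sqrt ?X + sqrt ?Y"
      using F e lam k0 by (intro sqrt_add_le_add_sqrt) auto
    moreover have "S1 * sqrt (F / e) + S2 * G \<le> (S1 + S2) * (sqrt (F / e) + G)"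
      using S0 G0 F e by (simp add: distrib_left distrib_right)
    ultimately have sq: "sqrt (?X + ?Y) \<le> (S1 + S2) * (sqrt (F / e) + G)"
      unfolding X Y by (rule order_trans)
    let ?I = "LINT x|lebesgue_on D. (\<delta> x)\<^sup>2 * softsign e (u x)"
    have "cf * ?I \<le> 2 * lam * Lam * E * ((S1 + S2) * (sqrt (F / e) + G))"
    proof (rule order_trans[OF WD(2) mult_left_mono[OF sq]])
      show "0 \<le> 2 * lam * Lam * E" using lam Lam E_nonneg by simp
    qed
    then have "?I \<le> 2 * lam * Lam * E * ((S1 + S2) * (sqrt (F / e) + G)) / cf"
      unfolding pos_le_divide_eq[OF cf] by (simp only: mult.commute[of _ cf])
    then have "?c * ?I \<le> ?c * (2 * lam * Lam * E * ((S1 + S2) * (sqrt (F / e) + G)) / cf)"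
      by (rule mult_left_mono) simp
    also have "\<dots> = K1 * E * (sqrt (F / e) + G)"
      using lam cf unfolding K1_def S1_def[symmetric] S2_def[symmetric]
      by (simp add: power2_eq_square power3_eq_cube)
    finally show "?c * ?I \<le> K1 * E * (sqrt (F / e) + G)" .
  qed
  finally show ?thesis by (simp only: mult.assoc)
qed

end

text \<open>The optimal truncation level is \<open>e = E powr (2/3)\<close>; for \<open>E \<ge> 1\<close> the trivial bound suffices.\<close>

lemma optimize_truncation:
  fixes N E G F cf K0 K1 K2 :: real
  assumes nn: "N \<ge> 0" "E \<ge> 0" "G \<ge> 0" "cf > 0" "cf \<le> F" "K0 \<ge> 0" "K1 \<ge> 0" "K2 \<ge> 0"
    and triv: "N\<^sup>2 \<le> K0" and main: "\<And>e. e > 0 \<Longrightarrow> N\<^sup>2 \<le> K1 * E * (sqrt (F / e) + G) + K2 * sqrt e"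
  shows "N \<le> sqrt (K0 + K1 * (1 + 1 / cf) + K2 + 1) * sqrt (1 + F * (1 + G)) * E powr (1 / 6)"
proof -
  define K where "K = K0 + K1 * (1 + 1 / cf) + K2"
  have K: "K \<ge> 0" "K0 \<le> K" unfolding K_def using nn by auto
  define C0 where "C0 = F * (1 + G)"
  have F: "F > 0" using nn by linarith
  have C0: "C0 \<ge> 0" "F \<le> C0" unfolding C0_def using F nn by auto
  \<comment> \<open>The term with \<open>G\<close> alone carries no factor \<open>F\<close>, whereas
    \<open>C0\<close> does; \<open>cf \<le> F\<close> bridges this and produces the
    \<open>1 / cf\<close> in the constant.\<close>
  have GC: "G \<le> C0 / cf"
  proof -
    have "cf * G \<le> F * (1 + G)" using nn by (intro mult_mono) auto
    then show ?thesis using nn by (simp add: C0_def le_divide_eq mult.commute)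
  qed
  have N2: "N\<^sup>2 \<le> K * (1 + C0) * E powr (1 / 3)"
  proof -
    consider "E = 0" | "0 < E" "E < 1" | "E \<ge> 1" using nn(2) by linarith
    then show ?thesis
    proof cases
      case 1
      \<comment> \<open>\<open>0 powr (1 / 3)\<close> is 0, so \<open>N\<close> must vanish: only
        the term \<open>K2 * sqrt e\<close> survives, and \<open>e\<close> can be taken arbitrarily
        small.\<close>
      have "N\<^sup>2 \<le> 0"
      proof (rule field_le_epsilon)
        fix r :: real assume r: "r > 0"
        define s where "s = r / (K2 + 1)"
        have s: "s > 0" using r nn by (simp add: s_def)
        have "N\<^sup>2 \<le> K2 * s" using main[of "s\<^sup>2"] 1 s by simp
        also have "\<dots> \<le> r" using r nn by (simp add: s_def field_simps)
        finally show "N\<^sup>2 \<le> 0 + r" by simp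
      qed
      then show ?thesis using 1 by simp
    next
      case 2
      \<comment> \<open>The level is the square of \<open>x\<close>, so its root is
        \<open>x\<close>, the power of \<open>E\<close> wanted for the square of \<open>N\<close>.
        The other two terms are of order \<open>x\<close> squared and \<open>x\<close> cubed, hence
        dominated by \<open>x\<close> since \<open>x \<le> 1\<close>.\<close>
      define x where "x = E powr (1 / 3)"
      have x: "0 < x" "x \<le> 1" using 2 by (auto simp: x_def powr_le1)
      have Ex: "E = x ^ 3" unfolding x_def using 2 by (simp add: powr_realpow[symmetric] powr_powr)
      have s: "sqrt (x\<^sup>2) = x" using x by simp
      have "N\<^sup>2 \<le> K1 * x ^ 3 * (sqrt (F / x\<^sup>2) + G) + K2 * sqrt (x\<^sup>2)"
        using main[of "x\<^sup>2"] x by (simp add: Ex)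
      also have "sqrt (F / x\<^sup>2) = sqrt F / x" using x by (simp add: real_sqrt_divide)
      also have "K1 * x ^ 3 * (sqrt F / x + G) + K2 * sqrt (x\<^sup>2) = (K1 * (x * sqrt F + x\<^sup>2 * G) + K2) * x"
        using x by (simp add: s power3_eq_cube power2_eq_square field_simps)
      also have "\<dots> \<le> (K * (1 + C0)) * x"
      proof (rule mult_right_mono)
        have Keq: "K * (1 + C0) = K0 * (1 + C0) + K1 * ((1 + C0) * (1 + 1 / cf)) + K2 * (1 + C0)"
          by (simp add: K_def algebra_simps)
        have "sqrt F \<le> 1 + C0"
        proof -
          have "F \<le> (1 + C0)\<^sup>2" using C0 by (simp add: power2_eq_square algebra_simps add_increasing)
          then show ?thesis using C0 real_sqrt_le_mono[of F "(1 + C0)\<^sup>2"] by simp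
        qed
        moreover have "x * sqrt F \<le> sqrt F" using x F by (simp add: mult_left_le_one_le)
        moreover have "x\<^sup>2 * G \<le> G" using x nn by (simp add: mult_left_le_one_le power_le_one)
        moreover have "C0 / cf \<le> (1 + C0) * (1 / cf)" using nn by (simp add: divide_right_mono)
        ultimately have "x * sqrt F + x\<^sup>2 * G \<le> (1 + C0) * (1 + 1 / cf)"
          using GC by (simp add: distrib_left)
        then have "K1 * (x * sqrt F + x\<^sup>2 * G) \<le> K1 * ((1 + C0) * (1 + 1 / cf))" using nn by (intro mult_left_mono) auto
        moreover have "K2 \<le> K2 * (1 + C0)" "0 \<le> K0 * (1 + C0)" using nn C0 by (auto simp: distrib_left)
        ultimately show "K1 * (x * sqrt F + x\<^sup>2 * G) + K2 \<le> K * (1 + C0)"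
          unfolding Keq by linarith
      qed (use x in simp)
      finally show ?thesis by (simp add: x_def)
    next
      case 3
      have "1 \<le> E powr (1 / 3)" using 3 by (simp add: ge_one_powr_ge_zero)
      then have "1 * 1 \<le> (1 + C0) * E powr (1 / 3)" using C0 by (intro mult_mono) auto
      then have "K * 1 \<le> K * ((1 + C0) * E powr (1 / 3))" using K by (intro mult_left_mono) auto
      then show ?thesis using triv K by (simp add: mult.assoc)
    qed
  qed
  have "N \<le> sqrt (K * (1 + C0) * E powr (1 / 3))" using N2 by (rule real_le_rsqrt)
  \<comment> \<open>Passing to \<open>K + 1\<close> makes the final constant strictly
    positive.\<close>
  also have "\<dots> \<le> sqrt ((K + 1) * (1 + C0) * E powr (1 / 3))"
    using K C0 by (intro real_sqrt_le_mono mult_right_mono) auto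
  also have "\<dots> = sqrt (K + 1) * sqrt (1 + C0) * E powr (1 / 6)"
  proof -
    have "sqrt (E powr (1 / 3)) = E powr (1 / 6)"
      by (simp add: powr_half_sqrt[symmetric] powr_powr)
    then show ?thesis by (simp add: real_sqrt_mult)
  qed
  finally show ?thesis by (simp add: K_def C0_def)
qed

section \<open>Essential bounds and assembly\<close>

text \<open>\<open>real_of_ereal\<close> sends both infinities to 0, so neither may be the essential
  supremum: plus infinity is excluded by membership in \<open>Linf D\<close>, minus infinity because
  it would force the almost everywhere statement to be false at every point.\<close>

lemma Linf_AE_bound:
  assumes "f \<in> Linf D" "\<not> (AE x in lebesgue_on D. False)"
  shows "AE x in lebesgue_on D. \<bar>f x\<bar> \<le> Linf_norm D f"
proof -
  let ?s = "esssup (lebesgue_on D) (\<lambda>x. ereal \<bar>f x\<bar>)"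
  have lt: "?s < \<infinity>" using assms(1) by (simp add: Linf_def)
  have ae: "AE x in lebesgue_on D. ereal \<bar>f x\<bar> \<le> ?s" by (rule esssup_AE)
  have "?s \<noteq> - \<infinity>"
  proof
    assume "?s = - \<infinity>"
    then show False using ae assms(2) by simp
  qed
  then have "ereal (Linf_norm D f) = ?s" using lt unfolding Linf_norm_def by (intro ereal_real') auto
  then show ?thesis using ae by (metis (mono_tags, lifting) eventually_mono ereal_less_eq(3))
qed

lemma open_measure_pos:
  fixes D :: "'a::euclidean_space set"
  assumes "open D" "bounded D" "D \<noteq> {}"
  shows "measure lebesgue D > 0"
proof -
  obtain x r where x: "r > 0" "ball x r \<subseteq> D" using assms(1,3) by (meson ex_in_conv open_contains_ball)
  have "0 < measure lebesgue (ball x r)" using x(1) content_ball_pos[of r x] by simp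
  also have "\<dots> \<le> measure lebesgue D"
    using assms x(2) by (intro measure_mono_fmeasurable) (auto simp: lmeasurable_open)
  finally show ?thesis .
qed

theorem corollary3p8:
  fixes D :: "(real ^ 'n) set" and lam Lam :: real
  assumes "CARD('n) \<ge> 2"
    and "lipschitz_domain D"
    and "lam > 0" and "Lam > 0"
  shows "\<exists>C1>0. \<forall>cf>0. \<exists>C>0. \<forall>M>0. \<forall>a\<in>coeffs_H1 D lam Lam M. \<forall>b\<in>coeffs_H1 D lam Lam M.
    \<forall>f\<in>Linf D. \<forall>ua ub.
      (AE x in lebesgue_on D. f x \<ge> cf) \<longrightarrow>
      weak_solution D a (functional_of D f) ua \<longrightarrow>
      weak_solution D b (functional_of D f) ub \<longrightarrow>
      (let C0 = C1 * Linf_norm D f *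
                (1 + max (L2_norm D (weak_grad D a)) (L2_norm D (weak_grad D b)))
       in L2_norm D (\<lambda>x. a x - b x)
            \<le> C * sqrt (1 + C0) * (H10_norm D (\<lambda>x. ua x - ub x)) powr (1/6))"
proof (rule exI[of _ "1::real"], intro conjI allI impI)
  \<comment> \<open>The witness for \<open>C1\<close> is 1; the dependence on the domain, the
    dimension, \<open>lam\<close>, \<open>Lam\<close> and \<open>cf\<close> is carried by
    \<open>C\<close>.\<close>
  fix cf :: real assume cf: "cf > 0"
  have D: "open D" "bounded D" "D \<noteq> {}"
    using assms(2) by (auto simp: lipschitz_domain_def bounded_domain_def)
  have Dl: "D \<in> lmeasurable" using D by (simp add: lmeasurable_open)
  have Ds: "D \<in> sets lebesgue" using Dl by (rule fmeasurableD)
  have mpos: "measure lebesgue D > 0" by (rule open_measure_pos[OF D])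
  note notAE = not_AE_False[OF Dl mpos]
  obtain S where S: "S > 0" "\<And>t. 0 < t \<Longrightarrow> measure lebesgue {x \<in> D. infdist x (- D) \<le> t} \<le> S * t"
    using lipschitz_domain_boundary_strip[OF assms(2)] by blast
  let ?\<kappa> = "2 * (Lam / lam + 1)\<^sup>2 + 2"
  \<comment> \<open>The constants of \<open>N_square_trivial\<close> and \<open>N_square_le\<close>,
    written out before the coefficients and \<open>f\<close> are fixed, so that \<open>C\<close>
    cannot depend on them.\<close>
  define A0 where "A0 = Lam\<^sup>2 * measure lebesgue D"
  define A1 where "A1 = 4 * Lam ^ 3 / (lam * cf) * (sqrt (2 * Lam\<^sup>2 * (measure lebesgue D / lam)) + sqrt (2 * ?\<kappa>))"
  define A2 where "A2 = Lam\<^sup>2 * (S * (1 + 32 * real DIM(real ^ 'n) * Lam / cf))"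
  have A: "A0 \<ge> 0" "A1 \<ge> 0" "A2 \<ge> 0"
    using assms(3,4) cf S(1) by (auto simp: A0_def A1_def A2_def intro!: mult_nonneg_nonneg add_nonneg_nonneg)
  let ?C = "sqrt (A0 + A1 * (1 + 1 / cf) + A2 + 1)"
  show "\<exists>C>0. \<forall>M>0. \<forall>a\<in>coeffs_H1 D lam Lam M. \<forall>b\<in>coeffs_H1 D lam Lam M.
    \<forall>f\<in>Linf D. \<forall>ua ub.
      (AE x in lebesgue_on D. f x \<ge> cf) \<longrightarrow>
      weak_solution D a (functional_of D f) ua \<longrightarrow>
      weak_solution D b (functional_of D f) ub \<longrightarrow>
      (let C0 = 1 * Linf_norm D f *
                (1 + max (L2_norm D (weak_grad D a)) (L2_norm D (weak_grad D b)))
       in L2_norm D (\<lambda>x. a x - b x)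
            \<le> C * sqrt (1 + C0) * (H10_norm D (\<lambda>x. ua x - ub x)) powr (1/6))"
  proof (intro exI[of _ ?C] conjI allI ballI impI)
    have "0 \<le> A1 * (1 + 1 / cf)" using A cf by (intro mult_nonneg_nonneg) auto
    then show "?C > 0" using A by simp
    fix M :: real and a b f ua ub :: "real ^ 'n \<Rightarrow> real"
    assume "M > 0" and a: "a \<in> coeffs_H1 D lam Lam M" and b: "b \<in> coeffs_H1 D lam Lam M"
      and f: "f \<in> Linf D" "AE x in lebesgue_on D. cf \<le> f x"
      and sa: "weak_solution D a (functional_of D f) ua" and sb: "weak_solution D b (functional_of D f) ub"
    have c: "a \<in> borel_measurable (lebesgue_on D)" "AE x in lebesgue_on D. lam \<le> a x \<and> a x \<le> Lam" "a \<in> H1 D"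
      "b \<in> borel_measurable (lebesgue_on D)" "AE x in lebesgue_on D. lam \<le> b x \<and> b x \<le> Lam" "b \<in> H1 D"
      using a b by (auto simp: coeffs_H1_def coeffs_def Linf_def)
    have fm: "f \<in> borel_measurable (lebesgue_on D)" using f(1) by (simp add: Linf_def)
    have fb: "AE x in lebesgue_on D. \<bar>f x\<bar> \<le> Linf_norm D f" by (rule Linf_AE_bound[OF f(1) notAE])
    have uH: "ua \<in> H1 D" "ub \<in> H1 D" using sa sb by (auto simp: weak_solution_def H10_def)
    note g = uH[THEN has_weak_gradient_weak_grad]
    let ?F = "Linf_norm D f" and ?G = "max (L2_norm D (weak_grad D a)) (L2_norm D (weak_grad D b))"
    \<comment> \<open>The lower and the upper bound for \<open>f\<close> hold at a common point
      because \<open>D\<close> has positive measure.\<close>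
    have cF: "cf \<le> ?F"
    proof (rule ccontr)
      assume "\<not> cf \<le> ?F"
      then have "AE x in lebesgue_on D. False" by (intro eventually_elim2[OF f(2) fb]) auto
      then show False using notAE by blast
    qed
    have dab: "has_weak_gradient D a (weak_grad D a)" "has_weak_gradient D b (weak_grad D b)"
      using c(3,6) by (simp_all add: has_weak_gradient_weak_grad)
    have G: "L2_norm D (weak_grad D a) \<le> ?G" "L2_norm D (weak_grad D b) \<le> ?G" by simp_all
    have Fnn: "0 \<le> ?F" using cF cf by simp
    interpret diffusion_pair D a b f ua ub "weak_grad D ua" "weak_grad D ub" lam Lam cf ?F
      "weak_grad D a" "weak_grad D b" ?G
      by unfold_locales
         (fact D assms(3,4) cf c fm f(2) fb sa sb g dab G Fnn)+
    \<comment> \<open>\<open>H10_norm\<close> refers to the selected gradient of the difference,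
      \<open>E\<close> to the difference of the selected gradients in the opposite order; they agree
      almost everywhere up to sign.\<close>
    have "has_weak_gradient D (\<lambda>x. ua x - ub x) (\<lambda>x. weak_grad D ua x - weak_grad D ub x)"
      by (rule has_weak_gradient_diff[OF g Dl])
    note w = this weak_grad_AE_eq[OF D(1,2) this]
    have "(LINT x|lebesgue_on D. (norm (weak_grad D (\<lambda>x. ua x - ub x) x))\<^sup>2) = (LINT x|lebesgue_on D. (norm (weak_grad D ub x - weak_grad D ua x))\<^sup>2)"
    proof (rule integral_cong_AE)
      show "AE x in lebesgue_on D. (norm (weak_grad D (\<lambda>x. ua x - ub x) x))\<^sup>2 = (norm (weak_grad D ub x - weak_grad D ua x))\<^sup>2"
        using w(2) by eventually_elim (simp add: norm_minus_commute)
      have "weak_grad D (\<lambda>x. ua x - ub x) \<in> borel_measurable (lebesgue_on D)"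
        using has_weak_gradient_weak_grad[OF H1I[OF w(1)]] by (simp add: has_weak_gradient_def L2_def)
      then show "(\<lambda>x. (norm (weak_grad D (\<lambda>x. ua x - ub x) x))\<^sup>2) \<in> borel_measurable (lebesgue_on D)" by measurable
      show "(\<lambda>x. (norm (weak_grad D ub x - weak_grad D ua x))\<^sup>2) \<in> borel_measurable (lebesgue_on D)"
        using diff_L2 unfolding L2_def by auto
    qed
    then have E: "H10_norm D (\<lambda>x. ua x - ub x) = E" by (simp add: H10_norm_def E_def L2_norm_def)
    have "N \<le> ?C * sqrt (1 + ?F * (1 + ?G)) * E powr (1 / 6)"
    proof (rule optimize_truncation)
      show "N \<ge> 0" by (simp add: N_def L2_norm_def)
      show "?G \<ge> 0" by (simp add: L2_norm_def le_max_iff_disj)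
      show "N\<^sup>2 \<le> A0" unfolding A0_def by (rule N_square_trivial)
      show "N\<^sup>2 \<le> A1 * E * (sqrt (?F / e) + ?G) + A2 * sqrt e" if "e > 0" for e
        using N_square_le[OF that S(2)] S(1) unfolding A1_def A2_def K1_def \<kappa>_def by simp
    qed (use E_nonneg cf cF A in auto)
    then show "let C0 = 1 * Linf_norm D f * (1 + ?G)
       in L2_norm D (\<lambda>x. a x - b x) \<le> ?C * sqrt (1 + C0) * (H10_norm D (\<lambda>x. ua x - ub x)) powr (1/6)"
      by (simp add: E N_def)
  qed
qed simp

end
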